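(* Let $n\ge 1$, $r\ge 2$ and $0\le a_2,\dots,a_n\le r-1$ be integers, and let $G\subset \mathrm{GL}(n,\mathbb{C})$ be the cyclic group of type $\frac1r(1,a_2,\dots,a_n)$, i.e. generated by $\mathrm{diag}(\varepsilon,\varepsilon^{a_2},\dots,\varepsilon^{a_n})$ with $\varepsilon$ a primitive $r$-th root of unity (so $|G|=r$). Let $f:Y\to\mathbb{C}^n/G$ be the Fujiki-Oka resolution. Then $$\chi(Y)=\mathrm{height}\left(\mathcal{R}_*\left(\frac{(1,a_2,\dots,a_n)}{r}\right)\right)+r,$$ where $\chi(Y)$ is the topological Euler characteristic of $Y$ and $\mathcal{R}_*$ denotes the remainder polynomial.
   Context: **Proper fractions.** An $n$-dimensional proper fraction is a symbol $\frac{\mathbf a}{r}=\frac{(a_1,\dots,a_n)}{r}$ with $r$ a positive integer and integers $0\le a_i\le r-1$ (it is a formal symbol: no cancellation of common factors). It is semi-unimodular if at least one $a_i$ equals $1$. $\overline{\mathbb{Q}^{prop}_n}$ is the set of $n$-dimensional proper fractions together with a symbol $\infty$. **Remainder maps.** For $1\le i\le n$, the $i$-th remainder map is $R_i\left(\frac{(a_1,\dots,a_n)}{r}\right)=\frac{(\overline{a_1}^{a_i},\dots,\overline{-r}^{a_i},\dots,\overline{a_n}^{a_i})}{a_i}$ if $a_i\ne0$ (with $\overline{-r}^{a_i}$ in position $i$ and $\overline{a_j}^{a_i}$ in position $j\neq i$), and $\infty$ if $a_i=0$; also $R_i(\infty)=\infty$. Here $\overline{b}^{m}$ is the integer with $0\le\overline{b}^{m}<m$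 and $\overline{b}^{m}\equiv b \pmod m$. **Remainder polynomial.** For a semi-unimodular proper fraction $\frac{\mathbf a}{r}$, the remainder polynomial is the noncommutative polynomial in $x_1,\dots,x_n$ $$\mathcal{R}_*\left(\tfrac{\mathbf a}{r}\right)=\tfrac{\mathbf a}{r}+\sum_{l\ge1}\ \sum_{(i_1,\dots,i_l)\in\{1,\dots,n\}^l}(R_{i_l}\cdots R_{i_2}R_{i_1})\left(\tfrac{\mathbf a}{r}\right)x_{i_1}x_{i_2}\cdots x_{i_l},$$ where terms with coefficient $\infty$ or $\frac{(0,\dots,0)}{1}$ are excluded. (Finitely many terms remain, since denominators strictly decrease.) **Height.** The height of a proper fraction $\frac{(a_1,\dots,a_n)}{r}$ is $\sum_{i=1}^n a_i-r$. The height of a remainder polynomial is the sum of the heights of all its coefficients (one for each remaining monomial, including the constant term). **Fujiki-Oka resolution.** Let $e_1,\dots,e_n$ be the standard basis of $\mathbb{R}^n$, $N_G=\mathbb{Z}^n+\mathbb{Z}\cdot\frac1r(1,a_2,\dots,a_n)\subset\mathbb{R}^n$, and $\sigma_0=\mathrm{Cone}(e_1,\dots,e_n)$, so that the affine toric variety $X(N_G,\sigma_0)$ is $\mathbb{C}^n/G$. Start with the cone $\sigma_0$, with ordered generators $(e_1,\dots,e_n)$, labelled by the proper fraction $\frac{(1,a_2,\dots,a_n)}{r}$. Given a cone with ordered generators $(u_1,\dots,u_n)$ labelled by $\frac{(c_1,\dots,c_n)}{s}\neq\frac{(0,\dots,0)}{1}$, where $N_G=\sum_i\mathbb{Z}u_i+\mathbb{Z}w$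 with $w=\frac1s\sum_i c_iu_i$, replace it by its star subdivision at $w$: for each $i$ with $c_i\neq0$, take the $n$-dimensional cone with ordered generators $(u_1,\dots,u_{i-1},w,u_{i+1},\dots,u_n)$, labelled by $R_i\left(\frac{(c_1,\dots,c_n)}{s}\right)$ (which again describes $N_G$ relative to the new generators in the same way). Cones labelled by $\frac{(0,\dots,0)}{1}$ (those whose generators form a $\mathbb{Z}$-basis of $N_G$) are left unchanged. The process terminates, and the final cones and their faces form a smooth fan $\Sigma$ subdividing $\sigma_0$; the induced toric morphism $f:Y=X(N_G,\Sigma)\to X(N_G,\sigma_0)=\mathbb{C}^n/G$ is the Fujiki-Oka resolution. *)

theory Defs
  imports "HOL-Analysis.Analysis" "HOL-Homology.Homology"
begin

section \<open>Proper fractions and remainder polynomials\<close>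

text \<open>
  The index type \<open>'n\<close> plays the role of \<open>{1,\<dots>,n}\<close>.  A fraction is a formal symbol, so no
  common factors are cancelled.  The operations below are meant for proper fractions, where the
  denominator is positive and every numerator entry is nonnegative and less than the denominator.
\<close>

datatype ('n::finite) fraction = Frac (numer: "int ^ 'n") (denom: int)

text \<open>In the type \<open>'n fraction option\<close>, the symbol \<open>\<infinity>\<close> is represented by \<^const>\<open>None\<close>.\<close>

fun remainder_map :: "('n::finite) \<Rightarrow> 'n fraction option \<Rightarrow> 'n fraction option" where
  "remainder_map i None = None"
| "remainder_map i (Some (Frac a r)) =
     (if a $ i = 0 then None
      else Some (Frac (\<chi> j. if j = i then (- r) mod (a $ i) else (a $ j) mod (a $ i)) (a $ i)))"

text \<open>
  A noncommutative polynomial is a partial map from words to coefficients, where the word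
  \<open>[i\<^sub>1, \<dots>, i\<^sub>l]\<close> stands for the monomial \<open>x\<^sub>i\<^sub>1 \<cdots> x\<^sub>i\<^sub>l\<close> and \<open>[]\<close> for the
  constant monomial.  Note that \<open>fold f [i\<^sub>1, \<dots>, i\<^sub>l]\<close> applies \<open>f i\<^sub>1\<close> first.
\<close>

definition remainder_polynomial :: "('n::finite) fraction \<Rightarrow> 'n list \<Rightarrow> 'n fraction option" where
  "remainder_polynomial q w =
     (let c = fold remainder_map w (Some q) in if c = Some (Frac 0 1) then None else c)"

definition height :: "('n::finite) fraction \<Rightarrow> int" where
  "height q = (\<Sum>i\<in>UNIV. numer q $ i) - denom q"

definition poly_height :: "(('n::finite) list \<Rightarrow> 'n fraction option) \<Rightarrow> int" where
  "poly_height P = (\<Sum>w\<in>dom P. height (the (P w)))"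


section \<open>Toric varieties with the classical topology\<close>

definition dual_lattice :: "(real ^ 'n) set \<Rightarrow> (real ^ 'n) set" where
  "dual_lattice N = {m. \<forall>v\<in>N. m \<bullet> v \<in> \<int>}"

definition dual_cone :: "(real ^ 'n) set \<Rightarrow> (real ^ 'n) set" where
  "dual_cone \<sigma> = {m. \<forall>v\<in>\<sigma>. 0 \<le> m \<bullet> v}"

definition cone_semigroup :: "(real ^ 'n) set \<Rightarrow> (real ^ 'n) set \<Rightarrow> (real ^ 'n) set" where
  "cone_semigroup N \<sigma> = dual_cone \<sigma> \<inter> dual_lattice N"

text \<open>
  The points of the affine toric variety of a cone \<open>\<sigma>\<close>, i.e. of the spectrum of the semigroup
  algebra over the complex numbers, are the monoid homomorphisms from the semigroup of \<open>\<sigma>\<close> to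
  the multiplicative monoid of complex numbers.  The classical topology is that of pointwise
  convergence, since evaluation at finitely many semigroup generators is a closed embedding
  into affine space and the other characters are monomials in these.
\<close>

definition affine_toric_points ::
    "(real ^ 'n) set \<Rightarrow> (real ^ 'n) set \<Rightarrow> (real ^ 'n \<Rightarrow> complex) set" where
  "affine_toric_points N \<sigma> =
     {x \<in> extensional (cone_semigroup N \<sigma>).
        x 0 = 1 \<and>
        (\<forall>m\<in>cone_semigroup N \<sigma>. \<forall>m'\<in>cone_semigroup N \<sigma>. x (m + m') = x m * x m')}"

definition affine_toric_variety ::
    "(real ^ 'n) set \<Rightarrow> (real ^ 'n) set \<Rightarrow> (real ^ 'n \<Rightarrow> complex) topology" where
  "affine_toric_variety N \<sigma> =
     subtopology (product_topology (\<lambda>_. euclidean) (cone_semigroup N \<sigma>))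
       (affine_toric_points N \<sigma>)"

text \<open>
  Points of the charts of \<open>\<sigma>\<close> and \<open>\<sigma>'\<close> are identified if they are the images of one point of
  the chart of \<open>\<sigma> \<inter> \<sigma>'\<close>; for a face \<open>\<tau>\<close> of \<open>\<sigma>\<close>, the inclusion of the chart of \<open>\<tau>\<close> into that of \<open>\<sigma>\<close>
  restricts homomorphisms to the smaller semigroup of \<open>\<sigma>\<close>.
\<close>

definition toric_gluing ::
    "(real ^ 'n) set \<Rightarrow> (real ^ 'n) set set \<Rightarrow>
     (((real ^ 'n) set \<times> (real ^ 'n \<Rightarrow> complex)) \<times> ((real ^ 'n) set \<times> (real ^ 'n \<Rightarrow> complex))) set" where
  "toric_gluing N \<Sigma> =
     {((\<sigma>, x), (\<sigma>', x')) | \<sigma> x \<sigma>' x'.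
        \<sigma> \<in> \<Sigma> \<and> \<sigma>' \<in> \<Sigma> \<and>
        (\<exists>y\<in>affine_toric_points N (\<sigma> \<inter> \<sigma>').
           x = restrict y (cone_semigroup N \<sigma>) \<and> x' = restrict y (cone_semigroup N \<sigma>'))}"

definition quotient_topology :: "'a topology \<Rightarrow> ('a \<times> 'a) set \<Rightarrow> 'a set topology" where
  "quotient_topology X R =
     topology (\<lambda>U. U \<subseteq> topspace X // R \<and> openin X {x \<in> topspace X. R `` {x} \<in> U})"

lemma openin_quotient_topology:
  "openin (quotient_topology X R) U \<longleftrightarrow>
     U \<subseteq> topspace X // R \<and> openin X {x \<in> topspace X. R `` {x} \<in> U}"
proof -
  have "istopology (\<lambda>U. U \<subseteq> topspace X // R \<and> openin X {x \<in> topspace X. R `` {x} \<in> U})"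
    unfolding istopology_def
  proof (intro conjI allI impI; (elim conjE)?)
    fix S T
    assume "openin X {x \<in> topspace X. R `` {x} \<in> S}" "openin X {x \<in> topspace X. R `` {x} \<in> T}"
    then have "openin X ({x \<in> topspace X. R `` {x} \<in> S} \<inter> {x \<in> topspace X. R `` {x} \<in> T})"
      by (rule openin_Int)
    also have "{x \<in> topspace X. R `` {x} \<in> S} \<inter> {x \<in> topspace X. R `` {x} \<in> T}
        = {x \<in> topspace X. R `` {x} \<in> S \<inter> T}"
      by auto
    finally show "openin X {x \<in> topspace X. R `` {x} \<in> S \<inter> T}" .
  next
    fix K
    assume K: "\<forall>U\<in>K. U \<subseteq> topspace X // R \<and> openin X {x \<in> topspace X. R `` {x} \<in> U}"
    have "{x \<in> topspace X. R `` {x} \<in> \<Union>K} = (\<Union>U\<in>K. {x \<in> topspace X. R `` {x} \<in> U})"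
      by auto
    also have "openin X \<dots>"
      using K by (intro openin_Union) auto
    finally show "openin X {x \<in> topspace X. R `` {x} \<in> \<Union>K}" .
  qed auto
  then show ?thesis
    by (simp add: quotient_topology_def)
qed

definition toric_variety ::
    "(real ^ 'n) set \<Rightarrow> (real ^ 'n) set set \<Rightarrow>
     ((real ^ 'n) set \<times> (real ^ 'n \<Rightarrow> complex)) set topology" where
  "toric_variety N \<Sigma> =
     quotient_topology (sum_topology (affine_toric_variety N) \<Sigma>) (toric_gluing N \<Sigma>)"


section \<open>The Fujiki-Oka resolution\<close>

definition fraction_lattice :: "('n::finite) fraction \<Rightarrow> (real ^ 'n) set" where
  "fraction_lattice q =
     {(\<chi> i. of_int (z $ i) + of_int k * (of_int (numer q $ i) / of_int (denom q))) | z k. True}"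

definition subdivision_point :: "(real ^ 'n) ^ 'n \<Rightarrow> ('n::finite) fraction \<Rightarrow> real ^ 'n" where
  "subdivision_point u q = (1 / of_int (denom q)) *\<^sub>R (\<Sum>i\<in>UNIV. of_int (numer q $ i) *\<^sub>R u $ i)"

text \<open>The labelled cones that occur in the process, each given by its family of generators.\<close>

inductive fujiki_oka_cone :: "('n::finite) fraction \<Rightarrow> (real ^ 'n) ^ 'n \<Rightarrow> 'n fraction \<Rightarrow> bool"
  for q\<^sub>0 where
  start: "fujiki_oka_cone q\<^sub>0 (\<chi> i. axis i 1) q\<^sub>0"
| subdivide: "fujiki_oka_cone q\<^sub>0 (\<chi> j. if j = i then subdivision_point u q else u $ j) q'"
  if "fujiki_oka_cone q\<^sub>0 u q" "q \<noteq> Frac 0 1" "remainder_map i (Some q) = Some q'"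

definition fujiki_oka_fan :: "('n::finite) fraction \<Rightarrow> (real ^ 'n) set set" where
  "fujiki_oka_fan q =
     {\<tau>. \<tau> \<noteq> {} \<and>
         (\<exists>u. fujiki_oka_cone q u (Frac 0 1) \<and> \<tau> face_of (convex_cone hull (range (($) u))))}"

definition fujiki_oka_variety ::
    "('n::finite) fraction \<Rightarrow> ((real ^ 'n) set \<times> (real ^ 'n \<Rightarrow> complex)) set topology" where
  "fujiki_oka_variety q = toric_variety (fraction_lattice q) (fujiki_oka_fan q)"


section \<open>The topological Euler characteristic\<close>

definition int_independent :: "('a, 'b) monoid_scheme \<Rightarrow> 'a set \<Rightarrow> bool" where
  "int_independent G B \<longleftrightarrow>
     finite B \<and> B \<subseteq> carrier G \<and>
     (\<forall>c :: 'a \<Rightarrow> int. finprod G (\<lambda>b. b [^]\<^bsub>G\<^esub> c b) B = \<one>\<^bsub>G\<^esub> \<longrightarrow> (\<forall>b\<in>B. c b = 0))"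

definition finite_rank :: "('a, 'b) monoid_scheme \<Rightarrow> bool" where
  "finite_rank G \<longleftrightarrow> (\<exists>k. \<forall>B. int_independent G B \<longrightarrow> card B \<le> k)"

definition group_rank :: "('a, 'b) monoid_scheme \<Rightarrow> nat" where
  "group_rank G = Sup (card ` {B. int_independent G B})"

definition betti_number :: "nat \<Rightarrow> 'a topology \<Rightarrow> nat" where
  "betti_number p X = group_rank (homology_group (int p) X)"

definition has_finite_homology :: "'a topology \<Rightarrow> bool" where
  "has_finite_homology X \<longleftrightarrow>
     (\<forall>p. finite_rank (homology_group (int p) X)) \<and> finite {p. betti_number p X \<noteq> 0}"

text \<open>Meaningful only for spaces satisfying \<^const>\<open>has_finite_homology\<close>.\<close>

definition euler_characteristic :: "'a topology \<Rightarrow> int" where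
  "euler_characteristic X = (\<Sum>p | betti_number p X \<noteq> 0. (- 1) ^ p * int (betti_number p X))"

end

theory Submission
  imports Defs
begin

text \<open>
  The label of every cone that is subdivided has the entry 1 at the index \<open>i\<^sub>1\<close>, and the generator with
  that index is never replaced before the cone becomes smooth.  The subdivision point is therefore
  determined by the lattice and by any face that contains it, so the subdivisions of different
  cones agree on common faces and the resulting smooth cones form a fan.

  The chart of a smooth cone is a product of copies of \<open>\<complex>\<close> and, for each missing generator, of
  \<open>\<complex> - {0}\<close>; its Euler characteristic is 1 if the cone is full-dimensional and 0 otherwise.
  Charts intersect in charts of smaller cones, so by additivity of the Euler characteristic on open
  covers \<open>\<chi>(Y)\<close> is the number of full-dimensional cones, i.e. of leaves of the subdivision tree.

  The numerators of a label are the denominators of the labels of its children.  Hence the sum of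
  the heights telescopes to the sum of the denominators 1 of the leaves minus the denominator
  \<open>r\<close> of the root.
\<close>

section \<open>Ranks of abelian groups\<close>

text \<open>Each cone is subdivided on its own, at a point read off from its own label, so nothing
  in the construction says that two neighbouring cones receive the same point on a common face.
  Pairs of cones are therefore followed through the tree together, with the invariant that they meet
  in the cone over their common generators. The entry 1 ties the point to the lattice: its
  coordinate there is 1 over the denominator. Cones are represented by finite sets of generators, so
  that faces are subsets and intersections of cones are intersections of sets.

  On the topological side, Betti numbers are suprema, which carry information only when bounded.
  Euler characteristics are therefore treated through a relation that asserts finite ranks and
  vanishing in high degrees along with the value. Additivity rests on rank-nullity along the long
  exact sequence of a pair, and on excision. The charts are reduced by the same additivity to
  contractible spaces, through a cover of the punctured plane by slit planes.\<close>

lemma integer_relation: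
  fixes c :: "'a \<Rightarrow> 'b \<Rightarrow> int"
  assumes "finite T" "finite S" "card T < card S"
  shows "\<exists>d. (\<exists>s\<in>S. d s \<noteq> 0) \<and> (\<forall>t\<in>T. (\<Sum>s\<in>S. d s * c s t) = 0)"
  using assms
proof (induction T arbitrary: S c rule: finite_induct)
  case empty
  then obtain s where "s \<in> S"
    by fastforce
  then show ?case
    by (intro exI[of _ "\<lambda>_. 1"]) auto
next
  case (insert t0 T)
  show ?case
  proof (cases "\<forall>s\<in>S. c s t0 = 0")
    case True
    have "card T < card S"
      using insert by simp
    from insert.IH[OF insert.prems(1) this] obtain d
      where d: "\<exists>s\<in>S. d s \<noteq> 0" "\<forall>t\<in>T. (\<Sum>s\<in>S. d s * c s t) = 0"
      by blast
    have "(\<Sum>s\<in>S. d s * c s t0) = 0"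
      using True by simp
    with d show ?thesis
      by blast
  next
    case False
    then obtain s0 where s0: "s0 \<in> S" "c s0 t0 \<noteq> 0"
      by blast
    \<comment> \<open>Elimination of the column \<open>t0\<close> with pivot \<open>c s0 t0\<close>;
      cross-multiplying instead of dividing keeps the entries integral.\<close>
    define c' where "c' s t = c s0 t0 * c s t - c s t0 * c s0 t" for s t
    have "card T < card (S - {s0})"
      using insert s0 by simp
    from insert.IH[OF _ this, of c'] insert.prems(1) obtain d
      where d: "\<exists>s\<in>S - {s0}. d s \<noteq> 0" "\<forall>t\<in>T. (\<Sum>s\<in>S - {s0}. d s * c' s t) = 0"
      by blast
    \<comment> \<open>The relation \<open>d\<close> between the reduced rows, rewritten for the
      original rows: the coefficient of \<open>s0\<close> collects the multiples of its row that
      were subtracted.\<close>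
    define e where
      "e s = (if s = s0 then - (\<Sum>s\<in>S - {s0}. d s * c s t0) else c s0 t0 * d s)" for s
    have "(\<Sum>s\<in>S. e s * c s t) = (\<Sum>s\<in>S - {s0}. d s * c' s t)" for t
    proof -
      have "(\<Sum>s\<in>S. e s * c s t) = e s0 * c s0 t + (\<Sum>s\<in>S - {s0}. e s * c s t)"
        using s0 insert.prems by (simp add: sum.remove)
      also have "(\<Sum>s\<in>S - {s0}. e s * c s t) = (\<Sum>s\<in>S - {s0}. c s0 t0 * d s * c s t)"
        by (intro sum.cong) (auto simp: e_def)
      finally show ?thesis
        by (simp add: e_def c'_def algebra_simps sum_subtractf sum_distrib_left sum_distrib_right)
    qed
    moreover have "c' s t0 = 0" for s
      by (simp add: c'_def)
    ultimately have "\<forall>t\<in>insert t0 T. (\<Sum>s\<in>S. e s * c s t) = 0"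
      using d(2) by simp
    moreover have "\<exists>s\<in>S. e s \<noteq> 0"
      using d(1) s0 by (auto simp: e_def)
    ultimately show ?thesis
      by blast
  qed
qed

context comm_group
begin

lemma finprod_int_pow:
  assumes "finite A" "f \<in> A \<rightarrow> carrier G"
  shows "finprod G f A [^] (k::int) = finprod G (\<lambda>a. f a [^] k) A"
  using assms
  by (induction A rule: finite_induct) (simp_all add: int_pow_distrib Pi_def)

lemma finprod_int_pow_sum:
  assumes "finite A" "x \<in> carrier G"
  shows "finprod G (\<lambda>a. x [^] (c a :: int)) A = x [^] (\<Sum>a\<in>A. c a)"
  using assms
  by (induction A rule: finite_induct) (simp_all add: int_pow_mult Pi_def)

lemma finprod_swap:
  assumes "finite A" "finite B" "\<And>a b. a \<in> A \<Longrightarrow> b \<in> B \<Longrightarrow> f a b \<in> carrier G"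
  shows "finprod G (\<lambda>a. finprod G (f a) B) A = finprod G (\<lambda>b. finprod G (\<lambda>a. f a b) A) B"
  using assms
proof (induction A rule: finite_induct)
  case (insert a A)
  then have "finprod G (\<lambda>b. finprod G (\<lambda>a. f a b) (insert a A)) B =
      finprod G (\<lambda>b. f a b \<otimes> finprod G (\<lambda>a. f a b) A) B"
    by (intro finprod_cong') (auto simp: Pi_def)
  also have "\<dots> = finprod G (f a) B \<otimes> finprod G (\<lambda>b. finprod G (\<lambda>a. f a b) A) B"
    using insert by (intro finprod_multf) (auto simp: Pi_def)
  finally show ?case
    using insert by (simp add: Pi_def)
qed simp

lemma hom_finprod:
  assumes "comm_group H" "h \<in> hom G H" "finite A" "f \<in> A \<rightarrow> carrier G"
  shows "h (finprod G f A) = finprod H (\<lambda>a. h (f a)) A"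
proof -
  interpret H: comm_group H by fact
  have "h \<one> = \<one>\<^bsub>H\<^esub>"
    using assms(2) hom_one is_group H.is_group by blast
  with assms(3,4) show ?thesis
    by (induction A rule: finite_induct)
      (use assms(2) in \<open>auto simp: hom_mult[OF assms(2)] Pi_def hom_in_carrier[OF assms(2)]\<close>)
qed

text \<open>An exchange bound up to torsion: only a nonzero power of each \<open>s\<close> has to
  lie in the subgroup generated by \<open>T\<close>. If \<open>S\<close> were larger, the exponent
  vectors over \<open>T\<close> would satisfy an integer relation \<open>d\<close>, and the
  exponents \<open>k s * d s\<close> would give a relation within \<open>S\<close>, nontrivial
  because no \<open>k s\<close> is 0.\<close>

lemma int_independent_card_le:
  assumes S: "int_independent G S" and T: "finite T" "T \<subseteq> carrier G"
    and dep: "\<And>s. s \<in> S \<Longrightarrow> \<exists>k c. k \<noteq> 0 \<and> s [^] (k::int) = finprod G (\<lambda>t. t [^] (c t :: int)) T"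
  shows "card S \<le> card T"
proof (rule ccontr)
  assume "\<not> card S \<le> card T"
  then have less: "card T < card S"
    by simp
  have fin: "finite S" and sub: "S \<subseteq> carrier G"
    and ind: "\<And>c :: 'a \<Rightarrow> int. finprod G (\<lambda>b. b [^] c b) S = \<one> \<Longrightarrow> \<forall>b\<in>S. c b = 0"
    using S unfolding int_independent_def by auto
  from dep obtain k c where kc: "\<And>s. s \<in> S \<Longrightarrow> k s \<noteq> 0 \<and> s [^] (k s::int) = finprod G (\<lambda>t. t [^] (c s t :: int)) T"
    by metis
  obtain d where d: "\<exists>s\<in>S. d s \<noteq> 0" "\<forall>t\<in>T. (\<Sum>s\<in>S. d s * c s t) = 0"
    using integer_relation[OF T(1) fin less, of c] by blast
  have "finprod G (\<lambda>s. s [^] (k s * d s)) S = finprod G (\<lambda>s. finprod G (\<lambda>t. t [^] (d s * c s t)) T) S"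
  proof (rule finprod_cong')
    fix s assume s: "s \<in> S"
    have "s [^] (k s * d s) = (s [^] k s) [^] d s"
      using s sub by (simp add: int_pow_pow subset_iff)
    also have "\<dots> = finprod G (\<lambda>t. (t [^] c s t) [^] d s) T"
      using kc[OF s] T by (simp add: finprod_int_pow Pi_def subset_iff)
    also have "\<dots> = finprod G (\<lambda>t. t [^] (d s * c s t)) T"
      using T by (intro finprod_cong') (auto simp: int_pow_pow mult.commute subset_iff Pi_def)
    finally show "s [^] (k s * d s) = finprod G (\<lambda>t. t [^] (d s * c s t)) T" .
  qed (use T in \<open>auto simp: Pi_def subset_iff\<close>)
  also have "\<dots> = finprod G (\<lambda>t. finprod G (\<lambda>s. t [^] (d s * c s t)) S) T"
    using T fin by (intro finprod_swap) auto
  also have "\<dots> = \<one>"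
  proof (rule finprod_one_eqI)
    fix t assume "t \<in> T"
    then show "finprod G (\<lambda>s. t [^] (d s * c s t)) S = \<one>"
      using T fin d(2) by (subst finprod_int_pow_sum) auto
  qed
  finally have "\<forall>s\<in>S. k s * d s = 0"
    by (rule ind)
  with d(1) kc show False
    by auto
qed

end

text \<open>The rank is attached to a subset \<open>K\<close> because kernels and images in an exact
  sequence occur as subsets of a carrier. Since the bound must be attained, having some rank
  \<open>k\<close> already means finite rank.\<close>

definition has_rank :: "('a, 'b) monoid_scheme \<Rightarrow> 'a set \<Rightarrow> nat \<Rightarrow> bool" where
  "has_rank G K k \<longleftrightarrow>
     (\<exists>B\<subseteq>K. int_independent G B \<and> card B = k) \<and>
     (\<forall>B\<subseteq>K. int_independent G B \<longrightarrow> card B \<le> k)"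

lemma has_rank_unique: "has_rank G K k \<Longrightarrow> has_rank G K l \<Longrightarrow> k = l"
  unfolding has_rank_def by (metis le_antisym)

lemma has_rank_group_rank:
  assumes "has_rank G (carrier G) k"
  shows "finite_rank G" "group_rank G = k"
proof -
  obtain B where B: "B \<subseteq> carrier G" "int_independent G B" "card B = k"
    and le: "\<And>B. B \<subseteq> carrier G \<Longrightarrow> int_independent G B \<Longrightarrow> card B \<le> k"
    using assms unfolding has_rank_def by blast
  have le': "card B \<le> k" if "int_independent G B" for B
    using le[of B] that unfolding int_independent_def by blast
  then show "finite_rank G"
    unfolding finite_rank_def by blast
  show "group_rank G = k"
    unfolding group_rank_def using B le' by (intro cSup_eq_maximum) auto
qed

lemma has_rank_bounded:
  assumes "\<And>B. B \<subseteq> K \<Longrightarrow> int_independent G B \<Longrightarrow> card B \<le> m"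
  shows "\<exists>k\<le>m. has_rank G K k"
proof -
  let ?P = "\<lambda>k. \<exists>B\<subseteq>K. int_independent G B \<and> card B = k"
  have "?P 0"
    by (rule exI[of _ "{}"]) (simp add: int_independent_def)
  moreover have bd: "y \<le> m" if "?P y" for y
    using assms that by blast
  ultimately have P: "?P (Greatest ?P)" and G: "\<And>k. ?P k \<Longrightarrow> k \<le> Greatest ?P"
    using GreatestI_nat[of ?P 0 m] Greatest_le_nat[of ?P _ m] by blast+
  have "has_rank G K (Greatest ?P)"
    unfolding has_rank_def using P G by blast
  with bd[OF P] show ?thesis
    by blast
qed

lemma has_rank_subset:
  assumes "has_rank G L l" "K \<subseteq> L"
  shows "\<exists>k\<le>l. has_rank G K k"
  by (rule has_rank_bounded) (use assms in \<open>auto simp: has_rank_def\<close>)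

text \<open>Adding \<open>x\<close> to a maximal independent set \<open>B\<close> creates a
  relation, and \<open>x\<close> must occur in it because \<open>B\<close> alone has none. The
  exponent of \<open>x\<close> cannot be divided out, so only a power of \<open>x\<close> is
  expressed over \<open>B\<close>.\<close>

lemma (in comm_group) has_rank_dependent:
  assumes rk: "has_rank G K (card B)" and K: "K \<subseteq> carrier G" "x \<in> K"
    and B: "B \<subseteq> K" "int_independent G B"
  shows "\<exists>k c. k \<noteq> 0 \<and> x [^] (k::int) = finprod G (\<lambda>b. b [^] (c b :: int)) B"
proof (cases "x \<in> B")
  case True
  have B': "finite B" "B \<subseteq> carrier G"
    using B unfolding int_independent_def by auto
  have "finprod G (\<lambda>b. b [^] (if b = x then 1 else 0 :: int)) B = finprod G (\<lambda>b. if x = b then x else \<one>) B"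
    using B' by (intro finprod_cong') (auto simp: Pi_def subset_iff)
  also have "\<dots> = x"
    using B' True by (intro finprod_singleton[where f = "\<lambda>_. x"]) (auto simp: Pi_def subset_iff)
  finally show ?thesis
    using K by (intro exI[of _ 1] exI[of _ "\<lambda>b. if b = x then 1 else 0 :: int"]) auto
next
  case False
  have B': "finite B" "B \<subseteq> carrier G"
    and ind: "\<And>c :: 'a \<Rightarrow> int. finprod G (\<lambda>b. b [^] c b) B = \<one> \<Longrightarrow> \<forall>b\<in>B. c b = 0"
    using B unfolding int_independent_def by auto
  have x: "x \<in> carrier G"
    using K by auto
  have "\<not> int_independent G (insert x B)"
  proof
    assume "int_independent G (insert x B)"
    then have "card (insert x B) \<le> card B"
      using rk B(1) K(2) unfolding has_rank_def by (metis insert_subset)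
    then show False
      using B'(1) False by simp
  qed
  then obtain c :: "'a \<Rightarrow> int" where c: "finprod G (\<lambda>b. b [^] c b) (insert x B) = \<one>"
      "\<exists>b\<in>insert x B. c b \<noteq> 0"
    using B' x unfolding int_independent_def by auto
  have closed: "finprod G (\<lambda>b. b [^] c b) B \<in> carrier G"
    using B' by (auto simp: Pi_def subset_iff)
  have eq: "x [^] c x \<otimes> finprod G (\<lambda>b. b [^] c b) B = \<one>"
    using c(1) B' x False by (subst (asm) finprod_insert) (auto simp: Pi_def subset_iff)
  have "c x \<noteq> 0"
  proof
    assume 0: "c x = 0"
    then have "finprod G (\<lambda>b. b [^] c b) B = \<one>"
      using eq closed by simp
    from ind[OF this] 0 c(2) show False
      by auto
  qed
  moreover have "x [^] c x = finprod G (\<lambda>b. b [^] (- c b)) B"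
  proof -
    have "x [^] c x = inv (finprod G (\<lambda>b. b [^] c b) B)"
      using eq closed x by (simp add: inv_equality)
    also have "\<dots> = finprod G (\<lambda>b. b [^] c b) B [^] (-1 :: int)"
      using closed by (simp add: int_pow_neg)
    also have "\<dots> = finprod G (\<lambda>b. (b [^] c b) [^] (-1 :: int)) B"
      using B' by (intro finprod_int_pow) (auto simp: Pi_def subset_iff)
    also have "\<dots> = finprod G (\<lambda>b. b [^] (- c b)) B"
      using B' by (intro finprod_cong') (auto simp: Pi_def subset_iff int_pow_pow)
    finally show ?thesis .
  qed
  ultimately show ?thesis
    by (intro exI[of _ "c x"] exI[of _ "\<lambda>b. - c b"]) simp
qed

text \<open>Apply \<open>h\<close> to a relation on \<open>K \<union> L\<close>: the kernel part
  disappears, so the exponents on \<open>L\<close> vanish by independence of the images, and then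
  those on \<open>K\<close> vanish too.\<close>

lemma (in comm_group) int_independent_lift:
  assumes H: "comm_group H" and h: "h \<in> hom G H"
    and K: "int_independent G K" "K \<subseteq> kernel G H h"
    and I: "int_independent H (h ` L)" "inj_on h L" "L \<subseteq> carrier G"
  shows "int_independent G (K \<union> L)" "K \<inter> L = {}"
proof -
  interpret H: comm_group H by fact
  have finK: "finite K" "K \<subseteq> carrier G"
    and indK: "\<And>c :: 'a \<Rightarrow> int. finprod G (\<lambda>b. b [^] c b) K = \<one> \<Longrightarrow> \<forall>b\<in>K. c b = 0"
    using K(1) unfolding int_independent_def by auto
  have finL: "finite L"
    using I(1,2) by (metis finite_image_iff int_independent_def)
  have indL: "\<forall>b\<in>L. c b = 0" if c: "finprod H (\<lambda>b. h b [^]\<^bsub>H\<^esub> c b) L = \<one>\<^bsub>H\<^esub>" for c :: "'a \<Rightarrow> int"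
  proof -
    let ?c = "\<lambda>y. c (the_inv_into L h y)"
    have "finprod H (\<lambda>y. y [^]\<^bsub>H\<^esub> ?c y) (h ` L) = finprod H (\<lambda>b. h b [^]\<^bsub>H\<^esub> ?c (h b)) L"
      using I h by (intro H.finprod_reindex) (auto simp: hom_in_carrier subset_iff)
    also have "\<dots> = finprod H (\<lambda>b. h b [^]\<^bsub>H\<^esub> c b) L"
      using I h by (intro H.finprod_cong') (auto simp: the_inv_into_f_f hom_in_carrier subset_iff Pi_def)
    finally have "\<forall>y\<in>h ` L. ?c y = 0"
      using c I(1) unfolding int_independent_def by auto
    then show ?thesis
      using I(2) by (auto simp: the_inv_into_f_f)
  qed
  show disj: "K \<inter> L = {}"
  proof (rule ccontr)
    assume "K \<inter> L \<noteq> {}"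
    then obtain x where x: "x \<in> L" "h x = \<one>\<^bsub>H\<^esub>"
      using K(2) by (auto simp: kernel_def)
    have "finprod H (\<lambda>b. h b [^]\<^bsub>H\<^esub> (if b = x then 1 else 0 :: int)) L = \<one>\<^bsub>H\<^esub>"
      using x by (intro H.finprod_one_eqI) auto
    from indL[OF this] x show False
      by auto
  qed
  show "int_independent G (K \<union> L)"
    unfolding int_independent_def
  proof (intro conjI allI impI)
    show "finite (K \<union> L)" "K \<union> L \<subseteq> carrier G"
      using finK finL I by auto
    fix c :: "'a \<Rightarrow> int"
    assume c: "finprod G (\<lambda>b. b [^] c b) (K \<union> L) = \<one>"
    have un: "finprod G (\<lambda>b. b [^] c b) (K \<union> L) =
        finprod G (\<lambda>b. b [^] c b) K \<otimes> finprod G (\<lambda>b. b [^] c b) L"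
      using finK finL I disj by (intro finprod_Un_disjoint) (auto simp: subset_iff)
    have clK: "finprod G (\<lambda>b. b [^] c b) K \<in> carrier G" and clL: "finprod G (\<lambda>b. b [^] c b) L \<in> carrier G"
      using finK I by (auto intro!: finprod_closed simp: subset_iff)
    have hpow: "h (x [^] (k::int)) = h x [^]\<^bsub>H\<^esub> k" if "x \<in> carrier G" for x k
      using that hom_int_pow[OF h] is_group H.is_group by auto
    have hK: "h (finprod G (\<lambda>b. b [^] c b) K) = \<one>\<^bsub>H\<^esub>"
    proof -
      have "h (finprod G (\<lambda>b. b [^] c b) K) = finprod H (\<lambda>b. h (b [^] c b)) K"
        using finK by (intro hom_finprod[OF H h]) (auto simp: subset_iff)
      also have "\<dots> = \<one>\<^bsub>H\<^esub>"
        using finK K(2) by (intro H.finprod_one_eqI) (auto simp: hpow kernel_def subset_iff)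
      finally show ?thesis .
    qed
    have hL: "h (finprod G (\<lambda>b. b [^] c b) L) = finprod H (\<lambda>b. h b [^]\<^bsub>H\<^esub> c b) L"
    proof -
      have "h (finprod G (\<lambda>b. b [^] c b) L) = finprod H (\<lambda>b. h (b [^] c b)) L"
        using finL I by (intro hom_finprod[OF H h]) (auto simp: subset_iff)
      also have "\<dots> = finprod H (\<lambda>b. h b [^]\<^bsub>H\<^esub> c b) L"
        using I h by (intro H.finprod_cong') (auto simp: hpow subset_iff Pi_def hom_in_carrier)
      finally show ?thesis .
    qed
    have "finprod H (\<lambda>b. h b [^]\<^bsub>H\<^esub> c b) L = h (finprod G (\<lambda>b. b [^] c b) (K \<union> L))"
      unfolding un using clK clL hK hL hom_mult[OF h clK clL] hom_in_carrier[OF h clL] by simp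
    also have "\<dots> = \<one>\<^bsub>H\<^esub>"
      using c h hom_one is_group H.is_group by metis
    finally have L0: "\<forall>b\<in>L. c b = 0"
      by (rule indL)
    then have "finprod G (\<lambda>b. b [^] c b) L = \<one>"
      by (intro finprod_one_eqI) simp
    with un c clK have "finprod G (\<lambda>b. b [^] c b) K = \<one>"
      by simp
    with indK L0 show "\<forall>b\<in>K \<union> L. c b = 0"
      by auto
  qed
qed

text \<open>Rank-nullity, with torsion allowed. A maximal independent set of the kernel together
  with lifts of one of the image is independent by \<open>int_independent_lift\<close>; that no
  independent set is larger comes from \<open>int_independent_card_le\<close>.\<close>

lemma (in comm_group) has_rank_kernel_image:
  assumes H: "comm_group H" and h: "h \<in> hom G H"
    and k: "has_rank G (kernel G H h) k" and l: "has_rank H (h ` carrier G) l"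
  shows "has_rank G (carrier G) (k + l)"
proof -
  interpret H: comm_group H by fact
  obtain K where K: "K \<subseteq> kernel G H h" "int_independent G K" "card K = k"
    using k unfolding has_rank_def by blast
  obtain I where I: "I \<subseteq> h ` carrier G" "int_independent H I" "card I = l"
    using l unfolding has_rank_def by blast
  obtain L where L: "L \<subseteq> carrier G" "I = h ` L" "inj_on h L"
    using I(1) by (meson subset_image_inj)
  have fin: "finite K" "finite L" "K \<subseteq> carrier G"
    using K(2) I(2) L(2,3) by (auto simp: int_independent_def finite_image_iff)
  have ind: "int_independent G (K \<union> L)" and disj: "K \<inter> L = {}"
    using int_independent_lift[OF H h K(2,1) _ L(3,1)] I(2) L(2) by auto
  have card: "card (K \<union> L) = k + l"
    using disj fin K(3) I(3) L(2,3) by (simp add: card_Un_disjoint card_image)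
  have hpow: "h (x [^] (k::int)) = h x [^]\<^bsub>H\<^esub> k" if "x \<in> carrier G" for x k
    using that hom_int_pow[OF h] is_group H.is_group by auto
  have "card S \<le> card (K \<union> L)" if S: "int_independent G S" for S
  proof (rule int_independent_card_le[OF S])
    show "finite (K \<union> L)" "K \<union> L \<subseteq> carrier G"
      using fin L by auto
    fix s assume "s \<in> S"
    then have s: "s \<in> carrier G"
      using S unfolding int_independent_def by auto
    have "h ` carrier G \<subseteq> carrier H"
      using h by (auto simp: hom_in_carrier)
    then obtain d c where d: "d \<noteq> 0" "h s [^]\<^bsub>H\<^esub> (d::int) = finprod H (\<lambda>b. b [^]\<^bsub>H\<^esub> (c b :: int)) I"
      using H.has_rank_dependent[of "h ` carrier G" I "h s"] I l s by blast
    \<comment> \<open>\<open>y\<close> lifts the expression of a power of \<open>h s\<close> over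
      \<open>I\<close>. Hence \<open>s [^] d\<close> and \<open>y\<close> differ by a kernel
      element, and a further power \<open>e\<close> of that difference can be expressed over
      \<open>K\<close>.\<close>
    define y where "y = finprod G (\<lambda>b. b [^] (c (h b))) L"
    have y: "y \<in> carrier G"
      unfolding y_def using L by (auto intro!: finprod_closed simp: subset_iff)
    have "h y = finprod H (\<lambda>b. h (b [^] c (h b))) L"
      unfolding y_def using fin L by (intro hom_finprod[OF H h]) (auto simp: subset_iff)
    also have "\<dots> = finprod H (\<lambda>b. h b [^]\<^bsub>H\<^esub> c (h b)) L"
      using L h by (intro H.finprod_cong') (auto simp: hpow subset_iff Pi_def hom_in_carrier)
    also have "\<dots> = finprod H (\<lambda>b. b [^]\<^bsub>H\<^esub> (c b :: int)) I"
      unfolding L(2) using L h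
      by (intro H.finprod_reindex[symmetric]) (auto simp: subset_iff hom_in_carrier)
    finally have hy: "h y = h (s [^] d)"
      using d(2) s by (simp add: hpow)
    have hc: "h y \<in> carrier H"
      using h y by (simp add: hom_in_carrier)
    have "s [^] d \<otimes> inv y \<in> kernel G H h"
    proof -
      have "h (s [^] d \<otimes> inv y) = h (s [^] d) \<otimes>\<^bsub>H\<^esub> h (inv y)"
        using s y hom_mult[OF h] by simp
      also have "h (inv y) = inv\<^bsub>H\<^esub> (h y)"
        using group_hom.hom_inv[of G H h y] y h is_group H.is_group
        by (simp add: group_hom_def group_hom_axioms_def)
      finally show ?thesis
        using s y hy[symmetric] hc by (simp add: kernel_def)
    qed
    then obtain e f where e: "e \<noteq> 0" "(s [^] d \<otimes> inv y) [^] (e::int) = finprod G (\<lambda>b. b [^] (f b :: int)) K"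
      using has_rank_dependent[of "kernel G H h" K] k K kernel_def[of G H h] by blast
    have yu: "y [^] e = finprod G (\<lambda>b. b [^] (c (h b) * e)) L"
    proof -
      have "y [^] e = finprod G (\<lambda>b. (b [^] c (h b)) [^] e) L"
        unfolding y_def using fin L by (intro finprod_int_pow) (auto simp: subset_iff)
      also have "\<dots> = finprod G (\<lambda>b. b [^] (c (h b) * e)) L"
        using L by (intro finprod_cong') (auto simp: subset_iff Pi_def int_pow_pow)
      finally show ?thesis .
    qed
    have "s [^] (d * e) = (s [^] d \<otimes> inv y) [^] e \<otimes> y [^] e"
    proof -
      have "(s [^] d \<otimes> inv y) [^] e \<otimes> y [^] e = (s [^] d \<otimes> inv y \<otimes> y) [^] e"
        using s y by (simp add: int_pow_distrib)
      also have "s [^] d \<otimes> inv y \<otimes> y = s [^] d"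
        using s y by (simp add: m_assoc)
      finally show ?thesis
        using s by (simp add: int_pow_pow)
    qed
    also have "\<dots> = finprod G (\<lambda>b. b [^] (if b \<in> K then f b else c (h b) * e)) (K \<union> L)"
    proof -
      let ?g = "\<lambda>b. b [^] (if b \<in> K then f b else c (h b) * e)"
      have "finprod G ?g (K \<union> L) = finprod G ?g K \<otimes> finprod G ?g L"
        using fin L disj by (intro finprod_Un_disjoint) (auto simp: subset_iff)
      also have "finprod G ?g K = finprod G (\<lambda>b. b [^] f b) K"
        using fin by (intro finprod_cong') (auto simp: subset_iff Pi_def)
      also have "finprod G ?g L = finprod G (\<lambda>b. b [^] (c (h b) * e)) L"
        using fin L disj by (intro finprod_cong') (auto simp: subset_iff Pi_def)
      finally show ?thesis
        using e(2) yu by simp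
    qed
    finally show "\<exists>k c. k \<noteq> 0 \<and> s [^] (k::int) = finprod G (\<lambda>t. t [^] (c t :: int)) (K \<union> L)"
      using d(1) e(1) by (intro exI[of _ "d * e"] exI) auto
  qed
  moreover have "K \<union> L \<subseteq> carrier G"
    using fin L by auto
  ultimately show ?thesis
    unfolding has_rank_def using ind card by metis
qed

text \<open>Lifts of an independent subset of the image are independent in \<open>G\<close>, so
  \<open>l\<close> bounds its size.\<close>

lemma (in comm_group) has_rank_image:
  assumes H: "comm_group H" and h: "h \<in> hom G H" and l: "has_rank G (carrier G) l"
  shows "\<exists>k. has_rank H (h ` carrier G) k"
proof -
  interpret H: comm_group H by fact
  have "card I \<le> l" if I: "I \<subseteq> h ` carrier G" "int_independent H I" for I
  proof -
    obtain L where L: "L \<subseteq> carrier G" "I = h ` L" "inj_on h L"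
      using I(1) by (meson subset_image_inj)
    have "int_independent G ({} \<union> L)"
      by (rule int_independent_lift[OF H h _ _ _ L(3,1)])
        (use I(2) L(2) in \<open>auto simp: int_independent_def\<close>)
    then have "card L \<le> l"
      using l L(1) unfolding has_rank_def by auto
    then show ?thesis
      using L by (simp add: card_image)
  qed
  then show ?thesis
    using has_rank_bounded by metis
qed

lemma has_rank_trivial:
  assumes "comm_group G" "K \<subseteq> {\<one>\<^bsub>G\<^esub>}"
  shows "has_rank G K 0"
proof -
  interpret comm_group G by fact
  have "B = {}" if B: "B \<subseteq> K" "int_independent G B" for B
  proof (rule ccontr)
    assume ne: "B \<noteq> {}"
    have "finprod G (\<lambda>b. b [^]\<^bsub>G\<^esub> (1 :: int)) B = \<one>\<^bsub>G\<^esub>"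
      using B(1) assms(2) by (intro finprod_one_eqI) (auto simp: subset_iff)
    with B(2) have "\<forall>b\<in>B. (1::int) = 0"
      unfolding int_independent_def
      by (elim conjE allE[of _ "\<lambda>_. 1"]) simp
    with ne show False
      by auto
  qed
  then obtain k where k: "k \<le> 0" "has_rank G K k"
    using has_rank_bounded[of K G 0] by (metis card.empty le_refl)
  then show ?thesis
    by simp
qed

text \<open>Rank-nullity with trivial kernel: the rank of the image equals \<open>k\<close> because
  ranks are unique.\<close>

lemma has_rank_iso:
  assumes "comm_group G" "comm_group H" "G \<cong> H" "has_rank G (carrier G) k"
  shows "has_rank H (carrier H) k"
proof -
  interpret G: comm_group G by fact
  interpret H: comm_group H by fact
  obtain h where h: "h \<in> iso G H"
    using assms(3) by (auto simp: is_iso_def)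
  then have hom: "h \<in> hom G H" and im: "h ` carrier G = carrier H" and inj: "inj_on h (carrier G)"
    by (auto simp: iso_def bij_betw_def)
  have "kernel G H h = {\<one>\<^bsub>G\<^esub>}"
    using hom inj G.is_group H.is_group
    by (metis group_hom.inj_iff_trivial_ker group_hom.intro group_hom_axioms.intro)
  then have "has_rank G (kernel G H h) 0"
    by (intro has_rank_trivial[OF assms(1)]) simp
  moreover obtain l where l: "has_rank H (carrier H) l"
    using G.has_rank_image[OF assms(2) hom assms(4)] im by auto
  ultimately have "has_rank G (carrier G) (0 + l)"
    by (intro G.has_rank_kernel_image[OF assms(2) hom]) (simp_all add: im)
  then have "l = k"
    using has_rank_unique[OF assms(4)] by simp
  with l show ?thesis
    by simp
qed

lemma has_rank_integer_group: "has_rank integer_group (carrier integer_group) 1"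
proof -
  interpret comm_group integer_group
    by (rule abelian_integer_group)
  have ind: "int_independent integer_group {1}"
    unfolding int_independent_def by (auto simp: finprod_insert)
  have "card S \<le> card {1::int}" if "int_independent integer_group S" for S
  proof (rule int_independent_card_le[OF that])
    fix s
    show "\<exists>k c. k \<noteq> 0 \<and> s [^]\<^bsub>integer_group\<^esub> (k::int) =
        finprod integer_group (\<lambda>t. t [^]\<^bsub>integer_group\<^esub> (c t :: int)) {1}"
      by (intro exI[of _ 1] exI[of _ "\<lambda>_. s"]) (simp add: finprod_insert)
  qed auto
  with ind show ?thesis
    unfolding has_rank_def by (auto intro!: exI[of _ "{1}"])
qed

section \<open>Euler characteristics of pairs\<close>

text \<open>Besides the value \<open>e\<close>, this records that every homology group in degree at
  least 0 has a finite rank and that the ranks vanish from some degree \<open>M\<close> on. Being a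
  relation, it carries finiteness through exact sequences together with the value. Absolute homology
  is the case \<open>S = {}\<close>.\<close>

definition euler_pair :: "'a topology \<Rightarrow> 'a set \<Rightarrow> int \<Rightarrow> bool" where
  "euler_pair X S e \<longleftrightarrow>
     (\<exists>(b :: nat \<Rightarrow> nat) M.
        (\<forall>p. has_rank (relative_homology_group (int p) X S)
               (carrier (relative_homology_group (int p) X S)) (b p)) \<and>
        (\<forall>p\<ge>M. b p = 0) \<and> e = (\<Sum>p<M. (- 1) ^ p * int (b p)))"

lemma euler_pairI:
  assumes "\<And>p. has_rank (relative_homology_group (int p) X S)
      (carrier (relative_homology_group (int p) X S)) (b p)"
    and "\<And>p. p \<ge> M \<Longrightarrow> b p = 0" and "e = (\<Sum>p<M. (- 1) ^ p * int (b p))"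
  shows "euler_pair X S e"
  using assms unfolding euler_pair_def by blast

lemma alternating_sum_extend:
  assumes "\<And>p. p \<ge> M \<Longrightarrow> b p = (0 :: nat)" "M \<le> M'"
  shows "(\<Sum>p<M. (- 1 :: int) ^ p * int (b p)) = (\<Sum>p<M'. (- 1) ^ p * int (b p))"
  using assms by (intro sum.mono_neutral_left) auto

lemma euler_pair_imp_euler_characteristic:
  assumes "euler_pair X {} e"
  shows "has_finite_homology X \<and> euler_characteristic X = e"
proof -
  obtain b M where b: "\<And>p. has_rank (homology_group (int p) X) (carrier (homology_group (int p) X)) (b p)"
    and M: "\<And>p. p \<ge> M \<Longrightarrow> b p = 0" and e: "e = (\<Sum>p<M. (- 1) ^ p * int (b p))"
    using assms unfolding euler_pair_def by blast
  have betti: "betti_number p X = b p" for p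
    unfolding betti_number_def using b has_rank_group_rank by blast
  have sub: "{p. b p \<noteq> 0} \<subseteq> {..<M}"
    using M by (metis (mono_tags, lifting) lessThan_iff linorder_not_less mem_Collect_eq subsetI)
  then have "finite {p. b p \<noteq> 0}"
    by (rule finite_subset) simp
  moreover have "(\<Sum>p | b p \<noteq> 0. (- 1) ^ p * int (b p)) = e"
    unfolding e using sub by (intro sum.mono_neutral_left) auto
  ultimately show ?thesis
    unfolding has_finite_homology_def euler_characteristic_def betti
    using b has_rank_group_rank by blast
qed

lemma alternating_sum_telescope:
  fixes t :: "nat \<Rightarrow> nat"
  assumes "t 0 = 0"
  shows "(\<Sum>p<M. (- 1 :: int) ^ p * (int (t (Suc p)) + int (t p))) = - ((- 1) ^ M * int (t M))"
  using assms by (induction M) (auto simp: algebra_simps)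

text \<open>Here \<open>r\<close>, \<open>s\<close>, \<open>t\<close> are the ranks of the images of
  the three maps in the long exact sequence: from \<open>S\<close> into \<open>X\<close>, from
  \<open>X\<close> into the pair, and the boundary map. Exactness identifies each kernel with the
  preceding image, and rank-nullity gives the three equations. By \<open>BC\<close>, finite ranks
  are known either for \<open>X\<close> or for the pair.\<close>

lemma pair_ranks:
  fixes X :: "'a topology" and S :: "'a set"
  defines "HA \<equiv> \<lambda>p. homology_group (int p) (subtopology X S)"
    and "HB \<equiv> \<lambda>p. homology_group (int p) X"
    and "HC \<equiv> \<lambda>p. relative_homology_group (int p) X S"
  assumes A: "\<And>p. has_rank (HA p) (carrier (HA p)) (a p)"
    and BC: "(\<forall>p. \<exists>b. has_rank (HB p) (carrier (HB p)) b) \<or> (\<forall>p. \<exists>c. has_rank (HC p) (carrier (HC p)) c)"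
  shows "\<exists>r s t. t 0 = (0::nat) \<and>
    (\<forall>p. a p = t (Suc p) + r p \<and> has_rank (HB p) (carrier (HB p)) (r p + s p) \<and>
       has_rank (HC p) (carrier (HC p)) (s p + t p))"
proof -
  define f where "f p = hom_induced (int p) (subtopology X S) {} X {} id" for p
  define g where "g p = hom_induced (int p) X {} X S id" for p
  define h where "h p = hom_boundary (int p) X S" for p
  \<comment> \<open>The boundary map lands in degree \<open>p - 1\<close>, taken over the integers
    so that degree -1 is covered at \<open>p = 0\<close>; that group is trivial, whence
    \<open>t 0 = 0\<close>.\<close>
  define HA' where "HA' p = homology_group (int p - 1) (subtopology X S)" for p
  have HA': "HA' (Suc p) = HA p" for p
    by (simp add: HA'_def HA_def)
  have comm: "comm_group (HA p)" "comm_group (HB p)" "comm_group (HC p)" "comm_group (HA' p)" for p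
    unfolding HA_def HB_def HC_def HA'_def by simp_all
  have f: "f p \<in> hom (HA p) (HB p)" and g: "g p \<in> hom (HB p) (HC p)" and h: "h p \<in> hom (HC p) (HA' p)" for p
    unfolding f_def g_def h_def HA_def HB_def HC_def HA'_def
    by (auto simp: hom_induced_hom hom_boundary_hom)
  have kh: "kernel (HC p) (HA' p) (h p) = g p ` carrier (HB p)" for p
    using homology_exactness_axiom_1[of "int p" X S]
    by (simp add: HA'_def HB_def HC_def g_def h_def)
  have kf: "kernel (HA p) (HB p) (f p) = h (Suc p) ` carrier (HC (Suc p))" for p
    using homology_exactness_axiom_2[of "int (Suc p)" X S]
    by (simp add: HA_def HB_def HC_def f_def h_def)
  have kg: "kernel (HB p) (HC p) (g p) = f p ` carrier (HA p)" for p
    using homology_exactness_axiom_3[of "int p" X S]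
    by (simp add: HA_def HB_def HC_def f_def g_def)
  have ker_rank: "\<exists>k. has_rank G (kernel G H \<phi>) k" if "has_rank G (carrier G) m"
    for G H :: "'a chain set monoid" and \<phi> m
    using has_rank_subset[OF that, of "kernel G H \<phi>"] by (auto simp: kernel_def)
  have "\<exists>r. has_rank (HB p) (f p ` carrier (HA p)) r" for p
    using comm_group.has_rank_image[OF comm(1) comm(2) f A] .
  then obtain r where r: "\<And>p. has_rank (HB p) (f p ` carrier (HA p)) (r p)"
    by metis
  \<comment> \<open>If the groups of \<open>X\<close> are known, this set is an image of them; if
    the relative groups are known, it is the kernel of the boundary map inside them.\<close>
  have "\<exists>s. has_rank (HC p) (g p ` carrier (HB p)) s" for p
    using BC
  proof
    assume "\<forall>p. \<exists>b. has_rank (HB p) (carrier (HB p)) b"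
    then show ?thesis
      using comm_group.has_rank_image[OF comm(2) comm(3) g] by blast
  next
    assume "\<forall>p. \<exists>c. has_rank (HC p) (carrier (HC p)) c"
    then show ?thesis
      using ker_rank kh by metis
  qed
  then obtain s where s: "\<And>p. has_rank (HC p) (g p ` carrier (HB p)) (s p)"
    by metis
  have "\<exists>t. has_rank (HA' p) (h p ` carrier (HC p)) t \<and> (p = 0 \<longrightarrow> t = 0)" for p
  proof (cases p)
    case 0
    have "trivial_group (HA' 0)"
      by (simp add: HA'_def)
    then have "h 0 ` carrier (HC 0) \<subseteq> {\<one>\<^bsub>HA' 0\<^esub>}"
      using h[of 0] by (auto simp: trivial_group_def hom_def)
    then show ?thesis
      using 0 has_rank_trivial[OF comm(4)] by blast
  next
    case (Suc q)
    show ?thesis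
      using ker_rank[OF A[of q], of "HB q" "f q"] kf[of q] HA'[of q] Suc by auto
  qed
  then obtain t where t: "\<And>p. has_rank (HA' p) (h p ` carrier (HC p)) (t p)" and t0: "t 0 = 0"
    by metis
  have "a p = t (Suc p) + r p" for p
  proof -
    have "has_rank (HA p) (kernel (HA p) (HB p) (f p)) (t (Suc p))"
      using t[of "Suc p"] kf[of p] HA'[of p] by simp
    from comm_group.has_rank_kernel_image[OF comm(1) comm(2) f this r]
    show ?thesis
      using A has_rank_unique by blast
  qed
  moreover have "has_rank (HB p) (carrier (HB p)) (r p + s p)" for p
    using comm_group.has_rank_kernel_image[OF comm(2) comm(3) g _ s] r kg by metis
  moreover have "has_rank (HC p) (carrier (HC p)) (s p + t p)" for p
    using comm_group.has_rank_kernel_image[OF comm(3) comm(4) h _ t] s kh by metis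
  ultimately show ?thesis
    using t0 by blast
qed

text \<open>With the ranks from \<open>pair_ranks\<close>, the \<open>r\<close> and \<open>s\<close>
  terms match and the \<open>t\<close> terms telescope: the Euler characteristic of \<open>X\<close>
  is that of \<open>S\<close> plus that of the pair.\<close>

lemma euler_pair_exact:
  fixes X :: "'a topology"
  assumes A: "euler_pair (subtopology X S) {} e"
  shows "euler_pair X {} e' \<Longrightarrow> euler_pair X S (e' - e)"
    and "euler_pair X S e' \<Longrightarrow> euler_pair X {} (e' + e)"
proof -
  define HB where "HB p = homology_group (int p) X" for p
  define HC where "HC p = relative_homology_group (int p) X S" for p
  obtain a M1 where a: "\<And>p. has_rank (homology_group (int p) (subtopology X S))
      (carrier (homology_group (int p) (subtopology X S))) (a p)"
    and M1: "\<And>p. p \<ge> M1 \<Longrightarrow> a p = 0" and e: "e = (\<Sum>p<M1. (- 1) ^ p * int (a p))"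
    using A unfolding euler_pair_def by blast
  \<comment> \<open>The bound \<open>Suc M1\<close> makes the end of the telescope vanish, because
    \<open>t M\<close> is a summand of \<open>a (M - 1)\<close>.\<close>
  have sums: "(\<Sum>p<M. (- 1) ^ p * int (r p + s p)) = (\<Sum>p<M. (- 1 :: int) ^ p * int (s p + t p)) + e"
    if "M \<ge> Suc M1" "t 0 = 0" "\<And>p. a p = t (Suc p) + r p" for r s t M
  proof -
    have "t M = 0"
      using that(1) that(3)[of "M - 1"] M1[of "M - 1"] by simp
    then have 0: "(\<Sum>p<M. (- 1 :: int) ^ p * (int (t (Suc p)) + int (t p))) = 0"
      using alternating_sum_telescope[of t M] that(2) by simp
    have "e = (\<Sum>p<M. (- 1) ^ p * int (a p))"
      unfolding e using that(1) M1 by (intro alternating_sum_extend) auto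
    also have "\<dots> = (\<Sum>p<M. (- 1) ^ p * int (r p + s p)) - (\<Sum>p<M. (- 1 :: int) ^ p * int (s p + t p))
        + (\<Sum>p<M. (- 1 :: int) ^ p * (int (t (Suc p)) + int (t p)))"
      by (simp add: that(3) sum_subtractf[symmetric] sum.distrib[symmetric] algebra_simps)
    finally show ?thesis
      using 0 by simp
  qed
  show "euler_pair X S (e' - e)" if X: "euler_pair X {} e'"
  proof -
    obtain b M2 where b: "\<And>p. has_rank (HB p) (carrier (HB p)) (b p)"
      and M2: "\<And>p. p \<ge> M2 \<Longrightarrow> b p = 0" and e': "e' = (\<Sum>p<M2. (- 1) ^ p * int (b p))"
      using X unfolding euler_pair_def HB_def by blast
    obtain r s t where rst: "t 0 = (0::nat)" "\<And>p. a p = t (Suc p) + r p"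
      "\<And>p. has_rank (HB p) (carrier (HB p)) (r p + s p)"
      "\<And>p. has_rank (HC p) (carrier (HC p)) (s p + t p)"
      using pair_ranks[of X S a, OF a] b unfolding HB_def HC_def by blast
    have b_eq: "b p = r p + s p" for p
      using b rst(3) has_rank_unique by blast
    define M where "M = max (Suc M1) M2"
    have M: "M \<ge> Suc M1" "M \<ge> M2"
      by (auto simp: M_def)
    show ?thesis
    proof (rule euler_pairI)
      show "s p + t p = 0" if "p \<ge> M" for p
        using M2[of p] M1[of "p - 1"] rst(2)[of "p - 1"] that M b_eq[of p] by simp
      show "has_rank (relative_homology_group (int p) X S)
          (carrier (relative_homology_group (int p) X S)) (s p + t p)" for p
        using rst(4) unfolding HC_def .
      have "e' = (\<Sum>p<M. (- 1) ^ p * int (b p))"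
        unfolding e' using M M2 by (intro alternating_sum_extend) auto
      then show "e' - e = (\<Sum>p<M. (- 1) ^ p * int (s p + t p))"
        using sums[OF M(1) rst(1,2), of s] by (simp add: b_eq)
    qed
  qed
  show "euler_pair X {} (e' + e)" if X: "euler_pair X S e'"
  proof -
    obtain c M2 where c: "\<And>p. has_rank (HC p) (carrier (HC p)) (c p)"
      and M2: "\<And>p. p \<ge> M2 \<Longrightarrow> c p = 0" and e': "e' = (\<Sum>p<M2. (- 1) ^ p * int (c p))"
      using X unfolding euler_pair_def HC_def by blast
    obtain r s t where rst: "t 0 = (0::nat)" "\<And>p. a p = t (Suc p) + r p"
      "\<And>p. has_rank (HB p) (carrier (HB p)) (r p + s p)"
      "\<And>p. has_rank (HC p) (carrier (HC p)) (s p + t p)"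
      using pair_ranks[of X S a, OF a] c unfolding HB_def HC_def by blast
    have c_eq: "c p = s p + t p" for p
      using c rst(4) has_rank_unique by blast
    define M where "M = max (Suc M1) M2"
    have M: "M \<ge> Suc M1" "M \<ge> M2"
      by (auto simp: M_def)
    show ?thesis
    proof (rule euler_pairI)
      show "r p + s p = 0" if "p \<ge> M" for p
        using M2[of p] M1[of p] rst(2)[of p] that M c_eq[of p] by simp
      show "has_rank (homology_group (int p) X) (carrier (homology_group (int p) X)) (r p + s p)" for p
        using rst(3) unfolding HB_def .
      have "e' = (\<Sum>p<M. (- 1) ^ p * int (c p))"
        unfolding e' using M M2 by (intro alternating_sum_extend) auto
      then show "e' + e = (\<Sum>p<M. (- 1) ^ p * int (r p + s p))"
        using sums[OF M(1) rst(1,2), of s] by (simp add: c_eq)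
    qed
  qed
qed

lemma euler_pair_iso:
  assumes "\<And>p. relative_homology_group (int p) X S \<cong> relative_homology_group (int p) Y T"
    and "euler_pair X S e"
  shows "euler_pair Y T e"
proof -
  obtain b M where b: "\<And>p. has_rank (relative_homology_group (int p) X S)
      (carrier (relative_homology_group (int p) X S)) (b p)"
    and M: "\<And>p. p \<ge> M \<Longrightarrow> b p = 0" and e: "e = (\<Sum>p<M. (- 1) ^ p * int (b p))"
    using assms(2) unfolding euler_pair_def by blast
  have "has_rank (relative_homology_group (int p) Y T) (carrier (relative_homology_group (int p) Y T)) (b p)" for p
    by (rule has_rank_iso[OF _ _ assms(1) b]) simp_all
  then show ?thesis
    using M e by (rule euler_pairI)
qed

lemma euler_pair_homeomorphic:
  assumes "X homeomorphic_space Y" "euler_pair X {} e"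
  shows "euler_pair Y {} e"
  using euler_pair_iso homeomorphic_space_imp_isomorphic_homology_groups assms by blast

text \<open>Excising \<open>A - B\<close> from the pair formed by \<open>A \<union> B\<close> and
  \<open>A\<close> leaves \<open>B\<close> and \<open>A \<inter> B\<close>, so the relative Euler
  characteristic is \<open>b - c\<close>; the sequence of the pair adds \<open>a\<close>. Openness
  supplies the closure condition of excision: \<open>A - B\<close> is closed in the union, and
  \<open>A\<close> is its own interior.\<close>

lemma euler_pair_Un:
  assumes "openin X A" "openin X B"
    and a: "euler_pair (subtopology X A) {} a" and b: "euler_pair (subtopology X B) {} b"
    and c: "euler_pair (subtopology X (A \<inter> B)) {} c"
  shows "euler_pair (subtopology X (A \<union> B)) {} (a + b - c)"
proof -
  define Y where "Y = subtopology X (A \<union> B)"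
  have sub: "A \<subseteq> topspace X" "B \<subseteq> topspace X"
    using assms(1,2) openin_subset by auto
  have oA: "openin Y A" and oB: "openin Y B"
    unfolding Y_def using assms(1,2) by (auto simp: openin_subtopology)
  have top: "topspace Y = A \<union> B"
    using sub by (auto simp: Y_def)
  have YA: "subtopology Y A = subtopology X A" and YB: "subtopology Y B = subtopology X B"
    and YAB: "subtopology (subtopology Y B) (A \<inter> B) = subtopology X (A \<inter> B)"
    unfolding Y_def by (simp_all add: subtopology_subtopology Int_absorb1 Int_absorb2 inf.absorb2 Un_Int_eq)
  define U where "U = A - B"
  have UA: "A - U = A \<inter> B" and UU: "A \<union> B - U = B"
    by (auto simp: U_def)
  have "closedin Y U"
    using oB top UU by (auto simp: closedin_def U_def)
  then have "Y closure_of U \<subseteq> Y interior_of A"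
    using oA by (simp add: closure_of_closedin interior_of_openin U_def)
  then have "hom_induced p (subtopology Y (A \<union> B - U)) (A - U) (subtopology Y (A \<union> B)) A id
      \<in> iso (relative_homology_group p (subtopology Y (A \<union> B - U)) (A - U))
            (relative_homology_group p (subtopology Y (A \<union> B)) A)" for p
    by (intro homology_excision_axiom) auto
  then have iso: "relative_homology_group p (subtopology Y B) (A \<inter> B) \<cong> relative_homology_group p Y A" for p
    unfolding UA UU by (metis is_isoI subtopology_topspace top)
  have "euler_pair (subtopology Y B) (A \<inter> B) (b - c)"
    by (rule euler_pair_exact(1)) (use b c YB YAB in auto)
  then have "euler_pair Y A (b - c)"
    using iso by (rule euler_pair_iso[rotated])
  then have "euler_pair Y {} (b - c + a)"
    by (rule euler_pair_exact(2)[rotated]) (use a YA in auto)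
  then show ?thesis
    by (simp add: Y_def algebra_simps)
qed

lemma euler_pair_empty:
  assumes "topspace X = {}"
  shows "euler_pair X {} 0"
proof (rule euler_pairI[where b = "\<lambda>_. 0" and M = 0])
  show "has_rank (homology_group (int p) X) (carrier (homology_group (int p) X)) 0" for p
    using trivial_homology_group_empty[OF assms, of "int p"]
    by (intro has_rank_trivial) (auto simp: trivial_group_def)
qed auto

lemma euler_pair_contractible:
  assumes "contractible_space X" "topspace X \<noteq> {}"
  shows "euler_pair X {} 1"
proof -
  obtain a where a: "a \<in> topspace X" "X homotopy_equivalent_space subtopology X {a}"
    using assms unfolding contractible_eq_homotopy_equivalent_singleton_subtopology by auto
  let ?P = "subtopology X {a}"
  have P: "topspace ?P = {a}"
    using a by auto
  have "euler_pair ?P {} 1"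
  proof (rule euler_pairI[where b = "\<lambda>p. if p = 0 then 1 else 0" and M = 1])
    show "has_rank (homology_group (int p) ?P) (carrier (homology_group (int p) ?P))
        (if p = 0 then 1 else 0)" for p
    proof (cases "p = 0")
      case True
      have "homology_group 0 ?P \<cong> integer_group"
        using homology_coefficients[OF P] .
      then have "integer_group \<cong> homology_group 0 ?P"
        by (simp add: group.iso_sym)
      from has_rank_iso[OF abelian_integer_group _ this has_rank_integer_group] show ?thesis
        using True by simp
    next
      case False
      then show ?thesis
        using homology_dimension_axiom[OF P, of "int p"]
        by (auto intro!: has_rank_trivial simp: trivial_group_def)
    qed
  qed auto
  moreover have "?P homotopy_equivalent_space X"
    using a(2) homotopy_equivalent_space_sym by blast
  ultimately show ?thesis
    using euler_pair_iso homotopy_equivalent_space_imp_isomorphic_homology_groups by blast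
qed

section \<open>Products of plane domains\<close>

text \<open>The star centres are 1 and -1. The two slit planes cover the punctured plane and overlap
  in the open upper and lower half-planes.\<close>

lemma starlike_complex_slit:
  "starlike (- \<real>\<^sub>\<le>\<^sub>0 :: complex set)" "starlike (- \<real>\<^sub>\<ge>\<^sub>0 :: complex set)"
proof -
  show "starlike (- \<real>\<^sub>\<le>\<^sub>0 :: complex set)"
    unfolding starlike_def
  proof (intro bexI[of _ 1] ballI subsetI)
    fix x y :: complex assume x: "x \<in> - \<real>\<^sub>\<le>\<^sub>0" and "y \<in> closed_segment 1 x"
    then obtain u where u: "0 \<le> u" "u \<le> 1" "y = (1 - u) *\<^sub>R 1 + u *\<^sub>R x"
      by (auto simp: closed_segment_def)
    show "y \<in> - \<real>\<^sub>\<le>\<^sub>0"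
    proof (rule ccontr)
      assume "\<not> ?thesis"
      then have y: "Im x = 0 \<or> u = 0" "1 - u + u * Re x \<le> 0"
        using u by (auto simp: complex_nonpos_Reals_iff)
      then have "Im x = 0" "Re x > 0"
        using u(2) x by (auto simp: complex_nonpos_Reals_iff)
      moreover from this have "u * Re x \<ge> 0"
        using u by simp
      ultimately have "u = 1" "u * Re x = 0"
        using y u by linarith+
      with \<open>Re x > 0\<close> show False
        by simp
    qed
  qed auto
  show "starlike (- \<real>\<^sub>\<ge>\<^sub>0 :: complex set)"
    unfolding starlike_def
  proof (intro bexI[of _ "-1"] ballI subsetI)
    fix x y :: complex assume x: "x \<in> - \<real>\<^sub>\<ge>\<^sub>0" and "y \<in> closed_segment (-1) x"
    then obtain u where u: "0 \<le> u" "u \<le> 1" "y = (1 - u) *\<^sub>R (-1) + u *\<^sub>R x"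
      by (auto simp: closed_segment_def)
    show "y \<in> - \<real>\<^sub>\<ge>\<^sub>0"
    proof (rule ccontr)
      assume "\<not> ?thesis"
      then have y: "Im x = 0 \<or> u = 0" "u - 1 + u * Re x \<ge> 0"
        using u by (auto simp: complex_nonneg_Reals_iff)
      then have "Im x = 0" "Re x < 0"
        using u(2) x by (auto simp: complex_nonneg_Reals_iff)
      moreover from this have "u * Re x \<le> 0"
        using u by (simp add: mult_nonneg_nonpos)
      ultimately have "u = 1" "u * Re x = 0"
        using y u by linarith+
      with \<open>Re x < 0\<close> show False
        by simp
    qed
  qed (auto simp: complex_nonneg_Reals_iff)
qed

definition complex_box :: "('n::finite \<Rightarrow> complex set) \<Rightarrow> (complex ^ 'n) set" where
  "complex_box A = {z. \<forall>i. z $ i \<in> A i}"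

lemma starlike_complex_box:
  assumes "\<And>i. starlike (A i)"
  shows "starlike (complex_box A)"
proof -
  obtain c where c: "\<And>i. c i \<in> A i" "\<And>i x. x \<in> A i \<Longrightarrow> closed_segment (c i) x \<subseteq> A i"
    using assms unfolding starlike_def by metis
  have "y \<in> complex_box A" if x: "x \<in> complex_box A" and y: "y \<in> closed_segment (\<chi> i. c i) x" for x y
  proof -
    obtain u where u: "0 \<le> u" "u \<le> 1" "y = (1 - u) *\<^sub>R (\<chi> i. c i) + u *\<^sub>R x"
      using y by (auto simp: closed_segment_def)
    have "y $ i \<in> closed_segment (c i) (x $ i)" for i
      using u by (auto simp: closed_segment_def)
    then show ?thesis
      using c(2) x unfolding complex_box_def by blast
  qed
  then show ?thesis
    unfolding starlike_def using c(1)
    by (intro bexI[of _ "\<chi> i. c i"]) (auto simp: complex_box_def)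
qed

lemma open_complex_box: "(\<And>i. open (A i)) \<Longrightarrow> open (complex_box A)"
  unfolding complex_box_def by (intro open_vector_box) auto

lemma starlike_nonempty: "starlike S \<Longrightarrow> S \<noteq> {}"
  unfolding starlike_def by auto

text \<open>Induction on the number of punctured factors. One of them is covered by two slit planes
  whose overlap is a disjoint union of two half-planes. Putting any of these four starlike sets in
  its place gives the same value e by induction, so the box has e + e - (e + e) = 0.\<close>

lemma euler_pair_complex_box:
  fixes A :: "'n::finite \<Rightarrow> complex set"
  assumes "\<And>i. A i = - {0} \<or> open (A i) \<and> starlike (A i)"
  shows "euler_pair (top_of_set (complex_box A)) {} (if \<exists>i. A i = - {0} then 0 else 1)"
  using assms
proof (induction "card {i. A i = - {0}}" arbitrary: A)
  case 0
  then have none: "\<nexists>i. A i = - {0}"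
    by simp
  then have "\<And>i. starlike (A i)"
    using 0 by blast
  then have "starlike (complex_box A)"
    by (rule starlike_complex_box)
  then have "contractible (complex_box A)" "complex_box A \<noteq> {}"
    using starlike_imp_contractible starlike_nonempty by blast+
  then have "euler_pair (top_of_set (complex_box A)) {} 1"
    by (intro euler_pair_contractible) auto
  with none show ?case
    by simp
next
  case (Suc k)
  have "card {i. A i = - {0}} \<noteq> 0"
    using Suc.hyps(2) by linarith
  then have "{i. A i = - {0}} \<noteq> {}"
    by (rule contrapos_nn) (simp only: card.empty)
  then obtain j where j: "A j = - {0}"
    by blast
  \<comment> \<open>The common value of all boxes in which the factor at \<open>j\<close> is
    replaced by an open starlike set other than \<open>- {0}\<close>; it depends only on the
    remaining factors.\<close>
  define e where "e = (if \<exists>i. i \<noteq> j \<and> A i = - {0} then 0 else 1 :: int)"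
  have opA: "open (A i)" for i
    using Suc.prems[of i] open_Compl[OF closed_singleton[of "0 :: complex"]] by metis
  have step: "euler_pair (top_of_set (complex_box (A(j := P)))) {} e"
    if P: "open P" "starlike P" "P \<noteq> - {0}" for P
  proof -
    have "{i. (A(j := P)) i = - {0}} = {i. A i = - {0}} - {j}"
      using P by auto
    then have "k = card {i. (A(j := P)) i = - {0}}"
      using Suc.hyps(2) j by (metis (mono_tags, lifting) card_Diff_singleton diff_Suc_1 mem_Collect_eq)
    then have
      "euler_pair (top_of_set (complex_box (A(j := P)))) {} (if \<exists>i. (A(j := P)) i = - {0} then 0 else 1)"
    proof (rule Suc.hyps(1))
      show "(A(j := P)) i = - {0} \<or> open ((A(j := P)) i) \<and> starlike ((A(j := P)) i)" for i
        unfolding fun_upd_apply using Suc.prems[of i] P by presburger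
    qed
    moreover have "(\<exists>i. (A(j := P)) i = - {0}) \<longleftrightarrow> (\<exists>i. i \<noteq> j \<and> A i = - {0})"
      using P by auto
    ultimately show ?thesis
      by (simp add: e_def)
  qed
  define U where "U P = complex_box (A(j := P))" for P
  have opU: "open (U P)" if "open P" for P
    unfolding U_def by (intro open_complex_box) (simp add: opA that)
  have UInt: "U P \<inter> U Q = U (P \<inter> Q)" and UUn: "U P \<union> U Q = U (P \<union> Q)" for P Q
    unfolding U_def complex_box_def by (auto split: if_splits)
  let ?L = "- \<real>\<^sub>\<le>\<^sub>0 :: complex set" and ?R = "- \<real>\<^sub>\<ge>\<^sub>0 :: complex set"
  let ?H = "{z. Im z > 0}" and ?K = "{z. Im z < 0}"
  have ops: "open ?L" "open ?R" "open ?H" "open ?K"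
    by (auto simp: open_halfspace_Im_gt open_halfspace_Im_lt)
  have "\<i> \<in> ?H" "- \<i> \<in> ?K"
    by simp_all
  then have "?H \<noteq> {}" "?K \<noteq> {}"
    by blast+
  then have "starlike ?H" "starlike ?K"
    by (auto intro!: convex_imp_starlike convex_halfspace_Im_gt convex_halfspace_Im_lt simp del: Collect_empty_eq)
  \<comment> \<open>Each piece omits a nonzero point, so it differs from \<open>- {0}\<close> and
    the number of punctured factors really drops.\<close>
  moreover have "-1 \<notin> ?L" "1 \<notin> ?R" "1 \<notin> ?H" "1 \<notin> ?K"
    by (auto simp: complex_nonpos_Reals_iff complex_nonneg_Reals_iff)
  then have "?L \<noteq> - {0}" "?R \<noteq> - {0}" "?H \<noteq> - {0}" "?K \<noteq> - {0}"
    by (metis ComplI neg_equal_0_iff_equal singletonD zero_neq_one)+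
  ultimately have charts: "euler_pair (top_of_set (U ?L)) {} e" "euler_pair (top_of_set (U ?R)) {} e"
     "euler_pair (top_of_set (U ?H)) {} e" "euler_pair (top_of_set (U ?K)) {} e"
    unfolding U_def using ops starlike_complex_slit by (auto intro: step)
  have "U ?H \<inter> U ?K = {}"
    by (simp only: UInt) (auto simp: U_def complex_box_def)
  then have "euler_pair (top_of_set (U ?H \<inter> U ?K)) {} 0"
    by (intro euler_pair_empty) simp
  then have "euler_pair (top_of_set (U ?H \<union> U ?K)) {} (e + e - 0)"
    using charts ops opU by (intro euler_pair_Un) auto
  moreover have "?H \<union> ?K = ?L \<inter> ?R"
    by (auto simp: complex_nonpos_Reals_iff complex_nonneg_Reals_iff)
  ultimately have "euler_pair (top_of_set (U ?L \<inter> U ?R)) {} (e + e)"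
    by (simp add: UInt UUn)
  then have "euler_pair (top_of_set (U ?L \<union> U ?R)) {} (e + e - (e + e))"
    using charts ops opU by (intro euler_pair_Un) auto
  moreover have "?L \<union> ?R = - {0}"
    by (auto simp: complex_nonpos_Reals_iff complex_nonneg_Reals_iff complex_eq_iff)
  moreover have "A(j := - {0}) = A"
    by (simp only: j[symmetric] fun_upd_triv)
  ultimately have "euler_pair (top_of_set (complex_box A)) {} 0"
    by (simp add: UUn) (simp add: U_def)
  moreover have "\<exists>i. A i = - {0}"
    using j by blast
  ultimately show ?case
    by (simp only: if_True)
qed

section \<open>Charts of smooth cones\<close>

lemma convex_cone_hull_finite_image:
  fixes u :: "'n::finite \<Rightarrow> 'a::real_vector"
  shows "convex_cone hull (u ` J) = {\<Sum>i\<in>UNIV. c i *\<^sub>R u i | c. (\<forall>i. 0 \<le> c i) \<and> (\<forall>i. i \<notin> J \<longrightarrow> c i = 0)}"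
    (is "_ = ?C")
proof (rule hull_unique)
  show "u ` J \<subseteq> ?C"
  proof
    fix x assume "x \<in> u ` J"
    then obtain j where j: "j \<in> J" "x = u j"
      by blast
    have "(\<Sum>i\<in>UNIV. (if i = j then 1 else 0) *\<^sub>R u i) = u j"
      by (simp add: if_distrib[of "\<lambda>c. c *\<^sub>R _"] cong: if_cong)
    with j show "x \<in> ?C"
      by (auto intro!: exI[of _ "\<lambda>i. if i = j then 1 else 0 :: real"])
  qed
  show "convex_cone ?C"
    unfolding convex_cone_iff
  proof (intro conjI ballI allI impI)
    show "0 \<in> ?C"
      by (auto intro!: exI[of _ "\<lambda>_. 0"])
    fix x y assume "x \<in> ?C" "y \<in> ?C"
    then obtain c d where "x = (\<Sum>i\<in>UNIV. c i *\<^sub>R u i)" "y = (\<Sum>i\<in>UNIV. d i *\<^sub>R u i)"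
      "\<forall>i. 0 \<le> c i" "\<forall>i. 0 \<le> d i" "\<forall>i. i \<notin> J \<longrightarrow> c i = 0" "\<forall>i. i \<notin> J \<longrightarrow> d i = 0"
      by blast
    then show "x + y \<in> ?C"
      by (intro CollectI exI[of _ "\<lambda>i. c i + d i"]) (auto simp: scaleR_left_distrib sum.distrib)
  next
    fix x and a :: real assume "x \<in> ?C" and a: "0 \<le> a"
    then obtain c where "x = (\<Sum>i\<in>UNIV. c i *\<^sub>R u i)" "\<forall>i. 0 \<le> c i" "\<forall>i. i \<notin> J \<longrightarrow> c i = 0"
      by blast
    with a show "a *\<^sub>R x \<in> ?C"
      by (intro CollectI exI[of _ "\<lambda>i. a * c i"]) (auto simp: scaleR_sum_right)
  qed
  fix T assume T: "u ` J \<subseteq> T" "convex_cone T"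
  show "?C \<subseteq> T"
  proof
    fix x assume "x \<in> ?C"
    then obtain c where c: "x = (\<Sum>i\<in>UNIV. c i *\<^sub>R u i)" "\<forall>i. 0 \<le> c i" "\<forall>i. i \<notin> J \<longrightarrow> c i = 0"
      by blast
    have "(\<Sum>i\<in>A. c i *\<^sub>R u i) \<in> T" for A
    proof (induction A rule: infinite_finite_induct)
      case (insert i A)
      have "c i *\<^sub>R u i \<in> T"
        using T c convex_cone_scaleR[OF T(2)] convex_cone_contains_0[OF T(2)] by (cases "i \<in> J") auto
      with insert show ?case
        using convex_cone_add[OF T(2)] by simp
    qed (use convex_cone_contains_0[OF T(2)] in auto)
    then show "x \<in> T"
      using c by blast
  qed
qed

lemma subset_range_eq_image: "V \<subseteq> range u \<Longrightarrow> V = u ` {i. u i \<in> V}"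
  by auto

lemma topspace_affine_toric_variety:
  "topspace (affine_toric_variety N \<sigma>) = affine_toric_points N \<sigma>"
  by (auto simp: affine_toric_variety_def affine_toric_points_def PiE_def)

text \<open>The vectors \<open>m i\<close> are the coordinate functionals of \<open>u\<close>. Their
  existence encodes that \<open>u\<close> is a basis, and membership in a cone becomes a sign
  condition on coordinates.\<close>

locale dual_bases =
  fixes u m :: "'n::finite \<Rightarrow> real ^ 'n"
  assumes dual: "m i \<bullet> u j = (if i = j then 1 else 0)"
begin

lemma inj_u: "inj u"
  by (rule injI) (metis dual zero_neq_one)

lemma coord_sum: "m j \<bullet> (\<Sum>i\<in>UNIV. c i *\<^sub>R u i) = c j"
proof -
  have "m j \<bullet> (\<Sum>i\<in>UNIV. c i *\<^sub>R u i) = (\<Sum>i\<in>UNIV. if j = i then c i else 0)"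
    unfolding inner_sum_right by (intro sum.cong) (auto simp: dual)
  then show ?thesis
    by simp
qed

lemma span_u: "span (range u) = UNIV"
proof -
  have "independent (range u)"
  proof (rule independent_if_scalars_zero)
    fix f x assume f: "(\<Sum>x\<in>range u. f x *\<^sub>R x) = 0" and "x \<in> range u"
    then obtain i where "x = u i"
      by blast
    moreover have "(\<Sum>i\<in>UNIV. f (u i) *\<^sub>R u i) = 0"
      using f sum.reindex[OF inj_u, of "\<lambda>x. f x *\<^sub>R x"] by (simp add: o_def)
    ultimately show "f x = 0"
      using coord_sum[of i "\<lambda>i. f (u i)"] by simp
  qed simp
  moreover have "card (range u) = DIM(real ^ 'n)"
    using inj_u by (simp add: card_image)
  ultimately show ?thesis
    by (metis card_eq_dim dim_UNIV finite_imageI finite top.extremum top.extremum_uniqueI)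
qed

lemma dual_expand: "w = (\<Sum>i\<in>UNIV. (w \<bullet> u i) *\<^sub>R m i)"
proof -
  define d where "d = w - (\<Sum>i\<in>UNIV. (w \<bullet> u i) *\<^sub>R m i)"
  have "d \<bullet> u j = 0" for j
  proof -
    have "(\<Sum>i\<in>UNIV. (w \<bullet> u i) *\<^sub>R m i) \<bullet> u j = (\<Sum>i\<in>UNIV. if i = j then w \<bullet> u i else 0)"
      unfolding inner_sum_left by (intro sum.cong) (auto simp: dual)
    then show ?thesis
      by (simp add: d_def inner_diff_left)
  qed
  then have "range u \<subseteq> {x. d \<bullet> x = 0}"
    by auto
  moreover have "subspace {x. d \<bullet> x = 0}"
    by (rule subspace_hyperplane)
  ultimately have "span (range u) \<subseteq> {x. d \<bullet> x = 0}"
    using span_minimal by blast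
  \<comment> \<open>\<open>d\<close> is orthogonal to a spanning family, hence to itself.\<close>
  then have "d \<in> {x. d \<bullet> x = 0}"
    unfolding span_u by blast
  then show ?thesis
    by (simp add: d_def)
qed

lemma eqI_coord:
  assumes "\<And>j. m j \<bullet> x = m j \<bullet> y"
  shows "x = y"
proof -
  have "w \<bullet> x = w \<bullet> y" for w
    by (subst (1 2) dual_expand[of w]) (simp add: inner_sum_left assms)
  then show ?thesis
    using vector_eq_ldot by metis
qed

lemma expand: "x = (\<Sum>i\<in>UNIV. (m i \<bullet> x) *\<^sub>R u i)"
  by (rule eqI_coord) (simp add: coord_sum)

lemma mem_cone_iff:
  assumes "V \<subseteq> range u"
  shows "x \<in> convex_cone hull V \<longleftrightarrow> (\<forall>i. 0 \<le> m i \<bullet> x \<and> (u i \<notin> V \<longrightarrow> m i \<bullet> x = 0))"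
proof -
  have "convex_cone hull V = {\<Sum>i\<in>UNIV. c i *\<^sub>R u i | c. (\<forall>i. 0 \<le> c i) \<and> (\<forall>i. u i \<notin> V \<longrightarrow> c i = 0)}"
    using convex_cone_hull_finite_image[of u "{i. u i \<in> V}"] subset_range_eq_image[OF assms] by simp
  then show ?thesis
    using expand[of x] by (auto simp: coord_sum)
qed

end

text \<open>A basis of the lattice: the cone over any subset of \<open>range u\<close> is
  smooth.\<close>

locale lattice_chart = dual_bases +
  fixes N :: "(real ^ 'n) set"
  assumes N_eq: "N = {\<Sum>i\<in>UNIV. of_int (z i) *\<^sub>R u i | z. True}"
begin

lemma mem_semigroup_iff:
  assumes V: "V \<subseteq> range u"
  shows "w \<in> cone_semigroup N (convex_cone hull V) \<longleftrightarrow>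
    (\<forall>i. w \<bullet> u i \<in> \<int> \<and> (u i \<in> V \<longrightarrow> 0 \<le> w \<bullet> u i))"
proof -
  have "w \<in> dual_lattice N \<longleftrightarrow> (\<forall>i. w \<bullet> u i \<in> \<int>)"
  proof
    assume w: "w \<in> dual_lattice N"
    have "u i \<in> N" for i
    proof -
      have "u i = (\<Sum>j\<in>UNIV. of_int (if j = i then 1 else 0) *\<^sub>R u j)"
        by (simp add: if_distrib[of of_int] if_distrib[of "\<lambda>c. c *\<^sub>R _"] cong: if_cong)
      then show ?thesis
        unfolding N_eq by (intro CollectI exI[of _ "\<lambda>j. if j = i then 1 else 0"]) simp
    qed
    with w show "\<forall>i. w \<bullet> u i \<in> \<int>"
      by (auto simp: dual_lattice_def)
  next
    assume "\<forall>i. w \<bullet> u i \<in> \<int>"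
    then show "w \<in> dual_lattice N"
      unfolding dual_lattice_def N_eq by (auto simp: inner_sum_right intro!: Ints_sum Ints_mult)
  qed
  moreover have "w \<in> dual_cone (convex_cone hull V) \<longleftrightarrow> (\<forall>i. u i \<in> V \<longrightarrow> 0 \<le> w \<bullet> u i)"
  proof
    show "\<forall>i. u i \<in> V \<longrightarrow> 0 \<le> w \<bullet> u i" if "w \<in> dual_cone (convex_cone hull V)"
      using that by (auto simp: dual_cone_def hull_inc)
    assume "\<forall>i. u i \<in> V \<longrightarrow> 0 \<le> w \<bullet> u i"
    then have "V \<subseteq> {x. w \<bullet> x \<ge> 0}"
      using V by auto
    then have "convex_cone hull V \<subseteq> {x. w \<bullet> x \<ge> 0}"
      by (rule hull_minimal) (rule convex_cone_halfspace_ge)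
    then show "w \<in> dual_cone (convex_cone hull V)"
      by (auto simp: dual_cone_def)
  qed
  ultimately show ?thesis
    by (auto simp: cone_semigroup_def)
qed

section \<open>Coordinates on the chart of a smooth cone\<close>

definition chart_domain :: "(real ^ 'n) set \<Rightarrow> (complex ^ 'n) set" where
  "chart_domain V = {z. \<forall>i. u i \<notin> V \<longrightarrow> z $ i \<noteq> 0}"

text \<open>The Laurent monomial with exponent vector \<open>w\<close>. On the semigroup the
  pairings are integers, and the floor only changes their type. The points of a chart turn out to be
  exactly these evaluations at the points of \<open>chart_domain V\<close>.\<close>

definition character_value :: "complex ^ 'n \<Rightarrow> real ^ 'n \<Rightarrow> complex" where
  "character_value z w = (\<Prod>i\<in>UNIV. z $ i powi \<lfloor>w \<bullet> u i\<rfloor>)"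

definition chart_point :: "(real ^ 'n) set \<Rightarrow> complex ^ 'n \<Rightarrow> real ^ 'n \<Rightarrow> complex" where
  "chart_point V z = restrict (character_value z) (cone_semigroup N (convex_cone hull V))"

definition chart_coord :: "(real ^ 'n \<Rightarrow> complex) \<Rightarrow> complex ^ 'n" where
  "chart_coord y = (\<chi> i. y (m i))"

lemma dual_in_semigroup: "V \<subseteq> range u \<Longrightarrow> m i \<in> cone_semigroup N (convex_cone hull V)"
  by (simp add: mem_semigroup_iff dual)

lemma semigroup_add:
  assumes "V \<subseteq> range u" "w \<in> cone_semigroup N (convex_cone hull V)" "w' \<in> cone_semigroup N (convex_cone hull V)"
  shows "w + w' \<in> cone_semigroup N (convex_cone hull V)"
  using assms by (auto simp: mem_semigroup_iff inner_add_left)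

lemma character_value_dual: "character_value z (m i) = z $ i"
proof -
  have "character_value z (m i) = (\<Prod>j\<in>UNIV. if j = i then z $ j else 1)"
    unfolding character_value_def by (intro prod.cong) (auto simp: dual)
  then show ?thesis
    by simp
qed

lemma chart_point_in:
  assumes V: "V \<subseteq> range u" and z: "z \<in> chart_domain V"
  shows "chart_point V z \<in> affine_toric_points N (convex_cone hull V)"
  unfolding affine_toric_points_def
proof (intro CollectI conjI ballI)
  let ?S = "cone_semigroup N (convex_cone hull V)"
  show "chart_point V z \<in> extensional ?S"
    by (simp add: chart_point_def)
  have "0 \<in> ?S"
    using V by (simp add: mem_semigroup_iff)
  then show "chart_point V z 0 = 1"
    by (simp add: chart_point_def character_value_def)
  fix w w' assume w: "w \<in> ?S" "w' \<in> ?S"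
  have "z $ i powi \<lfloor>(w + w') \<bullet> u i\<rfloor> = z $ i powi \<lfloor>w \<bullet> u i\<rfloor> * z $ i powi \<lfloor>w' \<bullet> u i\<rfloor>" for i
  proof -
    have int: "w \<bullet> u i \<in> \<int>" "w' \<bullet> u i \<in> \<int>"
      and pos: "u i \<in> V \<Longrightarrow> 0 \<le> w \<bullet> u i \<and> 0 \<le> w' \<bullet> u i"
      using w V by (auto simp: mem_semigroup_iff)
    from int obtain k l where kl: "w \<bullet> u i = of_int k" "w' \<bullet> u i = of_int l"
      by (auto elim!: Ints_cases)
    have "z $ i powi (k + l) = z $ i powi k * z $ i powi l"
    \<comment> \<open>The exponent law can fail only at \<open>z $ i = 0\<close> with
      \<open>k + l = 0\<close>. A zero coordinate forces \<open>u i \<in> V\<close>, where both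
      exponents are nonnegative and therefore 0.\<close>
    proof (cases "z $ i \<noteq> 0 \<or> k + l \<noteq> 0")
      case True
      then show ?thesis
        by (rule power_int_add)
    next
      case False
      then have "u i \<in> V"
        using z by (auto simp: chart_domain_def)
      then have "0 \<le> k" "0 \<le> l"
        using pos kl by auto
      with False have "k = 0" "l = 0"
        by auto
      with False show ?thesis
        by simp
    qed
    then show ?thesis
      by (simp add: kl inner_add_left flip: of_int_add)
  qed
  then show "chart_point V z (w + w') = chart_point V z w * chart_point V z w'"
    using w semigroup_add[OF V] by (simp add: chart_point_def character_value_def prod.distrib)
qed

text \<open>A homomorphism is determined by its values at the dual basis, because \<open>w\<close>
  is an integer combination of the \<open>m i\<close>, with nonnegative coefficients where
  \<open>u i \<in> V\<close>. Where \<open>u i \<notin> V\<close>, the semigroup also contains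
  \<open>- m i\<close>, which makes the value at \<open>m i\<close> invertible.\<close>

lemma point_eq_character_value:
  assumes V: "V \<subseteq> range u" and y: "y \<in> affine_toric_points N (convex_cone hull V)"
    and w: "w \<in> cone_semigroup N (convex_cone hull V)"
  shows "y w = character_value (chart_coord y) w"
proof -
  let ?S = "cone_semigroup N (convex_cone hull V)"
  have y0: "y 0 = 1" and add: "\<And>a b. a \<in> ?S \<Longrightarrow> b \<in> ?S \<Longrightarrow> y (a + b) = y a * y b"
    using y by (auto simp: affine_toric_points_def)
  have S: "of_int k *\<^sub>R m i \<in> ?S" if "u i \<in> V \<Longrightarrow> 0 \<le> k" for k i
    using V that by (auto simp: mem_semigroup_iff dual)
  have nat: "y (of_int (int k) *\<^sub>R m i) = y (m i) ^ k" for k i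
  proof (induction k)
    case (Suc k)
    have "of_int (int (Suc k)) *\<^sub>R m i = m i + of_int (int k) *\<^sub>R m i"
      by (simp add: scaleR_left_distrib)
    then have "y (of_int (int (Suc k)) *\<^sub>R m i) = y (m i + of_int (int k) *\<^sub>R m i)"
      by (rule arg_cong)
    also have "\<dots> = y (m i) * y (of_int (int k) *\<^sub>R m i)"
      using dual_in_semigroup[OF V] S[of i "int k"] by (intro add) auto
    finally show ?case
      using Suc by simp
  qed (simp add: y0)
  have pow: "y (of_int k *\<^sub>R m i) = y (m i) powi k" if k: "u i \<in> V \<Longrightarrow> 0 \<le> k" for k i
  proof (cases "0 \<le> k")
    case True
    then show ?thesis
      using nat[of "nat k" i] by (simp add: power_int_nonneg_exp)
  next
    case False
    then have "u i \<notin> V"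
      using k by auto
    then have "y (of_int k *\<^sub>R m i + of_int (- k) *\<^sub>R m i) = y (of_int k *\<^sub>R m i) * y (of_int (- k) *\<^sub>R m i)"
      by (intro add S) simp_all
    moreover have "of_int k *\<^sub>R m i + of_int (- k) *\<^sub>R m i = 0"
      by (simp flip: scaleR_left_distrib)
    moreover have "y (of_int (- k) *\<^sub>R m i) = y (m i) ^ nat (- k)"
      using nat[of "nat (- k)" i] False by simp
    ultimately have "y (of_int k *\<^sub>R m i) * y (m i) ^ nat (- k) = 1"
      using y0 by metis
    then have "y (of_int k *\<^sub>R m i) = inverse (y (m i) ^ nat (- k))"
      by (metis inverse_unique mult.commute)
    then show ?thesis
      using False by (simp add: power_int_def power_inverse)
  qed
  have floor: "of_int \<lfloor>w \<bullet> u i\<rfloor> = w \<bullet> u i" "u i \<in> V \<Longrightarrow> 0 \<le> \<lfloor>w \<bullet> u i\<rfloor>" for i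
    using w V by (auto simp: mem_semigroup_iff)
  have "(\<Sum>i\<in>A. of_int \<lfloor>w \<bullet> u i\<rfloor> *\<^sub>R m i) \<in> ?S \<and>
      y (\<Sum>i\<in>A. of_int \<lfloor>w \<bullet> u i\<rfloor> *\<^sub>R m i) = (\<Prod>i\<in>A. y (m i) powi \<lfloor>w \<bullet> u i\<rfloor>)" if "finite A" for A
    using that
  proof (induction A rule: finite_induct)
    case empty
    show ?case
      using V y0 by (simp add: mem_semigroup_iff)
  next
    case (insert i A)
    have "of_int \<lfloor>w \<bullet> u i\<rfloor> *\<^sub>R m i \<in> ?S"
      using S floor by blast
    with insert show ?case
      using add semigroup_add[OF V] pow[of i "\<lfloor>w \<bullet> u i\<rfloor>"] floor(2)[of i] by simp
  qed
  from this[of UNIV] show ?thesis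
    using dual_expand[of w] by (simp add: floor character_value_def chart_coord_def)
qed

lemma chart_coord_in:
  assumes V: "V \<subseteq> range u" and y: "y \<in> affine_toric_points N (convex_cone hull V)"
  shows "chart_coord y \<in> chart_domain V"
  unfolding chart_domain_def
proof (intro CollectI allI impI)
  fix i assume i: "u i \<notin> V"
  let ?S = "cone_semigroup N (convex_cone hull V)"
  have "m i \<in> ?S" "- m i \<in> ?S"
    using V i by (auto simp: mem_semigroup_iff dual)
  then have "y (m i + - m i) = y (m i) * y (- m i)" "y 0 = 1"
    using y unfolding affine_toric_points_def by blast+
  then show "chart_coord y $ i \<noteq> 0"
    by (auto simp: chart_coord_def)
qed

lemma chart_coord_point: "V \<subseteq> range u \<Longrightarrow> chart_coord (chart_point V z) = z"
  by (simp add: chart_coord_def chart_point_def dual_in_semigroup character_value_dual vec_eq_iff)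

lemma chart_point_coord:
  assumes V: "V \<subseteq> range u" and y: "y \<in> affine_toric_points N (convex_cone hull V)"
  shows "chart_point V (chart_coord y) = y"
proof -
  have "y \<in> extensional (cone_semigroup N (convex_cone hull V))"
    using y by (simp add: affine_toric_points_def)
  moreover have "chart_point V (chart_coord y) \<in> extensional (cone_semigroup N (convex_cone hull V))"
    by (simp add: chart_point_def)
  ultimately show ?thesis
    by (intro extensionalityI[of _ "cone_semigroup N (convex_cone hull V)"])
      (simp_all add: chart_point_def point_eq_character_value[OF V y])
qed

lemma chart_homeomorphic_maps:
  assumes V: "V \<subseteq> range u"
  shows "homeomorphic_maps (top_of_set (chart_domain V)) (affine_toric_variety N (convex_cone hull V))
    (chart_point V) chart_coord"
  unfolding homeomorphic_maps_def
proof (intro conjI ballI)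
  let ?S = "cone_semigroup N (convex_cone hull V)"
  show "continuous_map (top_of_set (chart_domain V)) (affine_toric_variety N (convex_cone hull V)) (chart_point V)"
    unfolding affine_toric_variety_def continuous_map_in_subtopology continuous_map_componentwise
  proof (intro conjI ballI)
    show "chart_point V ` topspace (top_of_set (chart_domain V)) \<subseteq> extensional ?S"
      by (auto simp: chart_point_def)
    show "chart_point V \<in> topspace (top_of_set (chart_domain V)) \<rightarrow> affine_toric_points N (convex_cone hull V)"
      using chart_point_in[OF V] by auto
    fix w assume w: "w \<in> ?S"
    have "continuous_on (chart_domain V) (\<lambda>z. \<Prod>i\<in>UNIV. z $ i powi \<lfloor>w \<bullet> u i\<rfloor>)"
    proof (intro continuous_on_prod continuous_on_power_int continuous_intros)
      fix i
      show "0 \<le> \<lfloor>w \<bullet> u i\<rfloor> \<or> (\<forall>z\<in>chart_domain V. z $ i \<noteq> 0)"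
        using w V by (cases "u i \<in> V") (auto simp: mem_semigroup_iff chart_domain_def)
    qed
    then show "continuous_map (top_of_set (chart_domain V)) euclidean (\<lambda>z. chart_point V z w)"
      using w by (simp add: chart_point_def character_value_def)
  qed
  show "continuous_map (affine_toric_variety N (convex_cone hull V)) (top_of_set (chart_domain V)) chart_coord"
    unfolding continuous_map_in_subtopology
  proof (intro conjI)
    have eq: "chart_coord y = (\<Sum>i\<in>UNIV. axis i (y (m i)))" for y
      by (simp add: chart_coord_def vec_eq_iff axis_def if_distrib cong: if_cong)
    have "continuous_map (affine_toric_variety N (convex_cone hull V)) euclidean (\<lambda>y. axis i (y (m i)))" for i
    proof -
      have "continuous_map (affine_toric_variety N (convex_cone hull V)) euclidean (\<lambda>y. y (m i))"
        unfolding affine_toric_variety_def using dual_in_semigroup[OF V]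
        by (intro continuous_map_from_subtopology continuous_map_product_projection)
      moreover have "continuous_map euclidean euclidean (axis i :: complex \<Rightarrow> complex ^ 'n)"
        by (simp add: linear_continuous_on linear_linear linearI vec_eq_iff axis_def)
      ultimately show ?thesis
        using continuous_map_compose[of _ euclidean "\<lambda>y. y (m i)" euclidean "axis i"] by (simp add: o_def)
    qed
    then show "continuous_map (affine_toric_variety N (convex_cone hull V)) euclidean chart_coord"
      unfolding eq by (intro continuous_map_sum) auto
    show "chart_coord \<in> topspace (affine_toric_variety N (convex_cone hull V)) \<rightarrow> chart_domain V"
      using chart_coord_in[OF V] by (simp add: topspace_affine_toric_variety)
  qed
qed (use V in \<open>auto simp: chart_coord_point chart_point_coord topspace_affine_toric_variety\<close>)

end

section \<open>Gluing the charts of a smooth fan\<close>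

abbreviation cone_hull :: "(real ^ 'n) set \<Rightarrow> (real ^ 'n) set" where
  "cone_hull V \<equiv> convex_cone hull V"

lemma cone_semigroup_antimono: "\<tau> \<subseteq> \<sigma> \<Longrightarrow> cone_semigroup N \<sigma> \<subseteq> cone_semigroup N \<tau>"
  by (auto simp: cone_semigroup_def dual_cone_def)

lemma zero_in_cone_semigroup: "0 \<in> cone_semigroup N \<sigma>"
  by (auto simp: cone_semigroup_def dual_cone_def dual_lattice_def)

lemma cone_semigroup_add: "w \<in> cone_semigroup N \<sigma> \<Longrightarrow> w' \<in> cone_semigroup N \<sigma> \<Longrightarrow> w + w' \<in> cone_semigroup N \<sigma>"
  by (auto simp: cone_semigroup_def dual_cone_def dual_lattice_def inner_add_left)

lemma affine_toric_points_restrict: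
  assumes "y \<in> affine_toric_points N \<tau>" "\<tau> \<subseteq> \<sigma>"
  shows "restrict y (cone_semigroup N \<sigma>) \<in> affine_toric_points N \<sigma>"
  using assms cone_semigroup_antimono[OF assms(2), of N]
  by (auto simp: affine_toric_points_def zero_in_cone_semigroup cone_semigroup_add subset_iff)

lemma affine_toric_points_restrict_same:
  "y \<in> affine_toric_points N \<sigma> \<Longrightarrow> restrict y (cone_semigroup N \<sigma>) = y"
  by (simp add: affine_toric_points_def extensional_restrict)

lemma restrict_cone_semigroup:
  "\<tau> \<subseteq> \<sigma> \<Longrightarrow> restrict (restrict y (cone_semigroup N \<tau>)) (cone_semigroup N \<sigma>) = restrict y (cone_semigroup N \<sigma>)"
  using cone_semigroup_antimono[of \<tau> \<sigma> N] by (auto simp: restrict_def fun_eq_iff)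

lemma continuous_map_restrict_affine_toric:
  assumes "\<tau> \<subseteq> \<sigma>"
  shows "continuous_map (affine_toric_variety N \<tau>) (affine_toric_variety N \<sigma>) (\<lambda>y. restrict y (cone_semigroup N \<sigma>))"
  unfolding affine_toric_variety_def continuous_map_in_subtopology continuous_map_componentwise
proof (intro conjI ballI)
  show "(\<lambda>y. restrict y (cone_semigroup N \<sigma>)) \<in>
      topspace (subtopology (product_topology (\<lambda>_. euclidean) (cone_semigroup N \<tau>)) (affine_toric_points N \<tau>))
      \<rightarrow> affine_toric_points N \<sigma>"
    using affine_toric_points_restrict[OF _ assms] by auto
  fix w assume w: "w \<in> cone_semigroup N \<sigma>"
  then have "w \<in> cone_semigroup N \<tau>"
    using cone_semigroup_antimono[OF assms] by blast
  then have "continuous_map (subtopology (product_topology (\<lambda>_. euclidean) (cone_semigroup N \<tau>)) (affine_toric_points N \<tau>))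
      euclidean (\<lambda>y. y w)"
    by (intro continuous_map_from_subtopology continuous_map_product_projection)
  then show "continuous_map (subtopology (product_topology (\<lambda>_. euclidean) (cone_semigroup N \<tau>)) (affine_toric_points N \<tau>))
      euclidean (\<lambda>y. restrict y (cone_semigroup N \<sigma>) w)"
    using w by simp
qed auto

context lattice_chart
begin

lemma restrict_chart_point:
  assumes "W \<subseteq> V"
  shows "restrict (chart_point W z) (cone_semigroup N (cone_hull V)) = chart_point V z"
  unfolding chart_point_def using restrict_cone_semigroup[OF hull_mono[OF assms]] .

lemma chart_coord_restrict:
  "V \<subseteq> range u \<Longrightarrow> chart_coord (restrict y (cone_semigroup N (cone_hull V))) = chart_coord y"
  by (simp add: chart_coord_def dual_in_semigroup)

text \<open>In chart coordinates this is the inclusion of the open set \<open>chart_domain W\<close>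
  into \<open>chart_domain V\<close>.\<close>

lemma open_map_restrict_affine_toric:
  assumes V: "V \<subseteq> range u" and W: "W \<subseteq> V"
  shows "open_map (affine_toric_variety N (cone_hull W)) (affine_toric_variety N (cone_hull V))
    (\<lambda>y. restrict y (cone_semigroup N (cone_hull V)))"
  unfolding open_map_def
proof (intro allI impI)
  have Wu: "W \<subseteq> range u"
    using V W by blast
  fix U assume U: "openin (affine_toric_variety N (cone_hull W)) U"
  then have sub: "U \<subseteq> affine_toric_points N (cone_hull W)"
    using openin_subset topspace_affine_toric_variety by metis
  have "homeomorphic_map (affine_toric_variety N (cone_hull W)) (top_of_set (chart_domain W)) chart_coord"
    using chart_homeomorphic_maps[OF Wu] homeomorphic_maps_map homeomorphic_maps_sym by blast
  then have "openin (top_of_set (chart_domain W)) (chart_coord ` U)"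
    using U homeomorphic_map_openness_eq by blast
  moreover have "openin (top_of_set (chart_domain V)) (chart_domain W)"
  proof -
    have "open (chart_domain W)"
    proof -
      have "chart_domain W = {z. \<forall>i. z $ i \<in> (if u i \<in> W then UNIV else - {0})}"
        by (auto simp: chart_domain_def)
      also have "open \<dots>"
        by (intro open_vector_box) auto
      finally show ?thesis .
    qed
    moreover have "chart_domain W \<subseteq> chart_domain V"
      using W by (auto simp: chart_domain_def)
    ultimately show ?thesis
      by (simp add: open_subset)
  qed
  ultimately have "openin (top_of_set (chart_domain V)) (chart_coord ` U)"
    by (rule openin_trans)
  moreover have "homeomorphic_map (top_of_set (chart_domain V)) (affine_toric_variety N (cone_hull V)) (chart_point V)"
    using chart_homeomorphic_maps[OF V] homeomorphic_maps_map by blast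
  ultimately have "openin (affine_toric_variety N (cone_hull V)) (chart_point V ` chart_coord ` U)"
    using homeomorphic_map_openness_eq by blast
  moreover have "chart_point V (chart_coord y) = restrict y (cone_semigroup N (cone_hull V))" if "y \<in> U" for y
    using restrict_chart_point[OF W, of "chart_coord y"] chart_point_coord[OF Wu, of y] sub that by auto
  then have "chart_point V ` chart_coord ` U = (\<lambda>y. restrict y (cone_semigroup N (cone_hull V))) ` U"
    by (auto simp: image_image)
  ultimately show "openin (affine_toric_variety N (cone_hull V)) ((\<lambda>y. restrict y (cone_semigroup N (cone_hull V))) ` U)"
    by simp
qed

text \<open>Equal restrictions mean equal coordinates in the chart of \<open>V\<close>. These are
  nonzero at generators outside \<open>W1\<close> and at those outside \<open>W2\<close>, hence at
  all outside \<open>W1 \<inter> W2\<close>, so they define a point of the smallest chart.\<close>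

lemma affine_toric_points_amalgamate:
  assumes V: "V \<subseteq> range u" and W: "W1 \<subseteq> V" "W2 \<subseteq> V"
    and y: "y1 \<in> affine_toric_points N (cone_hull W1)" "y2 \<in> affine_toric_points N (cone_hull W2)"
    and eq: "restrict y1 (cone_semigroup N (cone_hull V)) = restrict y2 (cone_semigroup N (cone_hull V))"
  shows "\<exists>z\<in>affine_toric_points N (cone_hull (W1 \<inter> W2)).
    restrict z (cone_semigroup N (cone_hull W1)) = y1 \<and> restrict z (cone_semigroup N (cone_hull W2)) = y2"
proof
  have Wu: "W1 \<subseteq> range u" "W2 \<subseteq> range u" "W1 \<inter> W2 \<subseteq> range u"
    using V W by blast+
  define c where "c = chart_coord y1"
  have c2: "c = chart_coord y2"
    using chart_coord_restrict[OF V, of y1] chart_coord_restrict[OF V, of y2] eq by (simp add: c_def)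
  have "c \<in> chart_domain W1" "c \<in> chart_domain W2"
    using chart_coord_in[OF Wu(1) y(1)] chart_coord_in[OF Wu(2) y(2)] c2 by (auto simp: c_def)
  then have "c \<in> chart_domain (W1 \<inter> W2)"
    by (auto simp: chart_domain_def)
  then show "chart_point (W1 \<inter> W2) c \<in> affine_toric_points N (cone_hull (W1 \<inter> W2))"
    by (rule chart_point_in[OF Wu(3)])
  show "restrict (chart_point (W1 \<inter> W2) c) (cone_semigroup N (cone_hull W1)) = y1 \<and>
      restrict (chart_point (W1 \<inter> W2) c) (cone_semigroup N (cone_hull W2)) = y2"
    using chart_point_coord[OF Wu(1) y(1)] chart_point_coord[OF Wu(2) y(2)] c2
    by (auto simp: restrict_chart_point c_def)
qed

end

text \<open>The fan is stored through the generator sets of its cones. Being full-dimensional is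
  then a matter of cardinality, and \<open>cone_Int\<close> is the condition that cones meet along
  common faces.\<close>

locale smooth_fan =
  fixes N :: "(real ^ 'n::finite) set" and \<V> :: "(real ^ 'n) set set"
  assumes finite_fan: "finite \<V>"
    and smooth: "V \<in> \<V> \<Longrightarrow> \<exists>u m. lattice_chart u m N \<and> V \<subseteq> range u"
    and Int_fan: "V \<in> \<V> \<Longrightarrow> W \<in> \<V> \<Longrightarrow> V \<inter> W \<in> \<V>"
    and cone_Int: "V \<in> \<V> \<Longrightarrow> W \<in> \<V> \<Longrightarrow> cone_hull V \<inter> cone_hull W = cone_hull (V \<inter> W)"
begin

abbreviation "P V \<equiv> affine_toric_points N (cone_hull V)"
abbreviation "S V \<equiv> cone_semigroup N (cone_hull V)"
abbreviation "T V \<equiv> affine_toric_variety N (cone_hull V)"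
abbreviation "gluing \<equiv> toric_gluing N ((hull) convex_cone ` \<V>)"
abbreviation "Y \<equiv> toric_variety N ((hull) convex_cone ` \<V>)"

lemma chart:
  assumes "V \<in> \<V>"
  obtains u m where "lattice_chart u m N" "V \<subseteq> range u"
  using smooth[OF assms] by blast

lemma mem_gluing_iff:
  assumes "V \<in> \<V>" "W \<in> \<V>"
  shows "((cone_hull V, x), (cone_hull W, x')) \<in> gluing \<longleftrightarrow>
    (\<exists>y\<in>P (V \<inter> W). x = restrict y (S V) \<and> x' = restrict y (S W))"
  using assms by (auto simp: toric_gluing_def cone_Int)

lemma hull_Int_subset: "cone_hull (V \<inter> W) \<subseteq> cone_hull V" "cone_hull (V \<inter> W) \<subseteq> cone_hull W"
  by (simp_all add: hull_mono)

lemma gluing_trans: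
  assumes V: "V \<in> \<V>" "V' \<in> \<V>" "V'' \<in> \<V>"
    and "((cone_hull V, x), (cone_hull V', x')) \<in> gluing"
    and "((cone_hull V', x'), (cone_hull V'', x'')) \<in> gluing"
  shows "((cone_hull V, x), (cone_hull V'', x'')) \<in> gluing"
proof -
  obtain y1 where y1: "y1 \<in> P (V \<inter> V')" "x = restrict y1 (S V)" "x' = restrict y1 (S V')"
    using assms by (auto simp: mem_gluing_iff)
  obtain y2 where y2: "y2 \<in> P (V' \<inter> V'')" "x' = restrict y2 (S V')" "x'' = restrict y2 (S V'')"
    using assms by (auto simp: mem_gluing_iff)
  obtain u m where "lattice_chart u m N" and sub: "V' \<subseteq> range u"
    using chart[OF V(2)] .
  then interpret lattice_chart u m N by simp
  \<comment> \<open>The two gluing witnesses have the same image in the middle chart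
    \<open>V'\<close>, so they come from one point over the triple intersection; its restriction to
    the overlap of \<open>V\<close> and \<open>V''\<close> is the witness wanted.\<close>
  obtain z where z: "z \<in> P ((V \<inter> V') \<inter> (V' \<inter> V''))"
    "restrict z (S (V \<inter> V')) = y1" "restrict z (S (V' \<inter> V'')) = y2"
    using affine_toric_points_amalgamate[OF sub _ _ y1(1) y2(1)] y1(3) y2(2) by blast
  have "x = restrict z (S V)" "x'' = restrict z (S V'')"
    unfolding y1(2) y2(3) z(2,3)[symmetric]
    by (rule restrict_cone_semigroup, simp add: hull_mono)+
  moreover have "V \<inter> V' \<inter> (V' \<inter> V'') \<subseteq> V \<inter> V''"
    by blast
  then have "cone_hull (V \<inter> V' \<inter> (V' \<inter> V'')) \<subseteq> cone_hull (V \<inter> V'')"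
    by (rule hull_mono)
  then have "restrict z (S (V \<inter> V'')) \<in> P (V \<inter> V'')"
    using z(1) affine_toric_points_restrict by blast
  moreover have "restrict (restrict z (S (V \<inter> V''))) (S V) = restrict z (S V)"
    "restrict (restrict z (S (V \<inter> V''))) (S V'') = restrict z (S V'')"
    by (rule restrict_cone_semigroup, simp add: hull_mono)+
  ultimately show ?thesis
    unfolding mem_gluing_iff[OF V(1,3)] by metis
qed

lemma topspace_charts:
  "topspace (sum_topology (affine_toric_variety N) ((hull) convex_cone ` \<V>)) =
     {(cone_hull V, x) | V x. V \<in> \<V> \<and> x \<in> P V}"
  by (auto simp: topspace_affine_toric_variety)

lemma equiv_gluing:
  "equiv (topspace (sum_topology (affine_toric_variety N) ((hull) convex_cone ` \<V>))) gluing"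
  (is "equiv ?X _")
proof (rule equivI)
  have mem: "\<exists>V W. V \<in> \<V> \<and> W \<in> \<V> \<and> p = (cone_hull V, snd p) \<and> q = (cone_hull W, snd q)"
    if "(p, q) \<in> gluing" for p q
    using that by (auto simp: toric_gluing_def) blast
  show "gluing \<subseteq> ?X \<times> ?X"
  proof
    fix r assume r: "r \<in> gluing"
    then obtain V W x x' where VW: "V \<in> \<V>" "W \<in> \<V>" and r_eq: "r = ((cone_hull V, x), (cone_hull W, x'))"
      using mem[of "fst r" "snd r"] by (metis prod.collapse)
    then obtain y where "y \<in> P (V \<inter> W)" "x = restrict y (S V)" "x' = restrict y (S W)"
      using r by (auto simp: mem_gluing_iff)
    then have "x \<in> P V" "x' \<in> P W"
      using affine_toric_points_restrict hull_Int_subset by blast+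
    then show "r \<in> ?X \<times> ?X"
      unfolding topspace_charts r_eq using VW by blast
  qed
  show "refl_on ?X gluing"
  proof (rule refl_onI)
    fix p assume "p \<in> ?X"
    then obtain V x where V: "V \<in> \<V>" "x \<in> P V" "p = (cone_hull V, x)"
      unfolding topspace_charts by blast
    then show "(p, p) \<in> gluing"
      unfolding V(3) mem_gluing_iff[OF V(1,1)] Int_absorb
      using affine_toric_points_restrict_same[OF V(2)] by (metis V(2))
  qed
  show "sym gluing"
    by (rule symI) (auto simp: toric_gluing_def Int_commute)
  show "trans gluing"
  proof (rule transI)
    fix p q r assume pq: "(p, q) \<in> gluing" and qr: "(q, r) \<in> gluing"
    obtain V V' where V: "V \<in> \<V>" "V' \<in> \<V>" "p = (cone_hull V, snd p)" "q = (cone_hull V', snd q)"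
      using mem[OF pq] by blast
    obtain V'' where V'': "V'' \<in> \<V>" "r = (cone_hull V'', snd r)"
      using mem[OF qr] by blast
    show "(p, r) \<in> gluing"
      using gluing_trans[OF V(1,2) V''(1), of "snd p" "snd q" "snd r"] pq qr V V'' by simp
  qed
qed

definition inclusion :: "(real ^ 'n) set \<Rightarrow> (real ^ 'n \<Rightarrow> complex) \<Rightarrow> ((real ^ 'n) set \<times> (real ^ 'n \<Rightarrow> complex)) set" where
  "inclusion V x = gluing `` {(cone_hull V, x)}"

lemma inclusion_eq_iff:
  assumes "V \<in> \<V>" "W \<in> \<V>" "x \<in> P V" "x' \<in> P W"
  shows "inclusion V x = inclusion W x' \<longleftrightarrow> (\<exists>y\<in>P (V \<inter> W). x = restrict y (S V) \<and> x' = restrict y (S W))"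
proof -
  have "(cone_hull V, x) \<in> topspace (sum_topology (affine_toric_variety N) ((hull) convex_cone ` \<V>))"
    "(cone_hull W, x') \<in> topspace (sum_topology (affine_toric_variety N) ((hull) convex_cone ` \<V>))"
    unfolding topspace_charts using assms by blast+
  then show ?thesis
    unfolding inclusion_def using eq_equiv_class_iff[OF equiv_gluing] mem_gluing_iff[OF assms(1,2)] by blast
qed

lemma topspace_Y: "topspace Y = (\<Union>V\<in>\<V>. inclusion V ` P V)"
proof -
  let ?X = "sum_topology (affine_toric_variety N) ((hull) convex_cone ` \<V>)"
  have "{x \<in> topspace ?X. gluing `` {x} \<in> topspace ?X // gluing} = topspace ?X"
    by (auto intro: quotientI)
  then have "openin Y (topspace ?X // gluing)"
    unfolding toric_variety_def openin_quotient_topology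
    by (simp only: openin_topspace order_refl simp_thms)
  moreover have "U \<subseteq> topspace ?X // gluing" if "openin Y U" for U
    using that unfolding toric_variety_def openin_quotient_topology by blast
  ultimately have "topspace Y = topspace ?X // gluing"
    by (metis openin_subset openin_topspace subset_antisym)
  also have "\<dots> = (\<Union>V\<in>\<V>. inclusion V ` P V)"
    unfolding topspace_charts quotient_def inclusion_def by blast
  finally show ?thesis .
qed

lemma openin_Y_iff:
  "openin Y U \<longleftrightarrow> U \<subseteq> topspace Y \<and> (\<forall>V\<in>\<V>. openin (T V) {x \<in> P V. inclusion V x \<in> U})"
proof -
  let ?X = "sum_topology (affine_toric_variety N) ((hull) convex_cone ` \<V>)"
  have "topspace Y = topspace ?X // gluing"
    unfolding topspace_Y topspace_charts quotient_def inclusion_def by blast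
  moreover have "{x. (cone_hull V, x) \<in> {p \<in> topspace ?X. gluing `` {p} \<in> U}} = {x \<in> P V. inclusion V x \<in> U}"
    if "V \<in> \<V>" for V
    using that by (auto simp: inclusion_def topspace_affine_toric_variety)
  moreover have "{p \<in> topspace ?X. gluing `` {p} \<in> U} \<subseteq> Sigma ((hull) convex_cone ` \<V>) (topspace \<circ> affine_toric_variety N)"
    by auto
  ultimately show ?thesis
    unfolding toric_variety_def openin_quotient_topology openin_sum_topology by simp
qed

lemma inclusion_restrict:
  assumes "V \<in> \<V>" "W \<in> \<V>" "W \<subseteq> V" "y \<in> P W"
  shows "restrict y (S V) \<in> P V" "inclusion V (restrict y (S V)) = inclusion W y"
proof -
  show 1: "restrict y (S V) \<in> P V"
    using affine_toric_points_restrict[OF assms(4)] assms(3) hull_mono by blast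
  have "V \<inter> W = W"
    using assms by blast
  then show "inclusion V (restrict y (S V)) = inclusion W y"
    using inclusion_eq_iff[OF assms(1,2) 1 assms(4)] assms(4) affine_toric_points_restrict_same[OF assms(4)]
    by auto
qed

lemma inclusion_Int:
  assumes "V \<in> \<V>" "W \<in> \<V>"
  shows "inclusion V ` P V \<inter> inclusion W ` P W = inclusion (V \<inter> W) ` P (V \<inter> W)"
proof (intro equalityI subsetI)
  fix p assume "p \<in> inclusion V ` P V \<inter> inclusion W ` P W"
  then obtain x x' where x: "x \<in> P V" "x' \<in> P W" "p = inclusion V x" "inclusion V x = inclusion W x'"
    by auto
  then obtain y where y: "y \<in> P (V \<inter> W)" "x = restrict y (S V)"
    using inclusion_eq_iff[OF assms] by blast
  then have "p = inclusion (V \<inter> W) y"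
    using inclusion_restrict[OF assms(1) Int_fan[OF assms] _ y(1)] x by simp
  with y show "p \<in> inclusion (V \<inter> W) ` P (V \<inter> W)"
    by blast
next
  fix p assume "p \<in> inclusion (V \<inter> W) ` P (V \<inter> W)"
  then obtain y where y: "y \<in> P (V \<inter> W)" "p = inclusion (V \<inter> W) y"
    by blast
  have "p = inclusion V (restrict y (S V))" "restrict y (S V) \<in> P V"
    "p = inclusion W (restrict y (S W))" "restrict y (S W) \<in> P W"
    using inclusion_restrict[OF assms(1) Int_fan[OF assms] _ y(1)]
      inclusion_restrict[OF assms(2) Int_fan[OF assms] _ y(1)] y(2) by simp_all
  then show "p \<in> inclusion V ` P V \<inter> inclusion W ` P W"
    by blast
qed

lemma continuous_map_inclusion:
  assumes "V \<in> \<V>"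
  shows "continuous_map (T V) Y (inclusion V)"
  unfolding continuous_map_def topspace_affine_toric_variety
  using assms openin_Y_iff by (auto simp: topspace_Y)

text \<open>The trace of the image of \<open>U\<close> in a chart \<open>W\<close> arises by pulling
  \<open>U\<close> back to the overlap chart and pushing the result forward to \<open>W\<close>; the
  first restriction map is continuous and the second is open.\<close>

lemma open_map_inclusion:
  assumes V: "V \<in> \<V>"
  shows "open_map (T V) Y (inclusion V)"
  unfolding open_map_def openin_Y_iff
proof (intro allI impI conjI ballI)
  fix U assume U: "openin (T V) U"
  then have sub: "U \<subseteq> P V"
    using openin_subset topspace_affine_toric_variety by metis
  then show "inclusion V ` U \<subseteq> topspace Y"
    unfolding topspace_Y using V by blast
  fix W assume W: "W \<in> \<V>"
  define Q where "Q = {y \<in> P (V \<inter> W). restrict y (S V) \<in> U}"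
  have "openin (T (V \<inter> W)) Q"
    using openin_continuous_map_preimage[OF continuous_map_restrict_affine_toric[OF hull_Int_subset(1)] U]
    by (simp add: Q_def topspace_affine_toric_variety)
  moreover obtain u m where "lattice_chart u m N" and Wu: "W \<subseteq> range u"
    using chart[OF W] .
  then interpret lattice_chart u m N by simp
  have "open_map (T (V \<inter> W)) (T W) (\<lambda>y. restrict y (S W))"
    by (rule open_map_restrict_affine_toric[OF Wu]) blast
  ultimately have "openin (T W) ((\<lambda>y. restrict y (S W)) ` Q)"
    by (simp add: open_map_def)
  moreover have "{x' \<in> P W. inclusion W x' \<in> inclusion V ` U} = (\<lambda>y. restrict y (S W)) ` Q"
  proof (intro equalityI subsetI)
    fix x' assume "x' \<in> {x' \<in> P W. inclusion W x' \<in> inclusion V ` U}"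
    then obtain x where "x' \<in> P W" "x \<in> U" "inclusion V x = inclusion W x'"
      by auto
    then obtain y where "y \<in> P (V \<inter> W)" "x = restrict y (S V)" "x' = restrict y (S W)"
      using inclusion_eq_iff[OF V W] sub by blast
    then show "x' \<in> (\<lambda>y. restrict y (S W)) ` Q"
      using \<open>x \<in> U\<close> by (auto simp: Q_def)
  next
    fix x' assume "x' \<in> (\<lambda>y. restrict y (S W)) ` Q"
    then obtain y where y: "y \<in> P (V \<inter> W)" "restrict y (S V) \<in> U" "x' = restrict y (S W)"
      by (auto simp: Q_def)
    have "x' \<in> P W" "inclusion W x' = inclusion V (restrict y (S V))"
      using inclusion_restrict[OF V Int_fan[OF V W] _ y(1)]
        inclusion_restrict[OF W Int_fan[OF V W] _ y(1)] y(3) by simp_all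
    with y(2) show "x' \<in> {x' \<in> P W. inclusion W x' \<in> inclusion V ` U}"
      by blast
  qed
  ultimately show "openin (T W) {x' \<in> P W. inclusion W x' \<in> inclusion V ` U}"
    by simp
qed

lemma chart_homeomorphic_inclusion:
  assumes V: "V \<in> \<V>"
  shows "openin Y (inclusion V ` P V)" "T V homeomorphic_space subtopology Y (inclusion V ` P V)"
proof -
  have "openin (T V) (P V)"
    by (metis openin_topspace topspace_affine_toric_variety)
  then show "openin Y (inclusion V ` P V)"
    using open_map_inclusion[OF V] by (simp add: open_map_def)
  have "inj_on (inclusion V) (P V)"
    by (rule inj_onI) (use inclusion_eq_iff[OF V V] in auto)
  then have "embedding_map (T V) Y (inclusion V)"
    by (intro injective_open_imp_embedding_map continuous_map_inclusion open_map_inclusion V)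
      (simp add: topspace_affine_toric_variety)
  then show "T V homeomorphic_space subtopology Y (inclusion V ` P V)"
    using embedding_map_imp_homeomorphic_space topspace_affine_toric_variety by metis
qed

end

section \<open>The Euler characteristic of a smooth fan\<close>

context smooth_fan
begin

lemma card_le: "V \<in> \<V> \<Longrightarrow> finite V \<and> card V \<le> CARD('n)"
  using smooth[of V] by (metis card_image_le card_mono finite finite_imageI finite_subset le_trans)

lemma euler_pair_chart:
  assumes V: "V \<in> \<V>"
  shows "euler_pair (subtopology Y (inclusion V ` P V)) {} (if card V = CARD('n) then 1 else 0)"
proof -
  obtain u m where "lattice_chart u m N" and Vu: "V \<subseteq> range u"
    using chart[OF V] .
  then interpret lattice_chart u m N by simp
  define A where "A i = (if u i \<in> V then UNIV else - {0 :: complex})" for i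
  have A: "A i = - {0} \<longleftrightarrow> u i \<notin> V" for i
    using UNIV_I[of "0 :: complex"] by (auto simp: A_def)
  have box: "chart_domain V = complex_box A"
    by (auto simp: chart_domain_def complex_box_def A_def)
  have "A i = - {0} \<or> open (A i) \<and> starlike (A i)" for i
    by (auto simp: A_def convex_imp_starlike)
  then have "euler_pair (top_of_set (chart_domain V)) {} (if \<exists>i. A i = - {0} then 0 else 1)"
    unfolding box by (rule euler_pair_complex_box)
  moreover have "(\<exists>i. A i = - {0}) \<longleftrightarrow> card V \<noteq> CARD('n)"
  proof -
    have "card (range u) = CARD('n)"
      using inj_u by (simp add: card_image)
    then have "card V = CARD('n) \<longleftrightarrow> V = range u"
      using Vu by (metis card_subset_eq finite finite_imageI)
    then show ?thesis
      unfolding A using Vu by blast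
  qed
  ultimately have "euler_pair (top_of_set (chart_domain V)) {} (if card V = CARD('n) then 1 else 0)"
    by (cases "card V = CARD('n)") (simp_all add: add.commute)
  moreover have "top_of_set (chart_domain V) homeomorphic_space T V"
    using chart_homeomorphic_maps[OF Vu] homeomorphic_maps_imp_homeomorphic_space by blast
  ultimately have "euler_pair (T V) {} (if card V = CARD('n) then 1 else 0)"
    by (rule euler_pair_homeomorphic[rotated])
  then show ?thesis
    by (rule euler_pair_homeomorphic[OF chart_homeomorphic_inclusion(2)[OF V]])
qed

text \<open>Removing one chart \<open>V\<close> from the family leaves two smaller families: the
  remaining charts, and their overlaps with \<open>V\<close>, which belong to the fan again. The
  induction is on cardinality because the second family need not be a subset of the first.\<close>

lemma euler_pair_union:
  assumes "finite \<S>" "\<S> \<subseteq> \<V>"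
  shows "euler_pair (subtopology Y (\<Union>V\<in>\<S>. inclusion V ` P V)) {} (int (card {V\<in>\<S>. card V = CARD('n)}))"
  using assms
proof (induction "card \<S>" arbitrary: \<S> rule: less_induct)
  case less
  show ?case
  proof (cases "\<S> = {}")
    case True
    then show ?thesis
      by (simp add: euler_pair_empty)
  next
    case False
    then obtain V \<S>' where S: "\<S> = insert V \<S>'" "V \<notin> \<S>'"
      by (meson Set.set_insert all_not_in_conv)
    have fin: "finite \<S>'" and V: "V \<in> \<V>" and S': "\<S>' \<subseteq> \<V>"
      using less.prems S by auto
    have less_card: "card \<S>' < card \<S>"
      using S fin by simp
    define U where "U V = inclusion V ` P V" for V
    have 1: "euler_pair (subtopology Y (\<Union>W\<in>\<S>'. U W)) {} (int (card {W\<in>\<S>'. card W = CARD('n)}))"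
      unfolding U_def by (rule less.hyps[OF less_card fin S'])
    have 2: "euler_pair (subtopology Y (U V)) {} (if card V = CARD('n) then 1 else 0)"
      unfolding U_def by (rule euler_pair_chart[OF V])
    define \<S>'' where "\<S>'' = (\<lambda>W. V \<inter> W) ` \<S>'"
    \<comment> \<open>Two distinct sets with at most n elements meet in fewer than n, so no overlap
      is full-dimensional and the overlaps contribute 0.\<close>
    have small: "card (V \<inter> W) \<noteq> CARD('n)" if "W \<in> \<S>'" for W
    proof
      assume eq: "card (V \<inter> W) = CARD('n)"
      have "V \<inter> W = V" "V \<inter> W = W"
        using card_le[OF V] card_le[of W] that S' eq
        by (metis Int_lower1 card_mono card_subset_eq le_antisym)
          (metis Int_lower2 card_le card_mono card_subset_eq eq le_antisym S' subsetD that)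
      with that S(2) show False
        by simp
    qed
    have "card \<S>'' < card \<S>" "finite \<S>''" "\<S>'' \<subseteq> \<V>"
      using card_image_le[OF fin, of "\<lambda>W. V \<inter> W"] less_card fin Int_fan[OF V] S'
      by (auto simp: \<S>''_def)
    from less.hyps[OF this]
    have "euler_pair (subtopology Y (\<Union>W\<in>\<S>''. U W)) {} (int (card {W\<in>\<S>''. card W = CARD('n)}))"
      unfolding U_def .
    moreover have "{W\<in>\<S>''. card W = CARD('n)} = {}"
      using small by (auto simp: \<S>''_def)
    ultimately have "euler_pair (subtopology Y (\<Union>W\<in>\<S>''. U W)) {} 0"
      by simp
    moreover have "U (V \<inter> W) = U V \<inter> U W" if "W \<in> \<S>'" for W
      unfolding U_def using inclusion_Int[OF V, of W] S' that by blast
    then have "(\<Union>W\<in>\<S>''. U W) = (\<Union>W\<in>\<S>'. U W) \<inter> U V"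
      unfolding \<S>''_def by auto
    ultimately have 3: "euler_pair (subtopology Y ((\<Union>W\<in>\<S>'. U W) \<inter> U V)) {} 0"
      by simp
    have "openin Y (U W)" if "W \<in> \<V>" for W
      unfolding U_def using chart_homeomorphic_inclusion(1)[OF that] .
    then have "openin Y (\<Union>W\<in>\<S>'. U W)" "openin Y (U V)"
      using S' V by auto
    from euler_pair_Un[OF this 1 2 3]
    have "euler_pair (subtopology Y ((\<Union>W\<in>\<S>'. U W) \<union> U V)) {}
      (int (card {W\<in>\<S>'. card W = CARD('n)}) + (if card V = CARD('n) then 1 else 0))"
      by simp
    moreover have "{W\<in>\<S>. card W = CARD('n)} = (if card V = CARD('n) then insert V {W\<in>\<S>'. card W = CARD('n)} else {W\<in>\<S>'. card W = CARD('n)})"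
      unfolding S(1) by auto
    then have "card {W\<in>\<S>. card W = CARD('n)} = card {W\<in>\<S>'. card W = CARD('n)} + (if card V = CARD('n) then 1 else 0)"
      using fin S(2) by simp
    moreover have "(\<Union>W\<in>\<S>'. U W) \<union> U V = (\<Union>W\<in>\<S>. U W)"
      unfolding S(1) by auto
    ultimately show ?thesis
      unfolding U_def by (cases "card V = CARD('n)") (simp_all add: add.commute)
  qed
qed

theorem euler_pair_toric_variety: "euler_pair Y {} (int (card {V\<in>\<V>. card V = CARD('n)}))"
  using euler_pair_union[OF finite_fan order_refl] topspace_Y by (metis subtopology_topspace)

end

section \<open>Compatible simplicial cones\<close>

context dual_bases
begin

text \<open>A nonempty face is the cone over the generators in it: if a point \<open>x\<close> of
  the face has positive coordinate at \<open>u i\<close>, splitting off that coordinate exhibits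
  \<open>x\<close> as a midpoint of two points of the cone, and so a positive multiple of
  \<open>u i\<close> lies in the face.\<close>

lemma face_of_cone_iff:
  "\<tau> \<noteq> {} \<and> \<tau> face_of (convex_cone hull range u) \<longleftrightarrow> (\<exists>V\<subseteq>range u. \<tau> = convex_cone hull V)"
proof (intro iffI; (elim conjE exE)?)
  fix V assume V: "V \<subseteq> range u" "\<tau> = convex_cone hull V"
  have "convex_cone hull V face_of (convex_cone hull range u)"
    unfolding face_of_def
  proof (intro conjI ballI impI)
    show "convex_cone hull V \<subseteq> convex_cone hull range u"
      by (rule hull_mono[OF V(1)])
    show "convex (convex_cone hull V)"
      by (rule convex_convex_cone_hull)
    fix a b x assume a: "a \<in> convex_cone hull range u" and b: "b \<in> convex_cone hull range u"
      and x: "x \<in> convex_cone hull V" "x \<in> open_segment a b"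
    obtain t where t: "0 < t" "t < 1" "x = (1 - t) *\<^sub>R a + t *\<^sub>R b"
      using x(2) by (auto simp: in_segment)
    have pos: "0 \<le> m i \<bullet> a" "0 \<le> m i \<bullet> b" for i
      using a b mem_cone_iff[of "range u"] by auto
    have "m i \<bullet> a = 0 \<and> m i \<bullet> b = 0" if "u i \<notin> V" for i
    proof -
      have "(1 - t) * (m i \<bullet> a) + t * (m i \<bullet> b) = 0"
        using x(1) that mem_cone_iff[OF V(1)] t(3) by (auto simp: inner_add_right)
      moreover have "(1 - t) * (m i \<bullet> a) \<ge> 0" "t * (m i \<bullet> b) \<ge> 0"
        using pos t by auto
      ultimately have "(1 - t) * (m i \<bullet> a) = 0" "t * (m i \<bullet> b) = 0"
        by linarith+
      then show ?thesis
        using t by auto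
    qed
    then show "a \<in> convex_cone hull V" "b \<in> convex_cone hull V"
      using pos mem_cone_iff[OF V(1)] by auto
  qed
  with V(2) show "\<tau> \<noteq> {} \<and> \<tau> face_of (convex_cone hull range u)"
    using convex_cone_hull_nonempty by blast
next
  assume ne: "\<tau> \<noteq> {}" and face: "\<tau> face_of (convex_cone hull range u)"
  have con: "conic \<tau>"
    using face_of_conic[OF conic_convex_cone_hull face] .
  then have cc: "convex_cone \<tau>"
    using ne face by (auto simp: convex_cone_def face_of_def)
  define V where "V = range u \<inter> \<tau>"
  have V: "V \<subseteq> range u"
    by (auto simp: V_def)
  have "convex_cone hull V \<subseteq> \<tau>"
    using cc by (intro hull_minimal) (auto simp: V_def)
  moreover have "\<tau> \<subseteq> convex_cone hull V"
  proof
    fix x assume x: "x \<in> \<tau>"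
    then have xc: "x \<in> convex_cone hull range u"
      using face by (auto simp: face_of_def)
    then have pos: "0 \<le> m i \<bullet> x" for i
      using mem_cone_iff[of "range u" x] by auto
    have "u i \<in> \<tau>" if i: "m i \<bullet> x \<noteq> 0" for i
    proof -
      define c where "c = m i \<bullet> x"
      have c: "c > 0"
        using pos[of i] i by (simp add: c_def)
      define y where "y = x - c *\<^sub>R u i"
      have "m j \<bullet> y \<ge> 0" for j
        using pos[of j] by (auto simp: y_def inner_diff_right dual c_def)
      then have y2: "2 *\<^sub>R y \<in> convex_cone hull range u"
        using mem_cone_iff[of "range u" y] convex_cone_hull_mul[of y "range u" 2] by auto
      have u2: "(2 * c) *\<^sub>R u i \<in> convex_cone hull range u"
        using c convex_cone_hull_mul[of "u i" "range u" "2 * c"] by (simp add: hull_inc)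
      have "(2 * c) *\<^sub>R u i \<in> \<tau>"
      \<comment> \<open>An open segment with equal ends is empty, so this case is separate; there
        \<open>x\<close> itself is the multiple of \<open>u i\<close>.\<close>
      proof (cases "(2 * c) *\<^sub>R u i = 2 *\<^sub>R y")
        case True
        then have "c *\<^sub>R u i = y"
          by (metis scaleR_cancel_left scaleR_scaleR zero_neq_numeral)
        then have "(2 * c) *\<^sub>R u i = x"
          by (metis (no_types, lifting) True add.commute diff_add_cancel scaleR_2 y_def)
        with x show ?thesis
          by simp
      next
        case False
        have "x = (1 - 1/2) *\<^sub>R ((2 * c) *\<^sub>R u i) + (1/2) *\<^sub>R (2 *\<^sub>R y)"
          by (simp add: y_def)
        then have "\<exists>t>0. t < 1 \<and> x = (1 - t) *\<^sub>R ((2 * c) *\<^sub>R u i) + t *\<^sub>R (2 *\<^sub>R y)"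
          by (intro exI[of _ "1/2"] conjI) simp_all
        with False have "x \<in> open_segment ((2 * c) *\<^sub>R u i) (2 *\<^sub>R y)"
          unfolding in_segment by blast
        then show ?thesis
          using face x u2 y2 unfolding face_of_def by blast
      qed
      from conic_mul[OF con this, of "1 / (2 * c)"] c show ?thesis
        by simp
    qed
    then show "x \<in> convex_cone hull V"
      using pos mem_cone_iff[OF V, of x] by (auto simp: V_def)
  qed
  ultimately show "\<exists>V\<subseteq>range u. \<tau> = convex_cone hull V"
    using V by blast
qed

text \<open>Relates the coefficients \<open>b\<close> over the new generators to the old
  coordinates. At \<open>k = i\<close> there is no term besides the one from \<open>w\<close>, so
  the coefficient of \<open>w\<close> can be read off from old coordinates.\<close>

lemma cone_sum_upd:
  assumes "x \<in> convex_cone hull range (u(i := w))"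
  obtains b where "\<And>j. 0 \<le> b j" "x = (\<Sum>j\<in>UNIV. b j *\<^sub>R (u(i := w)) j)"
    "\<And>k. m k \<bullet> x = b i * (m k \<bullet> w) + (if k = i then 0 else b k)"
proof -
  obtain b where b: "\<And>j. 0 \<le> b j" "x = (\<Sum>j\<in>UNIV. b j *\<^sub>R (u(i := w)) j)"
    using assms convex_cone_hull_finite_image[of "u(i := w)" UNIV] by auto
  have "m k \<bullet> x = b i * (m k \<bullet> w) + (if k = i then 0 else b k)" for k
  proof -
    have "m k \<bullet> x = (\<Sum>j\<in>UNIV. b j * (m k \<bullet> (u(i := w)) j))"
      unfolding b(2) by (simp add: inner_sum_right)
    also have "\<dots> = b i * (m k \<bullet> w) + (\<Sum>j\<in>UNIV - {i}. b j * (m k \<bullet> (u(i := w)) j))"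
      by (subst sum.remove[of _ i]) auto
    also have "(\<Sum>j\<in>UNIV - {i}. b j * (m k \<bullet> (u(i := w)) j)) = (\<Sum>j\<in>UNIV - {i}. if j = k then b j else 0)"
      by (intro sum.cong) (auto simp: dual)
    finally show ?thesis
      by simp
  qed
  with b that show thesis
    by blast
qed

lemma cone_upd_subset:
  assumes "\<And>j. 0 \<le> m j \<bullet> w"
  shows "convex_cone hull range (u(i := w)) \<subseteq> convex_cone hull range u"
proof (rule hull_minimal)
  show "convex_cone (convex_cone hull range u)"
    by (rule convex_cone_convex_cone_hull)
  show "range (u(i := w)) \<subseteq> convex_cone hull range u"
  proof
    fix x assume "x \<in> range (u(i := w))"
    then have "x = w \<or> x \<in> range u"
      by (auto split: if_splits)
    then show "x \<in> convex_cone hull range u"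
      using assms mem_cone_iff[of "range u" w] by (auto simp: hull_inc)
  qed
qed

end

section \<open>Compatibility of two cones under subdivision\<close>

definition compatible :: "(real ^ 'n) set \<Rightarrow> (real ^ 'n) set \<Rightarrow> bool" where
  "compatible V W \<longleftrightarrow> (convex_cone hull V) \<inter> (convex_cone hull W) = convex_cone hull (V \<inter> W)"

lemma compatible_sym: "compatible V W \<Longrightarrow> compatible W V"
  by (simp add: compatible_def Int_commute)

lemma compatibleI:
  "(\<And>x. x \<in> convex_cone hull V \<Longrightarrow> x \<in> convex_cone hull W \<Longrightarrow> x \<in> convex_cone hull (V \<inter> W)) \<Longrightarrow> compatible V W"
  unfolding compatible_def using hull_mono[of "V \<inter> W" V convex_cone] hull_mono[of "V \<inter> W" W convex_cone] by blast

text \<open>Being off the common face, \<open>w\<close> has a positive coordinate at some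
  \<open>u k\<close> outside \<open>W\<close>. A point of both cones has coordinate 0 there, so it
  does not involve \<open>w\<close>, and only common generators remain.\<close>

lemma (in dual_bases) compatible_upd:
  assumes comp: "compatible (range u) W" and pos: "\<And>j. 0 \<le> m j \<bullet> w"
    and w: "w \<notin> convex_cone hull (range u \<inter> W)"
  shows "compatible (range (u(i := w))) W"
proof (rule compatibleI)
  fix x assume x: "x \<in> convex_cone hull range (u(i := w))" "x \<in> convex_cone hull W"
  obtain b where b: "\<And>j. 0 \<le> b j" "x = (\<Sum>j\<in>UNIV. b j *\<^sub>R (u(i := w)) j)"
    "\<And>k. m k \<bullet> x = b i * (m k \<bullet> w) + (if k = i then 0 else b k)"
    using cone_sum_upd[OF x(1)] by blast
  have xW: "x \<in> convex_cone hull (range u \<inter> W)"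
    using x cone_upd_subset[OF pos] comp unfolding compatible_def by blast
  have zero: "m k \<bullet> x = 0" if "u k \<notin> W" for k
    using xW that mem_cone_iff[of "range u \<inter> W" x] by auto
  obtain k where k: "u k \<notin> W" "m k \<bullet> w > 0"
    using w pos mem_cone_iff[of "range u \<inter> W" w] by (auto simp: less_le)
  have "b i * (m k \<bullet> w) = 0"
    using zero[OF k(1)] b(3)[of k] b(1)[of k] b(1)[of i] k(2)
    by (smt (verit) mult_nonneg_nonneg)
  then have bi: "b i = 0"
    using k by simp
  define J where "J = {j. j \<noteq> i \<and> u j \<in> W}"
  have "b j = 0" if "j \<notin> J" for j
    using that b(3)[of j] zero[of j] bi by (cases "j = i") (auto simp: J_def)
  then have "x \<in> convex_cone hull ((u(i := w)) ` J)"
    unfolding convex_cone_hull_finite_image using b(1,2) by blast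
  moreover have "(u(i := w)) ` J \<subseteq> range (u(i := w)) \<inter> W"
    by (auto simp: J_def)
  ultimately show "x \<in> convex_cone hull (range (u(i := w)) \<inter> W)"
    using hull_mono by blast
qed

locale two_dual_bases = dual_bases u m + D': dual_bases u' m'
  for u m u' m' :: "'n::finite \<Rightarrow> real ^ 'n"
begin

text \<open>On the common face both bases expand \<open>z\<close> in shared generators only, so the
  coefficients agree.\<close>

lemma coord_eq:
  assumes z: "z \<in> convex_cone hull (range u \<inter> range u')" and eq: "u j = u' j'"
  shows "m j \<bullet> z = m' j' \<bullet> z"
proof -
  have "m' j' \<bullet> z = m' j' \<bullet> (\<Sum>l\<in>UNIV. (m l \<bullet> z) *\<^sub>R u l)"
    using expand[of z] by simp
  also have "\<dots> = (\<Sum>l\<in>UNIV. (m l \<bullet> z) * (m' j' \<bullet> u l))"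
    by (simp add: inner_sum_right)
  also have "\<dots> = (\<Sum>l\<in>UNIV. if l = j then m l \<bullet> z else 0)"
  proof (rule sum.cong)
    fix l
    show "(m l \<bullet> z) * (m' j' \<bullet> u l) = (if l = j then m l \<bullet> z else 0)"
    proof (cases "u l \<in> range u'")
      case True
      then obtain l' where l': "u l = u' l'"
        by blast
      then have "j' = l' \<longleftrightarrow> l = j"
        using eq inj_u D'.inj_u by (metis injD)
      then show ?thesis
        using l' D'.dual[of j' l'] by simp
    next
      case False
      then have "l \<noteq> j" "m l \<bullet> z = 0"
        using z eq mem_cone_iff[of "range u \<inter> range u'" z] by auto
      then show ?thesis
        by simp
    qed
  qed simp
  finally show ?thesis
    by simp
qed

lemma swap: "two_dual_bases u' m' u m"
  by unfold_locales

text \<open>Since \<open>w\<close> has a positive coordinate at \<open>u i\<close>, this generator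
  is shared. Comparing the coordinates of \<open>x\<close> along it bounds the coefficient
  \<open>c\<close> of \<open>w\<close> in one subdivided cone by the coefficient \<open>b\<close> in
  the other.\<close>

lemma compatible_upd_coeff_le:
  assumes w: "w \<in> convex_cone hull (range u \<inter> range u')" and i: "m i \<bullet> w > 0"
    and x: "x \<in> convex_cone hull (range u \<inter> range u')"
    and b: "m i \<bullet> x = b * (m i \<bullet> w)" 
    and b': "\<And>k. 0 \<le> b' k" "\<And>k. m' k \<bullet> x = c * (m' k \<bullet> w) + b' k"
  shows "c \<le> b"
proof -
  have "u i \<in> range u \<inter> range u'"
    using w i mem_cone_iff[of "range u \<inter> range u'" w] by force
  then obtain k where k: "u i = u' k"
    by auto
  have "b * (m i \<bullet> w) \<ge> c * (m i \<bullet> w)"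
    using b b'(2)[of k] b'(1)[of k] coord_eq[OF w k] coord_eq[OF x k] by simp
  then show ?thesis
    using i by simp
qed

text \<open>Both cones are subdivided at the same point of their common face. Two uses of
  \<open>compatible_upd_coeff_le\<close> show that \<open>x\<close> has the same coefficient at
  \<open>w\<close> on both sides; the rest of \<open>x\<close> can then involve only generators that
  both sides keep.\<close>

lemma compatible_upd_both:
  assumes comp: "compatible (range u) (range u')"
    and w: "w \<in> convex_cone hull (range u \<inter> range u')" and i: "m i \<bullet> w > 0" and i': "m' i' \<bullet> w > 0"
  shows "compatible (range (u(i := w))) (range (u'(i' := w)))"
proof (rule compatibleI)
  interpret S: two_dual_bases u' m' u m by (rule swap)
  have w': "w \<in> convex_cone hull (range u' \<inter> range u)"
    using w by (simp add: Int_commute)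
  have pos: "0 \<le> m j \<bullet> w" for j
    using w mem_cone_iff[of "range u \<inter> range u'" w] by auto
  have pos': "0 \<le> m' j \<bullet> w" for j
    using w D'.mem_cone_iff[of "range u \<inter> range u'" w] by auto
  fix x assume x: "x \<in> convex_cone hull range (u(i := w))" "x \<in> convex_cone hull range (u'(i' := w))"
  have xW: "x \<in> convex_cone hull (range u \<inter> range u')"
    using x cone_upd_subset[OF pos] D'.cone_upd_subset[OF pos'] comp unfolding compatible_def by blast
  then have xW': "x \<in> convex_cone hull (range u' \<inter> range u)"
    by (simp add: Int_commute)
  obtain b where b: "\<And>j. 0 \<le> b j" "x = (\<Sum>j\<in>UNIV. b j *\<^sub>R (u(i := w)) j)"
    "\<And>k. m k \<bullet> x = b i * (m k \<bullet> w) + (if k = i then 0 else b k)"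
    using cone_sum_upd[OF x(1)] by blast
  obtain b' where b': "\<And>j. 0 \<le> b' j" "x = (\<Sum>j\<in>UNIV. b' j *\<^sub>R (u'(i' := w)) j)"
    "\<And>k. m' k \<bullet> x = b' i' * (m' k \<bullet> w) + (if k = i' then 0 else b' k)"
    using D'.cone_sum_upd[OF x(2)] by blast
  have "b' i' \<le> b i"
    using compatible_upd_coeff_le[OF w i xW, of "b i" "\<lambda>k. if k = i' then 0 else b' k" "b' i'"] b(1,3) b'(1,3) by simp
  moreover have "b i \<le> b' i'"
    using S.compatible_upd_coeff_le[OF w' i' xW', of "b' i'" "\<lambda>k. if k = i then 0 else b k" "b i"] b(1,3) b'(1,3) by simp
  ultimately have eq: "b' i' = b i"
    by simp
  \<comment> \<open>Indices whose new generator is common to both sides: \<open>i\<close> now stands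
    for \<open>w\<close>, and the generator dropped by the other cone is excluded.\<close>
  define J where "J = {j. j = i \<or> u j \<in> range u' \<and> u j \<noteq> u' i'}"
  have "b j = 0" if j: "j \<notin> J" for j
  proof -
    have ji: "j \<noteq> i" and cases: "u j \<notin> range u' \<or> u j = u' i'"
      using j by (auto simp: J_def)
    from cases show ?thesis
    proof
      assume "u j \<notin> range u'"
      then have "m j \<bullet> x = 0" "m j \<bullet> w = 0"
        using xW w mem_cone_iff[of "range u \<inter> range u'"] by auto
      then show ?thesis
        using b(3)[of j] ji by simp
    next
      \<comment> \<open>The other cone has dropped this generator, so the coordinate of
        \<open>x\<close> along it comes from \<open>w\<close> alone. The coefficients of
        \<open>w\<close> being equal, \<open>b j = 0\<close> follows.\<close>
      assume u: "u j = u' i'"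
      show ?thesis
        using b(3)[of j] ji b'(3)[of i'] eq coord_eq[OF xW u] coord_eq[OF w u] by simp
    qed
  qed
  then have "x \<in> convex_cone hull ((u(i := w)) ` J)"
    unfolding convex_cone_hull_finite_image using b(1,2) by blast
  moreover have "(u(i := w)) ` J \<subseteq> range (u(i := w)) \<inter> range (u'(i' := w))"
  proof
    fix y assume "y \<in> (u(i := w)) ` J"
    then obtain j where j: "j \<in> J" "y = (u(i := w)) j"
      by blast
    have "y \<in> range (u'(i' := w))"
    proof (cases "j = i")
      case True
      then have "y = (u'(i' := w)) i'"
        using j by simp
      then show ?thesis
        by blast
    next
      case False
      then obtain j' where "u j = u' j'" "j' \<noteq> i'"
        using j by (auto simp: J_def)
      then have "y = (u'(i' := w)) j'"
        using j False by simp
      then show ?thesis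
        by blast
    qed
    with j show "y \<in> range (u(i := w)) \<inter> range (u'(i' := w))"
      by blast
  qed
  ultimately show "x \<in> convex_cone hull (range (u(i := w)) \<inter> range (u'(i' := w)))"
    using hull_mono by blast
qed

lemma compatible_subset:
  assumes comp: "compatible (range u) (range u')" and V: "V \<subseteq> range u" "W \<subseteq> range u'"
  shows "compatible V W"
proof (rule compatibleI)
  fix x assume x: "x \<in> convex_cone hull V" "x \<in> convex_cone hull W"
  then have xW: "x \<in> convex_cone hull (range u \<inter> range u')"
    using comp hull_mono[OF V(1)] hull_mono[OF V(2)] unfolding compatible_def by blast
  have VW: "V \<inter> W \<subseteq> range u"
    using V by blast
  have "m i \<bullet> x = 0" if i: "u i \<notin> V \<inter> W" for i
  proof (cases "u i \<in> V \<and> u i \<in> range u'")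
    case True
    then obtain i' where i': "u i = u' i'"
      by blast
    then have "u' i' \<notin> W"
      using i True by auto
    then show ?thesis
      using coord_eq[OF xW i'] D'.mem_cone_iff[OF V(2), of x] x by simp
  next
    case False
    then show ?thesis
      using xW x mem_cone_iff[OF V(1), of x] mem_cone_iff[of "range u \<inter> range u'" x] by auto
  qed
  then show "x \<in> convex_cone hull (V \<inter> W)"
    using mem_cone_iff[OF VW, of x] mem_cone_iff[OF V(1), of x] x(1) by auto
qed

end

section \<open>The subdivision tree\<close>

text \<open>\<open>subdivision_point\<close> for a family given as a function, so that replacing a
  generator is a function update.\<close>

definition division_point :: "('n::finite \<Rightarrow> real ^ 'n) \<Rightarrow> 'n fraction \<Rightarrow> real ^ 'n" where
  "division_point v q = (1 / of_int (denom q)) *\<^sub>R (\<Sum>i\<in>UNIV. of_int (numer q $ i) *\<^sub>R v i)"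

definition labelled_lattice :: "('n::finite \<Rightarrow> real ^ 'n) \<Rightarrow> 'n fraction \<Rightarrow> (real ^ 'n) set" where
  "labelled_lattice v q =
     {(\<Sum>i\<in>UNIV. of_int (z i) *\<^sub>R v i) + of_int k *\<^sub>R division_point v q | z k. True}"

text \<open>The invariant of the subdivision tree: \<open>p\<close> is the index of the entry 1 and
  \<open>e\<close> is the initial generator there. For the smooth label nothing is claimed about
  \<open>v p\<close>, because the step that makes a cone smooth may replace that generator.\<close>

definition admissible ::
    "(real ^ 'n) set \<Rightarrow> 'n::finite \<Rightarrow> real ^ 'n \<Rightarrow> ('n \<Rightarrow> real ^ 'n) \<Rightarrow> 'n fraction \<Rightarrow> bool" where
  "admissible N p e v q \<longleftrightarrow> (\<exists>m. dual_bases v m) \<and> N = labelled_lattice v q \<and>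
     (q = Frac 0 1 \<or>
      2 \<le> denom q \<and> numer q $ p = 1 \<and> v p = e \<and> (\<forall>i. 0 \<le> numer q $ i \<and> numer q $ i < denom q))"

lemma (in dual_bases) coord_division_point:
  "m j \<bullet> division_point u q = of_int (numer q $ j) / of_int (denom q)"
  by (simp add: division_point_def coord_sum)

lemma division_point_trivial: "division_point v (Frac 0 1) = 0"
  by (simp add: division_point_def)

lemma division_point_in_lattice: "division_point v q \<in> labelled_lattice v q"
  unfolding labelled_lattice_def by (intro CollectI exI[of _ "\<lambda>_. 0"] exI[of _ 1]) simp

lemma remainder_map_Some_iff:
  "remainder_map i (Some q) = Some q' \<longleftrightarrow> numer q $ i \<noteq> 0 \<and>
     q' = Frac (\<chi> j. if j = i then (- denom q) mod (numer q $ i) else (numer q $ j) mod (numer q $ i)) (numer q $ i)"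
  by (cases q) (auto cong: if_cong)

lemma sum_fun_upd:
  fixes v :: "'n::finite \<Rightarrow> 'a::real_vector"
  shows "(\<Sum>j\<in>UNIV. f j *\<^sub>R (v(i := w)) j) = f i *\<^sub>R w + (\<Sum>j\<in>UNIV - {i}. f j *\<^sub>R v j)"
  by (subst sum.remove[of _ i]) (auto intro!: arg_cong2[of _ _ _ _ "(+)"] sum.cong)

lemma sum_split:
  fixes v :: "'n::finite \<Rightarrow> 'a::real_vector"
  shows "(\<Sum>j\<in>UNIV. f j *\<^sub>R v j) = f i *\<^sub>R v i + (\<Sum>j\<in>UNIV - {i}. f j *\<^sub>R v j)"
  by (subst sum.remove[of _ i]) auto

text \<open>Writing each new numerator as the old value minus \<open>numer q $ i\<close> times the
  quotient \<open>d j\<close> turns the new point into an integer combination of the old generators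
  and \<open>w\<close>, with coefficient -1 at \<open>v i\<close>.\<close>

lemma division_point_step:
  fixes v :: "'n::finite \<Rightarrow> real ^ 'n"
  assumes ci: "numer q $ i > 0" and s: "denom q > 0" and q': "remainder_map i (Some q) = Some q'"
  defines "w \<equiv> division_point v q"
    and "d \<equiv> \<lambda>j. if j = i then (- denom q) div (numer q $ i) else (numer q $ j) div (numer q $ i)"
  shows "division_point (v(i := w)) q' = - v i - of_int (d i) *\<^sub>R w - (\<Sum>j\<in>UNIV - {i}. of_int (d j) *\<^sub>R v j)"
proof -
  define c where "c = numer q $ i"
  have sw: "of_int (denom q) *\<^sub>R w = of_int c *\<^sub>R v i + (\<Sum>j\<in>UNIV - {i}. of_int (numer q $ j) *\<^sub>R v j)"
    unfolding w_def division_point_def c_def using s sum_split[of "\<lambda>j. of_int (numer q $ j)" v i] by simp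
  have m: "numer q' $ j = (if j = i then - denom q else numer q $ j) - c * d j" for j
    using q' unfolding remainder_map_Some_iff by (auto simp: d_def c_def minus_div_mult_eq_mod[symmetric])
  have dq': "denom q' = c"
    using q' unfolding remainder_map_Some_iff by (auto simp: c_def)
  define w' where "w' = division_point (v(i := w)) q'"
  have "of_int c *\<^sub>R w' =
      of_int (numer q' $ i) *\<^sub>R w + (\<Sum>j\<in>UNIV - {i}. of_int (numer q' $ j) *\<^sub>R v j)"
    unfolding w'_def division_point_def dq' sum_fun_upd using ci by (simp add: c_def)
  also have "(\<Sum>j\<in>UNIV - {i}. of_int (numer q' $ j) *\<^sub>R v j) =
      (\<Sum>j\<in>UNIV - {i}. of_int (numer q $ j) *\<^sub>R v j) - of_int c *\<^sub>R (\<Sum>j\<in>UNIV - {i}. of_int (d j) *\<^sub>R v j)"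
    unfolding scaleR_sum_right sum_subtractf[symmetric]
    by (intro sum.cong) (auto simp: m algebra_simps)
  also have "of_int (numer q' $ i) *\<^sub>R w = - (of_int (denom q) *\<^sub>R w) - of_int c *\<^sub>R (of_int (d i) *\<^sub>R w)"
    by (simp add: m algebra_simps)
  finally have "of_int c *\<^sub>R w' =
      of_int c *\<^sub>R (- v i - of_int (d i) *\<^sub>R w - (\<Sum>j\<in>UNIV - {i}. of_int (d j) *\<^sub>R v j))"
    unfolding sw by (simp add: algebra_simps)
  then show ?thesis
    unfolding w'_def[symmetric] using ci by (simp add: c_def)
qed

text \<open>The coefficient -1 is a unit, so \<open>division_point_step\<close> can also be solved
  for \<open>v i\<close>: given \<open>w\<close> and the other generators, \<open>v i\<close> and
  the new division point are interchangeable over the integers.\<close>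

lemma labelled_lattice_step:
  fixes v :: "'n::finite \<Rightarrow> real ^ 'n"
  assumes ci: "numer q $ i > 0" and s: "denom q > 0" and q': "remainder_map i (Some q) = Some q'"
  defines "w \<equiv> division_point v q"
  shows "labelled_lattice (v(i := w)) q' = labelled_lattice v q"
proof -
  define d where "d j = (if j = i then (- denom q) div (numer q $ i) else (numer q $ j) div (numer q $ i))" for j
  define w' where "w' = division_point (v(i := w)) q'"
  have w': "w' = - v i - of_int (d i) *\<^sub>R w - (\<Sum>j\<in>UNIV - {i}. of_int (d j) *\<^sub>R v j)"
    unfolding w'_def w_def d_def by (rule division_point_step[OF ci s q'])
  let ?R = "UNIV - {i}"
  show ?thesis
  proof (intro equalityI subsetI)
    fix x assume "x \<in> labelled_lattice (v(i := w)) q'"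
    then obtain z k where "x = (\<Sum>j\<in>UNIV. of_int (z j) *\<^sub>R (v(i := w)) j) + of_int k *\<^sub>R w'"
      unfolding labelled_lattice_def w'_def by blast
    then have "x = of_int (z i) *\<^sub>R w + (\<Sum>j\<in>?R. of_int (z j) *\<^sub>R v j) + of_int k *\<^sub>R w'"
      unfolding sum_fun_upd .
    also have "\<dots> = of_int (- k) *\<^sub>R v i
        + ((\<Sum>j\<in>?R. of_int (z j) *\<^sub>R v j) - of_int k *\<^sub>R (\<Sum>j\<in>?R. of_int (d j) *\<^sub>R v j))
        + of_int (z i - k * d i) *\<^sub>R w"
      unfolding w' by (simp add: algebra_simps)
    also have "(\<Sum>j\<in>?R. of_int (z j) *\<^sub>R v j) - of_int k *\<^sub>R (\<Sum>j\<in>?R. of_int (d j) *\<^sub>R v j) =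
        (\<Sum>j\<in>?R. of_int (if j = i then - k else z j - k * d j) *\<^sub>R v j)"
      unfolding scaleR_sum_right sum_subtractf[symmetric]
      by (intro sum.cong) (auto simp: algebra_simps)
    finally have "x = (\<Sum>j\<in>UNIV. of_int (if j = i then - k else z j - k * d j) *\<^sub>R v j) + of_int (z i - k * d i) *\<^sub>R w"
      using sum_split[of "\<lambda>j. of_int (if j = i then - k else z j - k * d j)" v i] by simp
    then show "x \<in> labelled_lattice v q"
      unfolding labelled_lattice_def w_def
      by (intro CollectI exI[of _ "\<lambda>j. if j = i then - k else z j - k * d j"] exI[of _ "z i - k * d i"]) simp
  next
    fix x assume "x \<in> labelled_lattice v q"
    then obtain z k where "x = (\<Sum>j\<in>UNIV. of_int (z j) *\<^sub>R v j) + of_int k *\<^sub>R w"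
      unfolding labelled_lattice_def w_def by blast
    then have "x = of_int (z i) *\<^sub>R v i + (\<Sum>j\<in>?R. of_int (z j) *\<^sub>R v j) + of_int k *\<^sub>R w"
      using sum_split[of "\<lambda>j. of_int (z j)" v i] by simp
    also have "\<dots> = of_int (k - z i * d i) *\<^sub>R w
        + ((\<Sum>j\<in>?R. of_int (z j) *\<^sub>R v j) - of_int (z i) *\<^sub>R (\<Sum>j\<in>?R. of_int (d j) *\<^sub>R v j))
        + of_int (- z i) *\<^sub>R w'"
      unfolding w' by (simp add: algebra_simps)
    also have "(\<Sum>j\<in>?R. of_int (z j) *\<^sub>R v j) - of_int (z i) *\<^sub>R (\<Sum>j\<in>?R. of_int (d j) *\<^sub>R v j) =
        (\<Sum>j\<in>?R. of_int (if j = i then k - z i * d i else z j - z i * d j) *\<^sub>R v j)"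
      unfolding scaleR_sum_right sum_subtractf[symmetric]
      by (intro sum.cong) (auto simp: algebra_simps)
    finally have "x = (\<Sum>j\<in>UNIV. of_int (if j = i then k - z i * d i else z j - z i * d j) *\<^sub>R (v(i := w)) j)
        + of_int (- z i) *\<^sub>R w'"
      unfolding sum_fun_upd by simp
    then show "x \<in> labelled_lattice (v(i := w)) q'"
      unfolding labelled_lattice_def w'_def
      by (intro CollectI exI[of _ "\<lambda>j. if j = i then k - z i * d i else z j - z i * d j"] exI[of _ "- z i"]) simp
  qed
qed

text \<open>\<open>m i\<close> is scaled to the value 1 at \<open>w\<close>, and multiples of it are
  subtracted from the other functionals to make them vanish there.\<close>

lemma (in dual_bases) dual_bases_upd:
  assumes "m i \<bullet> w \<noteq> 0"
  shows "dual_bases (u(i := w)) (\<lambda>j. if j = i then (1 / (m i \<bullet> w)) *\<^sub>R m i else m j - ((m j \<bullet> w) / (m i \<bullet> w)) *\<^sub>R m i)"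
  by unfold_locales (use assms in \<open>auto simp: dual inner_diff_left\<close>)

lemma admissible_step:
  assumes adm: "admissible N p e v q" and ne: "q \<noteq> Frac 0 1" and q': "remainder_map i (Some q) = Some q'"
  shows "admissible N p e (v(i := division_point v q)) q'" "0 < denom q'" "denom q' < denom q"
proof -
  obtain m where "dual_bases v m"
    using adm by (auto simp: admissible_def)
  then interpret dual_bases v m .
  have s: "2 \<le> denom q" "numer q $ p = 1" "v p = e" and c: "\<And>i. 0 \<le> numer q $ i \<and> numer q $ i < denom q"
    using adm ne by (auto simp: admissible_def)
  have ci: "numer q $ i > 0"
    using q' c[of i] unfolding remainder_map_Some_iff by auto
  have dq': "denom q' = numer q $ i"
    and nq': "\<And>j. numer q' $ j = (if j = i then (- denom q) mod (numer q $ i) else (numer q $ j) mod (numer q $ i))"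
    using q' unfolding remainder_map_Some_iff by auto
  show "0 < denom q'" "denom q' < denom q"
    using dq' ci c[of i] by auto
  have "m i \<bullet> division_point v q \<noteq> 0"
    using ci s by (simp add: coord_division_point)
  then have "\<exists>m'. dual_bases (v(i := division_point v q)) m'"
    using dual_bases_upd by blast
  moreover have "N = labelled_lattice (v(i := division_point v q)) q'"
    using labelled_lattice_step[OF ci _ q', of v] adm s by (simp add: admissible_def)
  \<comment> \<open>All residues modulo 1 are 0, so subdivision at an entry 1 yields a smooth
    cone.\<close>
  moreover have "q' = Frac 0 1" if "numer q $ i = 1"
  proof -
    have "numer q' = 0" "denom q' = 1"
      using nq' dq' that by (auto simp: vec_eq_iff)
    then show ?thesis
      by (metis fraction.collapse)
  qed
  moreover have "2 \<le> denom q' \<and> numer q' $ p = 1 \<and> (v(i := division_point v q)) p = e \<and>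
      (\<forall>j. 0 \<le> numer q' $ j \<and> numer q' $ j < denom q')" if "numer q $ i \<noteq> 1"
  proof -
    \<comment> \<open>The replaced index is not \<open>p\<close>, and 1 is its own residue modulo a
      number at least 2; so the entry and the generator at \<open>p\<close> survive.\<close>
    have "i \<noteq> p" "2 \<le> numer q $ i"
      using that s ci by auto
    then show ?thesis
      using s by (auto simp: nq' dq')
  qed
  ultimately show "admissible N p e (v(i := division_point v q)) q'"
    unfolding admissible_def by blast
qed

text \<open>\<open>fujiki_oka_cone\<close> extends a path at its far end. Here the first subdivision
  is outermost, which gives the recursion over the subtree below \<open>v\<close> that comparing and
  counting leaves require.\<close>

inductive resolution_cone :: "('n::finite \<Rightarrow> real ^ 'n) \<Rightarrow> 'n fraction \<Rightarrow> ('n \<Rightarrow> real ^ 'n) \<Rightarrow> bool" where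
  here: "resolution_cone v (Frac 0 1) v"
| below: "resolution_cone v q x"
  if "q \<noteq> Frac 0 1" "remainder_map i (Some q) = Some q'" "resolution_cone (v(i := division_point v q)) q' x"

lemma resolution_cone_trivial_iff: "resolution_cone v (Frac 0 1) x \<longleftrightarrow> x = v"
  using resolution_cone.cases[of v "Frac 0 1" x] by (auto intro: resolution_cone.here)

lemma resolution_cone_nontrivial_iff:
  assumes "q \<noteq> Frac 0 1"
  shows "resolution_cone v q x \<longleftrightarrow>
    (\<exists>i q'. remainder_map i (Some q) = Some q' \<and> resolution_cone (v(i := division_point v q)) q' x)"
  using assms resolution_cone.cases[of v q x] by (blast intro: resolution_cone.below)

lemma subdivision_fun_upd:
  "($) (\<chi> j. if j = i then subdivision_point u q else u $ j) = (($) u)(i := division_point (($) u) q)"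
  by (auto simp: fun_eq_iff subdivision_point_def division_point_def)

lemma fujiki_oka_cone_iff_resolution_cone:
  "fujiki_oka_cone q u (Frac 0 1) \<longleftrightarrow> resolution_cone (\<lambda>i. axis i 1) q (($) u)"
proof
  have "resolution_cone (\<lambda>i. axis i 1) q x" if "fujiki_oka_cone q u q'" "resolution_cone (($) u) q' x" for u q' x
    using that
  proof (induction arbitrary: x)
    case start
    then show ?case
      by (simp add: fun_eq_iff)
  next
    case (subdivide u q i q')
    then show ?case
      unfolding subdivision_fun_upd by (blast intro: resolution_cone.below)
  qed
  then show "fujiki_oka_cone q u (Frac 0 1) \<Longrightarrow> resolution_cone (\<lambda>i. axis i 1) q (($) u)"
    using resolution_cone.here by blast
next
  have "fujiki_oka_cone q (\<chi> i. x i) (Frac 0 1)" if "resolution_cone v q' x" "fujiki_oka_cone q (\<chi> i. v i) q'" for v q' x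
    using that
  proof induction
    case (below q'' i q' v x)
    have "fujiki_oka_cone q (\<chi> j. if j = i then subdivision_point (\<chi> i. v i) q'' else (\<chi> i. v i) $ j) q'"
      using below by (intro fujiki_oka_cone.subdivide) auto
    moreover have "(\<chi> j. if j = i then subdivision_point (\<chi> i. v i) q'' else (\<chi> i. v i) $ j)
        = (\<chi> j. (v(i := division_point v q'')) j)"
      by (simp add: vec_eq_iff subdivision_point_def division_point_def)
    ultimately show ?case
      using below by simp
  qed
  from this[of "\<lambda>i. axis i 1" q "($) u"] fujiki_oka_cone.start[of q]
  show "resolution_cone (\<lambda>i. axis i 1) q (($) u) \<Longrightarrow> fujiki_oka_cone q u (Frac 0 1)"
    by (simp add: vec_lambda_eta)
qed

lemma admissible_resolution_cone:
  assumes "resolution_cone v q x" "admissible N p e v q"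
  shows "admissible N p e x (Frac 0 1)"
  using assms by induction (simp, blast dest: admissible_step(1))

lemma admissible_coord_nonneg:
  assumes "admissible N p e v q" "dual_bases v m"
  shows "0 \<le> m j \<bullet> division_point v q"
proof -
  interpret dual_bases v m by fact
  show ?thesis
    using assms(1) by (auto simp: admissible_def coord_division_point)
qed

lemma resolution_cone_subset:
  assumes "resolution_cone v q x" "admissible N p e v q"
  shows "convex_cone hull range x \<subseteq> convex_cone hull range v"
  using assms
proof induction
  case (below q i q' v x)
  obtain m where m: "dual_bases v m"
    using below.prems by (auto simp: admissible_def)
  then interpret dual_bases v m .
  show ?case
    using below admissible_step(1)[OF below.prems] cone_upd_subset[OF admissible_coord_nonneg[OF below.prems m]]
    by blast
qed simp

section \<open>Agreement of subdivisions on common faces\<close>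

lemma Ints_in_unit_interval_eq:
  fixes x y :: real
  assumes "x - y \<in> \<int>" "0 \<le> x" "x < 1" "0 \<le> y" "y < 1"
  shows "x = y"
proof -
  obtain k where "x - y = of_int k"
    using assms(1) by (auto elim: Ints_cases)
  moreover from this have "k = 0"
    using assms by linarith
  ultimately show ?thesis
    by simp
qed

text \<open>A nontrivial label has entry 1 at the fixed index, so its subdivision point is the
  lattice point of the cone whose coordinate along the common generator \<open>e\<close> is least positive and
  whose other coordinates are fractional parts.  Hence it depends only on the face that contains it.\<close>

lemma division_point_unique_on_face:
  assumes adm: "admissible N p e v q" "admissible N p e v' q'"
    and ne: "q \<noteq> Frac 0 1" "q' \<noteq> Frac 0 1"
    and mem: "division_point v q \<in> convex_cone hull (range v \<inter> range v')"
      "division_point v' q' \<in> convex_cone hull (range v \<inter> range v')"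
  shows "division_point v q = division_point v' q'"
proof -
  obtain m m' where "dual_bases v m" "dual_bases v' m'"
    using adm by (auto simp: admissible_def)
  then interpret two_dual_bases v m v' m'
    by (rule two_dual_bases.intro)
  define w w' where "w = division_point v q" and "w' = division_point v' q'"
  define s s' where "s = denom q" and "s' = denom q'"
  have s: "2 \<le> s" "numer q $ p = 1" "v p = e" "\<And>i. 0 \<le> numer q $ i \<and> numer q $ i < s"
    using adm(1) ne by (auto simp: admissible_def s_def)
  have s': "2 \<le> s'" "numer q' $ p = 1" "v' p = e" "\<And>i. 0 \<le> numer q' $ i \<and> numer q' $ i < s'"
    using adm(2) ne by (auto simp: admissible_def s'_def)
  have ep: "v p = v' p"
    using s s' by simp
  have mw: "m j \<bullet> w = of_int (numer q $ j) / of_int s" for j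
    unfolding w_def s_def by (rule coord_division_point)
  have mw': "m' j \<bullet> w' = of_int (numer q' $ j) / of_int s'" for j
    unfolding w'_def s'_def by (rule D'.coord_division_point)
  have memw: "w \<in> convex_cone hull (range v \<inter> range v')" "w' \<in> convex_cone hull (range v \<inter> range v')"
    using mem by (simp_all add: w_def w'_def)
  have "w' \<in> labelled_lattice v q"
    using division_point_in_lattice[of v' q'] adm by (simp add: admissible_def w'_def)
  then obtain z k where zk: "w' = (\<Sum>i\<in>UNIV. of_int (z i) *\<^sub>R v i) + of_int k *\<^sub>R w"
    unfolding labelled_lattice_def w_def by blast
  have c: "m j \<bullet> w' = of_int (z j) + of_int k * of_int (numer q $ j) / of_int s" for j
    unfolding zk by (simp add: inner_add_right coord_sum mw)
  have "w \<in> labelled_lattice v' q'"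
    using division_point_in_lattice[of v q] adm by (simp add: admissible_def w_def)
  then obtain z' k' where zk': "w = (\<Sum>i\<in>UNIV. of_int (z' i) *\<^sub>R v' i) + of_int k' *\<^sub>R w'"
    unfolding labelled_lattice_def w'_def by blast
  have c': "m' j \<bullet> w = of_int (z' j) + of_int k' * of_int (numer q' $ j) / of_int s'" for j
    unfolding zk' by (simp add: inner_add_right D'.coord_sum mw')
  \<comment> \<open>The coordinate of \<open>w'\<close> along the shared generator \<open>e\<close>
    is 1 over \<open>s'\<close>. Comparison with its lattice expression over \<open>v\<close> gives
    \<open>s' dvd s\<close>, and by symmetry the denominators agree.\<close>
  have "1 / of_int s' = of_int (z p) + of_int k / real_of_int s"
    using c[of p] coord_eq[OF memw(2) ep] mw'[of p] s s' by simp
  then have "real_of_int s = of_int (s' * (z p * s + k))"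
    using s(1) s'(1) by (simp add: field_simps)
  then have e1: "s = s' * (z p * s + k)"
    using of_int_eq_iff by blast
  have "1 / of_int s = of_int (z' p) + of_int k' / real_of_int s'"
    using c'[of p] coord_eq[OF memw(1) ep] mw[of p] s s' by simp
  then have "real_of_int s' = of_int (s * (z' p * s' + k'))"
    using s(1) s'(1) by (simp add: field_simps)
  then have e2: "s' = s * (z' p * s' + k')"
    using of_int_eq_iff by blast
  have "s' dvd s" "s dvd s'"
    using e1 e2 by (metis dvd_triv_left)+
  then have ss: "s' = s"
    using s(1) s'(1) by (simp add: zdvd_antisym_nonneg)
  \<comment> \<open>Thus \<open>k\<close> is 1 modulo \<open>s\<close>, so \<open>w'\<close> and
    \<open>w\<close> differ by integer coordinates over \<open>v\<close>.\<close>
  then have k: "k = 1 - z p * s"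
    using e1 s(1) by simp
  have "m j \<bullet> w' = m j \<bullet> w" for j
  proof (rule Ints_in_unit_interval_eq)
    have "m j \<bullet> w' - m j \<bullet> w = of_int (z j - z p * numer q $ j)"
      unfolding c mw k using s(1) by (simp add: field_simps)
    then show "m j \<bullet> w' - m j \<bullet> w \<in> \<int>"
      by (metis Ints_of_int)
    show "0 \<le> m j \<bullet> w" "m j \<bullet> w < 1"
      using s(1) s(4)[of j] by (auto simp: mw)
    \<comment> \<open>The bounds for \<open>w'\<close> are known over \<open>v'\<close>; on the
      common face each coordinate over \<open>v\<close> is 0 or one of those.\<close>
    have "m j \<bullet> w' = 0 \<or> (\<exists>j'. m j \<bullet> w' = m' j' \<bullet> w')"
      using memw(2) coord_eq[OF memw(2)] mem_cone_iff[of "range v \<inter> range v'" w'] by (metis IntE image_iff inf_le1)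
    then show "0 \<le> m j \<bullet> w'" "m j \<bullet> w' < 1"
      using s'(1) s'(4) by (auto simp: mw')
  qed
  then have "w' = w"
    by (rule eqI_coord)
  then show ?thesis
    by (simp add: w_def w'_def)
qed

text \<open>The coordinate at \<open>p\<close> is 1 over a denominator at least 2. On the common
  face, this would make \<open>v p\<close> a generator of the smooth cone as well, where lattice
  points have integer coordinates.\<close>

lemma division_point_notin_smooth_face:
  assumes adm: "admissible N p e v q" "admissible N p e v' (Frac 0 1)" and ne: "q \<noteq> Frac 0 1"
  shows "division_point v q \<notin> convex_cone hull (range v \<inter> range v')"
proof
  assume mem: "division_point v q \<in> convex_cone hull (range v \<inter> range v')"
  obtain m m' where "dual_bases v m" "dual_bases v' m'"
    using adm by (auto simp: admissible_def)
  then interpret two_dual_bases v m v' m'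
    by (rule two_dual_bases.intro)
  have s: "2 \<le> denom q" "numer q $ p = 1"
    using adm(1) ne by (auto simp: admissible_def)
  have mw: "m p \<bullet> division_point v q = 1 / of_int (denom q)"
    by (simp add: coord_division_point s)
  then have "v p \<in> range v'"
    using mem mem_cone_iff[of "range v \<inter> range v'" "division_point v q"] s by force
  then obtain j where j: "v p = v' j"
    by blast
  have "division_point v q \<in> labelled_lattice v' (Frac 0 1)"
    using division_point_in_lattice[of v q] adm by (simp add: admissible_def)
  then obtain z where "division_point v q = (\<Sum>i\<in>UNIV. of_int (z i) *\<^sub>R v' i)"
    unfolding labelled_lattice_def division_point_trivial by auto
  then have "1 / of_int (denom q) = real_of_int (z j)"
    using coord_eq[OF mem j] mw D'.coord_sum[of j "\<lambda>i. of_int (z i)"] by simp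
  then have "real_of_int (z j * denom q) = of_int 1"
    using s by (simp add: field_simps)
  then have "z j * denom q = 1"
    using of_int_eq_iff by blast
  then show False
    using s by (auto simp: zmult_eq_1_iff)
qed

lemma compatible_step:
  assumes adm: "admissible N p e v q" and comp: "compatible (range v) W"
    and w: "division_point v q \<notin> convex_cone hull (range v \<inter> W)"
  shows "compatible (range (v(i := division_point v q))) W"
proof -
  obtain m where m: "dual_bases v m"
    using adm by (auto simp: admissible_def)
  then interpret dual_bases v m .
  show ?thesis
    by (rule compatible_upd[OF comp admissible_coord_nonneg[OF adm m] w])
qed

lemma compatible_step_both:
  assumes adm: "admissible N p e v q" "admissible N p e v' q'"
    and ne: "q \<noteq> Frac 0 1" "q' \<noteq> Frac 0 1"
    and rm: "remainder_map i (Some q) = Some q1" "remainder_map i' (Some q') = Some q1'"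
    and comp: "compatible (range v) (range v')"
    and mem: "division_point v q \<in> convex_cone hull (range v \<inter> range v')"
    and eq: "division_point v q = division_point v' q'"
  shows "compatible (range (v(i := division_point v q))) (range (v'(i' := division_point v' q')))"
proof -
  obtain m m' where "dual_bases v m" "dual_bases v' m'"
    using adm by (auto simp: admissible_def)
  then interpret two_dual_bases v m v' m'
    by (rule two_dual_bases.intro)
  have "m i \<bullet> division_point v q > 0" "m' i' \<bullet> division_point v' q' > 0"
    using adm ne rm unfolding remainder_map_Some_iff admissible_def coord_division_point D'.coord_division_point
    by (auto simp: less_le)
  then show ?thesis
    using compatible_upd_both[OF comp mem, of i i'] eq by simp
qed

text \<open>Induction on the sum of the denominators. A cone whose point is off the common face is
  subdivided alone; two points on it coincide, and both cones are subdivided together; a point on it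
  opposite a smooth cone is impossible.\<close>

lemma compatible_resolution_cones:
  assumes "admissible N p e v q" "admissible N p e v' q'" "compatible (range v) (range v')"
    and "resolution_cone v q x" "resolution_cone v' q' x'"
  shows "compatible (range x) (range x')"
  using assms
proof (induction "nat (denom q) + nat (denom q')" arbitrary: v q v' q' rule: less_induct)
  case less
  let ?w = "division_point v q" and ?w' = "division_point v' q'"
  let ?F = "convex_cone hull (range v \<inter> range v')"
  have FS: "range v' \<inter> range v = range v \<inter> range v'"
    by blast
  note adm = less.prems(1,2) and comp = less.prems(3) and rc = less.prems(4,5)
  consider "q = Frac 0 1" "q' = Frac 0 1" | "q \<noteq> Frac 0 1" "?w \<notin> ?F" | "q' \<noteq> Frac 0 1" "?w' \<notin> ?F"
    | "q \<noteq> Frac 0 1" "?w \<in> ?F" "q' \<noteq> Frac 0 1" "?w' \<in> ?F"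
    | "q = Frac 0 1" "q' \<noteq> Frac 0 1" "?w' \<in> ?F" | "q \<noteq> Frac 0 1" "?w \<in> ?F" "q' = Frac 0 1"
    by blast
  then show ?case
  proof cases
    case 1
    then show ?thesis
      using comp rc by (simp add: resolution_cone_trivial_iff)
  next
    case 2
    obtain i q1 where q1: "remainder_map i (Some q) = Some q1" and rc1: "resolution_cone (v(i := ?w)) q1 x"
      using rc(1) resolution_cone_nontrivial_iff[OF 2(1)] by blast
    note step = admissible_step[OF adm(1) 2(1) q1]
    show ?thesis
      by (rule less.hyps[OF _ step(1) adm(2) compatible_step[OF adm(1) comp 2(2)] rc1 rc(2)])
        (use step in linarith)
  next
    case 3
    obtain i q1 where q1: "remainder_map i (Some q') = Some q1" and rc1: "resolution_cone (v'(i := ?w')) q1 x'"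
      using rc(2) resolution_cone_nontrivial_iff[OF 3(1)] by blast
    note step = admissible_step[OF adm(2) 3(1) q1]
    have "compatible (range (v'(i := ?w'))) (range v)"
      by (rule compatible_step[OF adm(2) compatible_sym[OF comp]]) (use 3(2) FS in simp)
    then have "compatible (range v) (range (v'(i := ?w')))"
      by (rule compatible_sym)
    then show ?thesis
      by (rule less.hyps[OF _ adm(1) step(1) _ rc(1) rc1, rotated]) (use step in linarith)
  next
    case 4
    obtain i q1 where q1: "remainder_map i (Some q) = Some q1" and rc1: "resolution_cone (v(i := ?w)) q1 x"
      using rc(1) resolution_cone_nontrivial_iff[OF 4(1)] by blast
    obtain i' q1' where q1': "remainder_map i' (Some q') = Some q1'" and rc1': "resolution_cone (v'(i' := ?w')) q1' x'"
      using rc(2) resolution_cone_nontrivial_iff[OF 4(3)] by blast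
    note step = admissible_step[OF adm(1) 4(1) q1] and step' = admissible_step[OF adm(2) 4(3) q1']
    have "?w = ?w'"
      by (rule division_point_unique_on_face[OF adm 4(1,3,2,4)])
    then have "compatible (range (v(i := ?w))) (range (v'(i' := ?w')))"
      by (rule compatible_step_both[OF adm 4(1,3) q1 q1' comp 4(2)])
    then show ?thesis
      by (rule less.hyps[OF _ step(1) step'(1) _ rc1 rc1', rotated]) (use step step' in linarith)
  next
    case 5
    then show ?thesis
      using division_point_notin_smooth_face[OF adm(2) _ 5(2), of v] adm(1) 5 FS by simp
  next
    case 6
    then show ?thesis
      using division_point_notin_smooth_face[OF adm(1) _ 6(1), of v'] adm(2) 6 by simp
  qed
qed

section \<open>Leaves and their generator sets\<close>

definition resolution_generators :: "('n::finite \<Rightarrow> real ^ 'n) \<Rightarrow> 'n fraction \<Rightarrow> (real ^ 'n) set set" where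
  "resolution_generators v q = {range x | x. resolution_cone v q x}"

lemma resolution_generators_trivial: "resolution_generators v (Frac 0 1) = {range v}"
  by (auto simp: resolution_generators_def resolution_cone_trivial_iff)

lemma resolution_generators_nontrivial:
  assumes "q \<noteq> Frac 0 1"
  shows "resolution_generators v q =
    (\<Union>i\<in>{i. numer q $ i \<noteq> 0}.
       resolution_generators (v(i := division_point v q)) (the (remainder_map i (Some q))))"
proof -
  have rm: "remainder_map i (Some q) = Some (the (remainder_map i (Some q))) \<longleftrightarrow> numer q $ i \<noteq> 0" for i
    by (cases q) auto
  show ?thesis
  proof (intro equalityI subsetI)
    fix V assume "V \<in> resolution_generators v q"
    then obtain i q' x where *: "V = range x" "remainder_map i (Some q) = Some q'"
      "resolution_cone (v(i := division_point v q)) q' x"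
      unfolding resolution_generators_def resolution_cone_nontrivial_iff[OF assms] by blast
    then have "the (remainder_map i (Some q)) = q'"
      by simp
    moreover have "numer q $ i \<noteq> 0"
      using *(2) unfolding remainder_map_Some_iff by blast
    ultimately show "V \<in> (\<Union>i\<in>{i. numer q $ i \<noteq> 0}.
       resolution_generators (v(i := division_point v q)) (the (remainder_map i (Some q))))"
      unfolding resolution_generators_def using * by blast
  next
    fix V assume "V \<in> (\<Union>i\<in>{i. numer q $ i \<noteq> 0}.
       resolution_generators (v(i := division_point v q)) (the (remainder_map i (Some q))))"
    then obtain i x where "numer q $ i \<noteq> 0" "V = range x"
      "resolution_cone (v(i := division_point v q)) (the (remainder_map i (Some q))) x"
      unfolding resolution_generators_def by blast
    then show "V \<in> resolution_generators v q"
      unfolding resolution_generators_def resolution_cone_nontrivial_iff[OF assms] using rm[of i] by blast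
  qed
qed

text \<open>Sibling cones are compatible, so a common leaf would lie in their common face. That face
  omits the generator \<open>v j\<close>, and so a nonzero functional would vanish on all generators
  of the leaf, which span the space.\<close>

lemma resolution_generators_disjoint:
  assumes adm: "admissible N p e v q" and ne: "q \<noteq> Frac 0 1" and ij: "i \<noteq> j"
    and qi: "remainder_map i (Some q) = Some qi" and qj: "remainder_map j (Some q) = Some qj"
  shows "resolution_generators (v(i := division_point v q)) qi \<inter>
    resolution_generators (v(j := division_point v q)) qj = {}"
proof (rule ccontr)
  define w where "w = division_point v q"
  assume "\<not> ?thesis"
  then obtain x x' where x: "resolution_cone (v(i := w)) qi x" "resolution_cone (v(j := w)) qj x'" "range x = range x'"
    unfolding resolution_generators_def w_def by auto
  note admi = admissible_step(1)[OF adm ne qi, folded w_def] and admj = admissible_step(1)[OF adm ne qj, folded w_def]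
  obtain m where m: "dual_bases v m"
    using adm by (auto simp: admissible_def)
  then interpret dual_bases v m .
  obtain m1 where "dual_bases (v(i := w)) m1"
    using admi by (auto simp: admissible_def)
  then interpret D1: dual_bases "v(i := w)" m1 .
  obtain mx where "dual_bases x mx"
    using admissible_resolution_cone[OF x(1) admi] by (auto simp: admissible_def)
  then interpret Dx: dual_bases x mx .
  have "w \<in> convex_cone hull (range v \<inter> range v)"
    using mem_cone_iff[of "range v" w] admissible_coord_nonneg[OF adm m] by (simp add: w_def)
  then have comp: "compatible (range (v(i := w))) (range (v(j := w)))"
    using compatible_step_both[OF adm adm ne ne qi qj] by (simp add: w_def compatible_def)
  have "m i \<bullet> w \<noteq> 0"
    using qi adm ne by (auto simp: w_def coord_division_point remainder_map_Some_iff admissible_def)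
  \<comment> \<open>The coordinate of \<open>w\<close> at \<open>i\<close> is nonzero, that of
    \<open>v j\<close> is 0.\<close>
  then have "w \<noteq> v j"
    using ij by (auto simp: dual)
  then have notin: "v j \<notin> range (v(j := w))"
    using inj_u by (auto simp: inj_eq)
  have "m1 j \<bullet> x k = 0" for k
  proof -
    have "x k \<in> convex_cone hull range x"
      by (rule hull_inc) blast
    then have "x k \<in> convex_cone hull range (v(i := w))"
      using resolution_cone_subset[OF x(1) admi] by blast
    moreover have "x k \<in> convex_cone hull range (v(j := w))"
      using resolution_cone_subset[OF x(2) admj] \<open>x k \<in> convex_cone hull range x\<close> unfolding x(3) by blast
    ultimately have "x k \<in> convex_cone hull (range (v(i := w)) \<inter> range (v(j := w)))"
      using comp unfolding compatible_def by blast
    moreover have "(v(i := w)) j \<notin> range (v(i := w)) \<inter> range (v(j := w))"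
      using notin ij by simp
    ultimately show ?thesis
      using D1.mem_cone_iff[of "range (v(i := w)) \<inter> range (v(j := w))" "x k"] by blast
  qed
  then have "m1 j = 0"
    using Dx.dual_expand[of "m1 j"] by simp
  then show False
    using D1.dual[of j j] by simp
qed

section \<open>Heights of remainder polynomials and the number of leaves\<close>

lemma fold_remainder_map_None: "fold remainder_map w None = None"
  by (induction w) auto

lemma remainder_polynomial_Nil: "q \<noteq> Frac 0 1 \<Longrightarrow> remainder_polynomial q [] = Some q"
  by (simp add: remainder_polynomial_def)

lemma remainder_polynomial_Cons:
  "remainder_polynomial q (i # w) =
     (if numer q $ i = 0 then None else remainder_polynomial (the (remainder_map i (Some q))) w)"
  by (cases q) (auto simp: remainder_polynomial_def fold_remainder_map_None)

lemma remainder_polynomial_trivial: "dom (remainder_polynomial (Frac 0 1)) = {}"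
proof -
  have "remainder_polynomial (Frac 0 1) w = None" for w :: "'a list"
    by (cases w) (simp_all add: remainder_polynomial_Cons, simp add: remainder_polynomial_def)
  then show ?thesis
    by (simp add: dom_def)
qed

lemma dom_remainder_polynomial:
  assumes "q \<noteq> Frac 0 1"
  shows "dom (remainder_polynomial q) = insert []
    (\<Union>i\<in>{i. numer q $ i \<noteq> 0}. (#) i ` dom (remainder_polynomial (the (remainder_map i (Some q)))))"
    (is "_ = insert [] ?B")
proof (rule Set.set_eqI)
  fix w
  show "w \<in> dom (remainder_polynomial q) \<longleftrightarrow> w \<in> insert [] ?B"
    by (cases w) (auto simp: remainder_polynomial_Nil[OF assms] remainder_polynomial_Cons dom_def)
qed

text \<open>Apart from the constant term, monomials are sorted by their first letter; those starting
  with \<open>i\<close> carry the coefficients of the polynomial of the child at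
  \<open>i\<close>.\<close>

lemma poly_height_nontrivial:
  assumes ne: "q \<noteq> Frac 0 1"
    and fin: "\<And>i. numer q $ i \<noteq> 0 \<Longrightarrow> finite (dom (remainder_polynomial (the (remainder_map i (Some q)))))"
  shows "poly_height (remainder_polynomial q) = height q +
    (\<Sum>i | numer q $ i \<noteq> 0. poly_height (remainder_polynomial (the (remainder_map i (Some q)))))"
proof -
  define I where "I = {i. numer q $ i \<noteq> 0}"
  define B where "B i = (#) i ` dom (remainder_polynomial (the (remainder_map i (Some q))))" for i
  have finB: "finite (B i)" if "i \<in> I" for i
    using fin that by (simp add: I_def B_def)
  have "poly_height (remainder_polynomial q) =
      (\<Sum>w\<in>insert [] (\<Union>i\<in>I. B i). height (the (remainder_polynomial q w)))"
    unfolding poly_height_def dom_remainder_polynomial[OF ne] I_def B_def ..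
  also have "\<dots> = height q + (\<Sum>w\<in>(\<Union>i\<in>I. B i). height (the (remainder_polynomial q w)))"
    using finB by (subst sum.insert) (auto simp: B_def remainder_polynomial_Nil[OF ne])
  also have "(\<Sum>w\<in>(\<Union>i\<in>I. B i). height (the (remainder_polynomial q w))) =
      (\<Sum>i\<in>I. \<Sum>w\<in>B i. height (the (remainder_polynomial q w)))"
    using finB by (intro sum.UNION_disjoint) (auto simp: B_def)
  also have "\<dots> = (\<Sum>i\<in>I. poly_height (remainder_polynomial (the (remainder_map i (Some q)))))"
    unfolding B_def poly_height_def
    by (rule sum.cong, rule refl, subst sum.reindex) (auto simp: remainder_polynomial_Cons I_def)
  finally show ?thesis
    by (simp add: I_def)
qed

lemma card_resolution_generators:
  assumes "admissible N p e v q"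
  shows "finite (dom (remainder_polynomial q)) \<and> finite (resolution_generators v q) \<and>
    int (card (resolution_generators v q)) = poly_height (remainder_polynomial q) + denom q"
  using assms
proof (induction "nat (denom q)" arbitrary: v q rule: less_induct)
  case less
  show ?case
  proof (cases "q = Frac 0 1")
    case True
    \<comment> \<open>A smooth cone is a single leaf with empty polynomial; its denominator 1
      accounts for the count.\<close>
    have "dom (remainder_polynomial q) = {}"
      unfolding True by (rule remainder_polynomial_trivial)
    then show ?thesis
      by (simp add: True resolution_generators_trivial poly_height_def)
  next
    case ne: False
    define I where "I = {i. numer q $ i \<noteq> 0}"
    define c where "c i = the (remainder_map i (Some q))" for i
    define w where "w = division_point v q"
    have rm: "remainder_map i (Some q) = Some (c i)" "denom (c i) = numer q $ i" if "i \<in> I" for i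
      using that by (cases q; simp add: I_def c_def)+
    have IH: "finite (dom (remainder_polynomial (c i))) \<and> finite (resolution_generators (v(i := w)) (c i)) \<and>
        int (card (resolution_generators (v(i := w)) (c i))) = poly_height (remainder_polynomial (c i)) + denom (c i)"
      if i: "i \<in> I" for i
      unfolding w_def using admissible_step[OF less.prems ne rm(1)[OF i]]
      by (intro less.hyps) auto
    have gens: "resolution_generators v q = (\<Union>i\<in>I. resolution_generators (v(i := w)) (c i))"
      unfolding resolution_generators_nontrivial[OF ne] I_def c_def w_def ..
    have "card (resolution_generators v q) = (\<Sum>i\<in>I. card (resolution_generators (v(i := w)) (c i)))"
      unfolding gens
    proof (rule card_UN_disjoint)
      show "\<forall>i\<in>I. \<forall>j\<in>I. i \<noteq> j \<longrightarrow>
          resolution_generators (v(i := w)) (c i) \<inter> resolution_generators (v(j := w)) (c j) = {}"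
        unfolding w_def using resolution_generators_disjoint[OF less.prems ne] rm(1) by blast
    qed (use IH in auto)
    then have "int (card (resolution_generators v q)) =
        (\<Sum>i\<in>I. poly_height (remainder_polynomial (c i))) + (\<Sum>i\<in>I. numer q $ i)"
      using IH rm(2) by (simp add: sum.distrib)
    \<comment> \<open>An index with numerator 0 has no child and adds nothing, so the denominators
      of the children add up to the sum of all numerators.\<close>
    also have "(\<Sum>i\<in>I. numer q $ i) = height q + denom q"
      unfolding height_def I_def by (simp add: sum.mono_neutral_left)
    also have "(\<Sum>i\<in>I. poly_height (remainder_polynomial (c i))) + (height q + denom q) =
        poly_height (remainder_polynomial q) + denom q"
      using poly_height_nontrivial[OF ne] IH by (simp add: I_def c_def)
    finally have "int (card (resolution_generators v q)) = poly_height (remainder_polynomial q) + denom q" .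
    moreover have "finite (dom (remainder_polynomial q))"
      unfolding dom_remainder_polynomial[OF ne] using IH by (auto simp: I_def c_def)
    moreover have "finite (resolution_generators v q)"
      unfolding gens using IH by auto
    ultimately show ?thesis
      by blast
  qed
qed

section \<open>The starting cone and the Euler characteristic of the resolution\<close>

lemma dual_bases_axis: "dual_bases (\<lambda>i. axis i 1) (\<lambda>i :: 'n::finite. axis i 1)"
  by unfold_locales (auto simp: inner_axis_axis)

lemma sum_scaleR_axis: "(\<Sum>i\<in>UNIV. c i *\<^sub>R axis i 1) = ((\<chi> i. c i) :: real ^ 'n::finite)"
  by (simp add: vec_eq_iff axis_def if_distrib cong: if_cong)

lemma fraction_lattice_eq: "fraction_lattice q = labelled_lattice (\<lambda>i. axis i 1) q"
proof -
  have eq: "(\<Sum>i\<in>UNIV. of_int (z i) *\<^sub>R axis i 1) + of_int k *\<^sub>R division_point (\<lambda>i. axis i 1) q =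
      (\<chi> i. of_int (z i) + of_int k * (of_int (numer q $ i) / of_int (denom q)))" for z k
    unfolding division_point_def sum_scaleR_axis by (simp add: vec_eq_iff)
  have "\<exists>z' k'. (\<chi> i. real_of_int (z $ i) + of_int k * (of_int (numer q $ i) / of_int (denom q))) =
      (\<chi> i. real_of_int (z' i) + of_int k' * (of_int (numer q $ i) / of_int (denom q)))" for z :: "int ^ 'a" and k
    by (intro exI[of _ "\<lambda>i. z $ i"] exI[of _ k]) simp
  moreover have "\<exists>z' k'. (\<chi> i. real_of_int (z i) + of_int k * (of_int (numer q $ i) / of_int (denom q))) =
      (\<chi> i. real_of_int (z' $ i) + of_int k' * (of_int (numer q $ i) / of_int (denom q)))" for z :: "'a \<Rightarrow> int" and k
    by (intro exI[of _ "\<chi> i. z i"] exI[of _ k]) simp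
  ultimately show ?thesis
    unfolding fraction_lattice_def labelled_lattice_def eq by blast
qed

theorem theorem1p4:
  fixes a :: "int ^ 'n" and r :: int and i\<^sub>1 :: 'n
  assumes "r \<ge> 2"
    and "a $ i\<^sub>1 = 1"
    and "\<And>i. i \<noteq> i\<^sub>1 \<Longrightarrow> 0 \<le> a $ i \<and> a $ i \<le> r - 1"
  shows "has_finite_homology (fujiki_oka_variety (Frac a r)) \<and>
    euler_characteristic (fujiki_oka_variety (Frac a r)) =
      poly_height (remainder_polynomial (Frac a r)) + r"
proof -
  define q where "q = Frac a r"
  define N where "N = fraction_lattice q"
  let ?v = "\<lambda>i :: 'n. axis i (1 :: real)"
  \<comment> \<open>At \<open>i\<^sub>1\<close> the bounds come from the entry 1 and
    \<open>r \<ge> 2\<close>.\<close>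
  have "0 \<le> a $ i \<and> a $ i < r" for i
    using assms(1,2) assms(3)[of i] by (cases "i = i\<^sub>1") auto
  then have adm: "admissible N i\<^sub>1 (axis i\<^sub>1 1) ?v q"
    unfolding admissible_def N_def using fraction_lattice_eq[of q] dual_bases_axis assms(1,2)
    by (auto simp: q_def)
  \<comment> \<open>All subsets of the generator sets of leaves, which generate exactly the faces;
    the empty set gives the zero cone.\<close>
  define \<V> where "\<V> = {V. \<exists>x. resolution_cone ?v q x \<and> V \<subseteq> range x}"
  have leaf: "\<exists>m. lattice_chart x m N" if "resolution_cone ?v q x" for x
  proof -
    have x: "admissible N i\<^sub>1 (axis i\<^sub>1 1) x (Frac 0 1)"
      using admissible_resolution_cone[OF that adm] .
    then obtain m where "dual_bases x m"
      by (auto simp: admissible_def)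
    moreover have "N = {\<Sum>i\<in>UNIV. of_int (z i) *\<^sub>R x i | z. True}"
      using x unfolding admissible_def labelled_lattice_def division_point_trivial by auto
    ultimately show ?thesis
      by (auto simp: lattice_chart_def lattice_chart_axioms_def)
  qed
  have card: "finite (resolution_generators ?v q)"
    "int (card (resolution_generators ?v q)) = poly_height (remainder_polynomial q) + r"
    using card_resolution_generators[OF adm] by (simp_all add: q_def)
  interpret smooth_fan N \<V>
  proof
    have "\<V> = (\<Union>R\<in>resolution_generators ?v q. Pow R)"
      unfolding \<V>_def resolution_generators_def by blast
    moreover have "finite R" if "R \<in> resolution_generators ?v q" for R
      using that by (auto simp: resolution_generators_def)
    ultimately show "finite \<V>"
      using card(1) by auto
    show "\<exists>u m. lattice_chart u m N \<and> V \<subseteq> range u" if "V \<in> \<V>" for V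
      using that leaf unfolding \<V>_def by blast
    show "V \<inter> W \<in> \<V>" if "V \<in> \<V>" "W \<in> \<V>" for V W
      using that unfolding \<V>_def by blast
    show "cone_hull V \<inter> cone_hull W = cone_hull (V \<inter> W)" if VW: "V \<in> \<V>" "W \<in> \<V>" for V W
    proof -
      obtain x x' where x: "resolution_cone ?v q x" "V \<subseteq> range x" and x': "resolution_cone ?v q x'" "W \<subseteq> range x'"
        using VW unfolding \<V>_def by blast
      obtain m m' where "dual_bases x m" "dual_bases x' m'"
        using leaf[OF x(1)] leaf[OF x'(1)] by (auto simp: lattice_chart_def)
      then interpret two_dual_bases x m x' m'
        by (rule two_dual_bases.intro)
      \<comment> \<open>Both leaves descend from the same starting cone, which is compatible with
        itself.\<close>
      have "compatible (range x) (range x')"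
        by (rule compatible_resolution_cones[OF adm adm _ x(1) x'(1)]) (simp add: compatible_def)
      from compatible_subset[OF this x(2) x'(2)] show ?thesis
        by (simp add: compatible_def)
    qed
  qed
  have "fujiki_oka_fan q = (hull) convex_cone ` \<V>"
  proof (rule Set.set_eqI)
    fix \<tau>
    have "\<tau> \<in> fujiki_oka_fan q \<longleftrightarrow>
        (\<exists>x. resolution_cone ?v q x \<and> \<tau> \<noteq> {} \<and> \<tau> face_of (convex_cone hull range x))"
      unfolding fujiki_oka_fan_def fujiki_oka_cone_iff_resolution_cone
      by (auto intro: exI[of _ "vec_lambda _"] simp: vec_lambda_inverse)
    also have "\<dots> \<longleftrightarrow> (\<exists>x. resolution_cone ?v q x \<and> (\<exists>V\<subseteq>range x. \<tau> = convex_cone hull V))"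
      using leaf dual_bases.face_of_cone_iff unfolding lattice_chart_def by meson
    also have "\<dots> \<longleftrightarrow> \<tau> \<in> (hull) convex_cone ` \<V>"
      unfolding \<V>_def by blast
    finally show "\<tau> \<in> fujiki_oka_fan q \<longleftrightarrow> \<tau> \<in> (hull) convex_cone ` \<V>" .
  qed
  then have Y: "fujiki_oka_variety q = Y"
    by (simp add: fujiki_oka_variety_def N_def)
  \<comment> \<open>The generators of a leaf are distinct, so a subset with n elements is the whole
    set.\<close>
  have "{V\<in>\<V>. card V = CARD('n)} = resolution_generators ?v q"
  proof -
    have "card (range x) = CARD('n)" if "resolution_cone ?v q x" for x
      using leaf[OF that] dual_bases.inj_u unfolding lattice_chart_def by (metis card_image)
    then have "V = range x" if "resolution_cone ?v q x" "V \<subseteq> range x" "card V = CARD('n)" for V x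
      using that by (metis card_subset_eq finite finite_imageI)
    with \<open>\<And>x. resolution_cone ?v q x \<Longrightarrow> card (range x) = CARD('n)\<close> show ?thesis
      unfolding \<V>_def resolution_generators_def by blast
  qed
  then have "euler_pair (fujiki_oka_variety q) {} (poly_height (remainder_polynomial q) + r)"
    using euler_pair_toric_variety card(2) Y by simp
  then show ?thesis
    unfolding q_def by (rule euler_pair_imp_euler_characteristic)
qed

end
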